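(* Let $R$ be a finite local principal ideal ring of signature $(a,e,f,p,\Delta)$, with set of uniformizers $U$ and coefficient ring $R_\omega$. Assume $a>e$. Let $T_\times$, $\nabla$, $g$ and the substitution products $*$ be as defined in the context. (1) $*$ is a group action of $T_\times=(R_\omega[Y]/(Y^a))^\times$, equipped with the substitution product group structure, on the set $\nabla=\{q\in R_\omega[Y]\mid\deg(q)=e\text{ and }q\text{ is }p\text{-Eisenstein}\}$. (2) $\Delta$ is a union of orbits in $\nabla$ under this action. (3) If $R$ is neat, $\Delta$ is the orbit of the Eisenstein polynomial $g$. (4) If $q\in\Delta$ then every $u\in U$ is a zero of some polynomial in the orbit of $q$ under $T_\times$. (5) The polynomials in an orbit all have the same number of zeroes in $R$. (6) The group $T_\times$ equally acts on $U$, through $t*u:=t(u)u$. This action is transitive. (7) If $q\in\Delta$, $u\in U$ and $q(u)=0$, then $(t*q)(t*u)=0$ for all $t\in T_\times$. (8) If $R$ is neat, the map $U\to\Delta$ sending $u$ to the unique $q$ with $q(u)=0$ is an epimorphism of $T_\times$-sets. (9) If $R$ is neat, the isomorphism classes of the finite local principal ideal rings of type $(a,e,f,p)$ are in one-to-one correspondence with the orbits of $T_\times$ in $\nabla$.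
   Context: All rings are commutative with 1. For a finite local principal ideal ring $R$ with maximal ideal $\mathfrak{p}$: $k=R/\mathfrak{p}$, $p=\mathrm{char}(k)$, $f=[k:\mathbb{F}_p]$; $a$ is the least positive integer with $\mathfrak{p}^a=0$; for $0\ne r\in R$, $\mathrm{ord}_{\mathfrak{p}}(r)=n$ iff $r\in\mathfrak{p}^n\setminus\mathfrak{p}^{n+1}$, and $\mathrm{ord}_{\mathfrak{p}}(0)=a$; $e=\mathrm{ord}_{\mathfrak{p}}(p)$. The type of $R$ is $(a,e,f,p)$. $U=\{u\in R\mid\mathrm{ord}_{\mathfrak{p}}(u)=1\}$ is the set of uniformizers. When $a>e$, $R$ is called neat if $e\mid a$. Put $\rho=\{r\in R\mid r^{p^f}=r\}$ (a system of representatives of $R/\mathfrak{p}$). The coefficient ring $R_\omega$ of $R$ is the subring of $R$ generated by $\rho$; it is a finite local principal ideal ring with maximal ideal $pR_\omega$, and up to isomorphism it depends only on $\lceil a/e\rceil$, $f$, $p$. $\nabla$ is the set of monic $q\in R_\omega[Y]$ of degree $e$ with all non-leading coefficients in $pR_\omega$ and constant term in $pR_\omega\setminus p^2R_\omega$ ($p$-Eisenstein polynomials of degree $e$). $\Delta=\{q\in\nabla\mid q\text{ has a zero in }R\}$. The signature of $R$ is $(a,e,f,p,\Delta)$. Definition of $g$: fix a uniformizer $\pi\in U$ and a unit $\varepsilon\in R^\times$ with $p=\varepsilon\pi^e$; write (uniquely) $\varepsilon=\sum_{i=0}^{a-1}r_i\pi^i$ with $r_i\in\rho$; put $\tilde\varepsilon(Y)=\sum_{i=0}^{a-e-1}r_iY^i\in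 R_\omega[Y]$ and $g_0(Y)=Y^a+\tilde\varepsilon(Y)Y^e-p$. By Hensel's Lemma $g_0$ factors uniquely in $R_\omega[Y]$ as $g_0=g\,g_1$ with $g,g_1$ monic, $g\equiv Y^e$ and $g_1\equiv Y^{a-e}+\tilde\varepsilon(Y)$ mod $p$; this defines $g$, which lies in $\nabla$. $T=R_\omega[Y]/(Y^a)$; its units are the classes of $t\in R_\omega[Y]$ with $t(0)\in R_\omega^\times$. $T_\times$ is the set $T^\times$ with the substitution product $t_1*t_2=t_1(t_2(Y)Y)\cdot t_2(Y)$, which makes it a group. For $t\in T_\times$ and $q\in\nabla$, $t*q\in R_\omega[Y]$ is obtained by replacing $Z$ by $Y$ in the resultant $\mathrm{res}_Y(q(Y),\,Z-t(Y)Y)\in R_\omega[Z]$, with $t$ replaced by any representative in $R_\omega[Y]$ (the result does not depend on the choice). Here, since $q$ is monic, if $q=\prod_{i=1}^e(Y-u_i)$ over a ring extension $B$ of $R_\omega[Z]$, then $\mathrm{res}_Y(q(Y),w(Y))=\prod_{i=1}^e w(u_i)$. For $u\in U$, $t(u)$ is computed from any representative of $t$ (well defined as $u^a=0$).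
   Formalization: In (9) rings carry an identification of their coefficient ring with R_ω, and isomorphisms must respect it; with plain ring isomorphisms (9) can fail for f>1, e.g. type (6,3,2,2): three orbits, but Frobenius identifies two of the rings. *)

theory Defs
  imports
    "HOL-Algebra.Group_Action"
    "HOL-Algebra.QuotRing"
    "HOL-Algebra.Ideal_Product"
    "HOL-Algebra.Generated_Rings"
    "HOL-Algebra.Generated_Fields"
    "HOL-Algebra.Embedded_Algebras"
    "HOL-Algebra.Algebraic_Closure_Type"
    "Subresultants.Resultant_Prelim"
begin

section \<open>Finite local principal ideal rings and their type\<close>

definition finite_local_pir :: "('r, 'm) ring_scheme \<Rightarrow> bool" where
  "finite_local_pir S \<longleftrightarrow>
     cring S \<and> finite (carrier S) \<and> (\<exists>!M. maximalideal M S) \<and>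
     (\<forall>I. ideal I S \<longrightarrow> principalideal I S)"

definition max_ideal :: "('r, 'm) ring_scheme \<Rightarrow> 'r set" where
  "max_ideal S = (THE M. maximalideal M S)"

definition residue_field :: "('r, 'm) ring_scheme \<Rightarrow> 'r set ring" where
  "residue_field S = S Quot max_ideal S"

definition residue_char :: "('r, 'm) ring_scheme \<Rightarrow> nat" where
  "residue_char S =
     (LEAST n. 0 < n \<and> [n] \<cdot>\<^bsub>residue_field S\<^esub> \<one>\<^bsub>residue_field S\<^esub> = \<zero>\<^bsub>residue_field S\<^esub>)"

text \<open>The field generated by the empty set is the prime field.\<close>

definition residue_degree :: "('r, 'm) ring_scheme \<Rightarrow> nat" where
  "residue_degree S =
     ring.dim (residue_field S) (generate_field (residue_field S) {}) (carrier (residue_field S))"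

text \<open>Powers of ideals are powers in the multiplicative monoid of all ideals.\<close>

definition max_ideal_pow :: "('r, 'm) ring_scheme \<Rightarrow> nat \<Rightarrow> 'r set" where
  "max_ideal_pow S n = max_ideal S [^]\<^bsub>ideals_set S\<^esub> n"

definition nilpotency_index :: "('r, 'm) ring_scheme \<Rightarrow> nat" where
  "nilpotency_index S = (LEAST n. 0 < n \<and> max_ideal_pow S n = {\<zero>\<^bsub>S\<^esub>})"

definition max_ideal_ord :: "('r, 'm) ring_scheme \<Rightarrow> 'r \<Rightarrow> nat" where
  "max_ideal_ord S r =
     (if r = \<zero>\<^bsub>S\<^esub> then nilpotency_index S
      else (THE n. r \<in> max_ideal_pow S n - max_ideal_pow S (Suc n)))"

definition ramification_index :: "('r, 'm) ring_scheme \<Rightarrow> nat" where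
  "ramification_index S = max_ideal_ord S ([residue_char S] \<cdot>\<^bsub>S\<^esub> \<one>\<^bsub>S\<^esub>)"

definition type_of_ring :: "('r, 'm) ring_scheme \<Rightarrow> nat \<times> nat \<times> nat \<times> nat" where
  "type_of_ring S = (nilpotency_index S, ramification_index S, residue_degree S, residue_char S)"

definition neat :: "('r, 'm) ring_scheme \<Rightarrow> bool" where
  "neat S \<longleftrightarrow> ramification_index S dvd nilpotency_index S"

definition uniformizers :: "('r, 'm) ring_scheme \<Rightarrow> 'r set" where
  "uniformizers S = {u \<in> carrier S. max_ideal_ord S u = 1}"

definition residue_reps :: "('r, 'm) ring_scheme \<Rightarrow> 'r set" where
  "residue_reps S =
     {r \<in> carrier S. r [^]\<^bsub>S\<^esub> (residue_char S ^ residue_degree S) = r}"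

definition coeff_ring :: "('r, 'm) ring_scheme \<Rightarrow> ('r, 'm) ring_scheme" where
  "coeff_ring S = S\<lparr>carrier := generate_ring S (residue_reps S)\<rparr>"


section \<open>Eisenstein polynomials and the signature\<close>

text \<open>
  From here on the ring \<open>R\<close> under consideration is a whole type \<open>'a\<close> of class
  \<open>comm_ring_1\<close>, so that polynomials and resultants are those of the type-class library;
  \<open>whole\<close> is \<open>R\<close> as a ring structure. Constants whose type mentions \<open>'a\<close> depend on \<open>R\<close>
  through \<open>'a\<close>. Polynomials over the coefficient ring are the polynomials over \<open>'a\<close> all of
  whose coefficients lie in it.
\<close>

abbreviation whole :: "'a::comm_ring_1 ring" where
  "whole \<equiv> ring_of_type_algebra"

definition coeff_ring_polys :: "'a::comm_ring_1 poly ring" where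
  "coeff_ring_polys =
     (whole :: 'a poly ring)\<lparr>carrier := {q. \<forall>i. coeff q i \<in> carrier (coeff_ring (whole :: 'a ring))}\<rparr>"

definition p_multiples :: "nat \<Rightarrow> 'a::comm_ring_1 set" where
  "p_multiples n =
     (\<lambda>x. of_nat (residue_char (whole :: 'a ring)) ^ n * x) ` carrier (coeff_ring (whole :: 'a ring))"

definition eisenstein_polys :: "'a::comm_ring_1 poly set" where
  "eisenstein_polys =
     {q \<in> carrier coeff_ring_polys.
        degree q = ramification_index (whole :: 'a ring) \<and> lead_coeff q = 1 \<and>
        (\<forall>i < degree q. coeff q i \<in> p_multiples 1) \<and>
        coeff q 0 \<in> p_multiples 1 - p_multiples 2}"

definition eisenstein_with_zero :: "'a::comm_ring_1 poly set" where
  "eisenstein_with_zero = {q \<in> eisenstein_polys. \<exists>x. poly q x = 0}"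

definition signature :: "nat \<times> nat \<times> nat \<times> nat \<times> 'a::comm_ring_1 poly set" where
  "signature =
     (nilpotency_index (whole :: 'a ring), ramification_index (whole :: 'a ring),
      residue_degree (whole :: 'a ring), residue_char (whole :: 'a ring), eisenstein_with_zero)"


section \<open>The Eisenstein polynomial attached to a uniformizer\<close>

definition digits :: "'a::comm_ring_1 \<Rightarrow> 'a \<Rightarrow> nat \<Rightarrow> 'a" where
  "digits \<pi> x =
     (let a = nilpotency_index (whole :: 'a ring)
      in THE r. (\<forall>i<a. r i \<in> residue_reps whole) \<and> (\<forall>i\<ge>a. r i = 0) \<and> x = (\<Sum>i<a. r i * \<pi> ^ i))"

definition digit_poly :: "'a::comm_ring_1 \<Rightarrow> 'a \<Rightarrow> 'a poly" where
  "digit_poly \<pi> \<epsilon> =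
     (\<Sum>i < nilpotency_index (whole :: 'a ring) - ramification_index (whole :: 'a ring).
        monom (digits \<pi> \<epsilon> i) i)"

definition cong_mod_p :: "'a::comm_ring_1 poly \<Rightarrow> 'a poly \<Rightarrow> bool" where
  "cong_mod_p q q' \<longleftrightarrow> (\<forall>i. coeff (q - q') i \<in> p_multiples 1)"

definition hensel_factor :: "'a::comm_ring_1 \<Rightarrow> 'a \<Rightarrow> 'a poly" where
  "hensel_factor \<pi> \<epsilon> =
     (let a = nilpotency_index (whole :: 'a ring);
          e = ramification_index (whole :: 'a ring);
          g0 = monom 1 a + digit_poly \<pi> \<epsilon> * monom 1 e - of_nat (residue_char (whole :: 'a ring))
      in THE g. g \<in> carrier coeff_ring_polys \<and> lead_coeff g = 1 \<and> cong_mod_p g (monom 1 e) \<and>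
           (\<exists>g1 \<in> carrier coeff_ring_polys. lead_coeff g1 = 1 \<and>
              cong_mod_p g1 (monom 1 (a - e) + digit_poly \<pi> \<epsilon>) \<and> g0 = g * g1))"


section \<open>The substitution group and its actions\<close>

definition trunc_ideal :: "'a::comm_ring_1 poly set" where
  "trunc_ideal = PIdl\<^bsub>coeff_ring_polys\<^esub> (monom 1 (nilpotency_index (whole :: 'a ring)))"

definition trunc_ring :: "'a::comm_ring_1 poly set ring" where
  "trunc_ring = coeff_ring_polys Quot trunc_ideal"

text \<open>
  Operations on residue classes are defined through all representatives: a union of classes,
  or the only element of an image. Both carry the intended value exactly when the result is
  independent of the representatives.
\<close>

definition subst_mult :: "'a::comm_ring_1 poly set \<Rightarrow> 'a poly set \<Rightarrow> 'a poly set" where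
  "subst_mult T1 T2 =
     (\<Union>t1\<in>T1. \<Union>t2\<in>T2. trunc_ideal +>\<^bsub>coeff_ring_polys\<^esub> (pcompose t1 (t2 * [:0, 1:]) * t2))"

definition subst_group :: "'a::comm_ring_1 poly set monoid" where
  "subst_group =
     \<lparr>carrier = Units trunc_ring, monoid.mult = subst_mult, one = \<one>\<^bsub>trunc_ring\<^esub>\<rparr>"

text \<open>
  The resultant eliminates \<open>Y\<close>: it is taken in \<open>R[Z][Y]\<close>, the outer polynomial variable
  being \<open>Y\<close> and the inner one \<open>Z\<close>, so \<open>Z\<close> is \<open>[:[:0, 1:]:]\<close>. The Sylvester determinant gives
  \<open>resultant q w = \<Prod>i. w (u i)\<close> for monic \<open>q\<close> with roots \<open>u i\<close>.
\<close>

definition subst_resultant :: "'a::comm_ring_1 poly \<Rightarrow> 'a poly \<Rightarrow> 'a poly" where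
  "subst_resultant t q =
     resultant (map_poly (\<lambda>c. [:c:]) q) ([:[:0, 1:]:] - map_poly (\<lambda>c. [:c:]) (t * [:0, 1:]))"

definition poly_action :: "'a::comm_ring_1 poly set \<Rightarrow> 'a poly \<Rightarrow> 'a poly" where
  "poly_action T = (\<lambda>q\<in>eisenstein_polys. the_elem ((\<lambda>t. subst_resultant t q) ` T))"

definition unif_action :: "'a::comm_ring_1 poly set \<Rightarrow> 'a \<Rightarrow> 'a" where
  "unif_action T = (\<lambda>u\<in>uniformizers whole. the_elem ((\<lambda>t. poly t u * u) ` T))"


section \<open>Isomorphism classes of rings of the same type\<close>

text \<open>
  Rings of a given type are taken together with an identification \<open>\<iota>\<close> of their coefficient ring
  with that of \<open>R\<close>, and isomorphisms respect these identifications. This is what gives sense to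
  comparing the sets of Eisenstein polynomials with a zero for different rings, all of them
  subsets of one and the same set of polynomials. It cannot be dropped: for type \<open>(6, 3, 2, 2)\<close>
  there are three orbits of Eisenstein polynomials, but only two classes of rings under
  arbitrary ring isomorphisms, because the Frobenius automorphism of the coefficient ring
  interchanges two of the orbits. Every finite ring is isomorphic to one whose carrier is a set
  of natural numbers.
\<close>

definition rings_of_type ::
    "nat \<times> nat \<times> nat \<times> nat \<Rightarrow> (nat ring \<times> ('a::comm_ring_1 \<Rightarrow> nat)) set" where
  "rings_of_type \<tau> =
     {(S, \<iota>). finite_local_pir S \<and> type_of_ring S = \<tau> \<and>
              \<iota> \<in> ring_iso (coeff_ring (whole :: 'a ring)) (coeff_ring S)}"

definition iso_of_type ::
    "nat \<times> nat \<times> nat \<times> nat \<Rightarrow>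
     ((nat ring \<times> ('a::comm_ring_1 \<Rightarrow> nat)) \<times> (nat ring \<times> ('a \<Rightarrow> nat))) set" where
  "iso_of_type \<tau> =
     {((S, \<iota>), (S', \<iota>')). (S, \<iota>) \<in> rings_of_type \<tau> \<and> (S', \<iota>') \<in> rings_of_type \<tau> \<and>
        (\<exists>h \<in> ring_iso S S'. \<forall>x \<in> carrier (coeff_ring (whole :: 'a ring)). h (\<iota> x) = \<iota>' x)}"

definition eisenstein_with_zero_in ::
    "nat ring \<Rightarrow> ('a::comm_ring_1 \<Rightarrow> nat) \<Rightarrow> 'a poly set" where
  "eisenstein_with_zero_in S \<iota> =
     {q \<in> eisenstein_polys.
        \<exists>x \<in> carrier S. (\<Oplus>\<^bsub>S\<^esub> i \<in> {..degree q}. \<iota> (coeff q i) \<otimes>\<^bsub>S\<^esub> x [^]\<^bsub>S\<^esub> i) = \<zero>\<^bsub>S\<^esub>}"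

end

theory Submission
  imports Defs "Subresultants.Subresultant"
begin

text \<open>
  The maximal ideal of \<open>R\<close> is generated by a uniformizer \<open>u\<close>, and \<open>p\<close> is a unit times \<open>u ^ e\<close>; hence
  \<open>R = R\<^sub>\<omega>[u]\<close>, and evaluating a polynomial over \<open>R\<^sub>\<omega>\<close> at \<open>u\<close> is governed by the valuations
  of its coefficients. For Eisenstein \<open>q\<close>, the polynomial \<open>t * q\<close> is the only monic \<open>q'\<close> of degree \<open>e\<close>
  such that \<open>q\<close> divides \<open>q' (t Y)\<close>. This determines \<open>t * q\<close> without any splitting ring and gives
  the Eisenstein property, the independence of representatives and the laws of an action.
  It also shows that \<open>t * q\<close> vanishes at \<open>t(u) u\<close> if \<open>q\<close> vanishes at \<open>u\<close>, and since every
  uniformizer is \<open>t(u) u\<close> for some \<open>t\<close>, the action on uniformizers is transitive.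

  If \<open>e\<close> divides \<open>a\<close>, a polynomial over \<open>R\<^sub>\<omega>\<close> of degree less than \<open>e\<close> that vanishes at \<open>u\<close>
  is zero, so the Eisenstein polynomial of \<open>u\<close> is unique and generates the kernel of evaluation.
  Thus the rings of the given type are the \<open>R\<^sub>\<omega>[Y]/(q)\<close>, and two of them are isomorphic
  over \<open>R\<^sub>\<omega>\<close> exactly when the same Eisenstein polynomials have zeros in both.
\<close>

section \<open>Monic polynomials and resultants\<close>

text \<open>The obstacle is that \<open>P\<close> is nilpotent, so that nothing can be cancelled as
  over a discrete valuation ring. Two substitutes shape the proof. From \<open>P ^ j * x = 0\<close>
  with \<open>j \<le> k\<close> at least \<open>P dvd x\<close> follows, so identities are lifted
  from the residue field by splitting off one factor \<open>P\<close> at a time,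
  \<open>Suc k\<close> times in all. And a monic polynomial is no zero divisor modulo any constant,
  so a constant dividing a product with it divides the cofactor. If \<open>e\<close> does not divide
  \<open>a\<close>, then Y^a need not be a multiple of \<open>q\<close>. That t * q still depends
  only on \<open>t\<close> modulo Y^a is due to its shape Y^e + P y: each summand supplies the
  missing factor. The factor g of g_0 is recovered from the uniformizer: g_0 vanishes at it, so its
  Eisenstein polynomial divides g_0, and the congruences modulo \<open>p\<close> force every
  admissible factor to be this one. R and all other rings of its type are treated alike as
  extensions of one coefficient ring along a map \<open>j\<close>; hence evaluation takes
  polynomials over a type to values in a record ring.\<close>

lemma monic_division:
  fixes q :: "'b::comm_ring_1 poly"
  assumes "lead_coeff q = 1"
  obtains b r where "t = q * b + r" "r = 0 \<or> degree r < degree q"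
proof -
  have q0: "q \<noteq> 0" using assms by auto
  obtain b r where br: "pseudo_divmod t q = (b, r)" by force
  \<comment> \<open>Pseudo-division scales the dividend by a power of the leading coefficient of the
    divisor, here a power of 1; so it is division with remainder even in the presence of zero
    divisors.\<close>
  from pseudo_divmod[OF q0 br] have "t = q * b + r" "r = 0 \<or> degree r < degree q"
    using assms by auto
  then show ?thesis using that by blast
qed

lemma monic_mult_degree:
  fixes q :: "'b::comm_ring_1 poly"
  assumes "lead_coeff q = 1" "h \<noteq> 0"
  shows "degree (q * h) = degree q + degree h" "coeff (q * h) (degree q + degree h) = lead_coeff h"
proof -
  show 1: "coeff (q * h) (degree q + degree h) = lead_coeff h"
    using assms by (simp add: coeff_mult_degree_sum)
  then have "degree q + degree h \<le> degree (q * h)"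
    using assms by (intro le_degree) auto
  then show "degree (q * h) = degree q + degree h"
    using degree_mult_le[of q h] by simp
qed

lemma monic_dvd_small_degree:
  fixes q :: "'b::comm_ring_1 poly"
  assumes "lead_coeff q = 1" "q dvd r" "degree r < degree q"
  shows "r = 0"
proof -
  obtain h where h: "r = q * h" using assms by (auto elim: dvdE)
  show ?thesis
  proof (cases "h = 0")
    case False
    then show ?thesis using monic_mult_degree(1)[OF assms(1) False] assms(3) h by simp
  qed (simp add: h)
qed

text \<open>Divisibility by the constant polynomial \<open>[:c:]\<close> is how congruences modulo
  \<open>c\<close> between polynomials are written from here on.\<close>

lemma const_poly_dvd_iff_coeffs:
  fixes c :: "'b::comm_ring_1"
  shows "[:c:] dvd f \<longleftrightarrow> (\<forall>i. c dvd coeff f i)"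
proof
  assume "\<forall>i. c dvd coeff f i"
  then show "[:c:] dvd f"
  proof (induction f)
    case (pCons b f)
    have "c dvd b" "\<forall>i. c dvd coeff f i" using pCons.prems
      by (metis coeff_pCons_0, metis coeff_pCons_Suc)
    then obtain x y where "b = c * x" "f = [:c:] * y" using pCons.IH by (auto elim!: dvdE)
    then have "pCons b f = [:c:] * pCons x y" by simp
    then show ?case by (metis dvd_triv_left)
  qed simp
qed (auto elim!: dvdE)

text \<open>A monic polynomial is still monic modulo \<open>c\<close> and hence no zero divisor
  there. In terms of coefficients: the top coefficient of \<open>q * h\<close> is that of
  \<open>h\<close>, so the leading term of \<open>h\<close> is divisible by \<open>c\<close> and can
  be removed.\<close>

lemma const_dvd_monic_mult:
  fixes q :: "'b::comm_ring_1 poly"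
  assumes q: "lead_coeff q = 1" and "[:c:] dvd q * h"
  shows "[:c:] dvd h"
  using assms(2)
proof (induction "degree h" arbitrary: h rule: less_induct)
  case less
  show ?case
  proof (cases "h = 0")
    case False
    have "c dvd coeff (q * h) (degree q + degree h)"
      using less.prems by (simp add: const_poly_dvd_iff_coeffs)
    then have c: "c dvd lead_coeff h" using monic_mult_degree(2)[OF q False] by simp
    define h' where "h' = h - monom (lead_coeff h) (degree h)"
    have m: "[:c:] dvd monom (lead_coeff h) (degree h)"
      using c by (auto simp: const_poly_dvd_iff_coeffs coeff_monom)
    have d: "[:c:] dvd q * h'"
      unfolding h'_def right_diff_distrib by (intro dvd_diff less.prems dvd_mult m)
    have "[:c:] dvd h'"
    proof (cases "degree h = 0")
      case True
      then have "h' = 0" by (simp add: h'_def monom_0 degree_0_id)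
      then show ?thesis by simp
    next
      case f: False
      have "degree h' \<le> degree h" unfolding h'_def
        by (intro degree_diff_le degree_monom_le) auto
      moreover have "coeff h' (degree h) = 0" by (simp add: h'_def)
      ultimately have "degree h' < degree h"
        using f by (cases "h' = 0") (simp, metis leading_coeff_0_iff le_neq_implies_less)
      then show ?thesis using less.hyps d by blast
    qed
    moreover have "h = h' + monom (lead_coeff h) (degree h)" by (simp add: h'_def)
    ultimately show ?thesis using m by (metis dvd_add)
  qed simp
qed

lemma pcompose_diff_dvd:
  fixes g :: "'b::comm_ring_1 poly"
  shows "w - w' dvd pcompose g w - pcompose g w'"
proof (induction g)
  case (pCons c g)
  have "pcompose (pCons c g) w - pcompose (pCons c g) w' =
     (w - w') * pcompose g w + w' * (pcompose g w - pcompose g w')"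
    by (simp add: pcompose_pCons algebra_simps)
  then show ?case using pCons.IH by simp
qed simp

lemma pcompose_monom_one: "pcompose (monom 1 n) w = w ^ n" for w :: "'b::comm_ring_1 poly"
  by (simp add: monom_altdef pcompose_hom.hom_power pcompose_pCons)

lemma mult_X_power: "(t * [:0, 1:]) ^ n = monom 1 n * t ^ n" for t :: "'b::comm_ring_1 poly"
  by (simp only: power_mult_distrib monom_altdef smult_1_left mult.commute)

section \<open>Resultants with respect to Y over polynomials in Z\<close>

abbreviation lift_const :: "'b::comm_ring_1 poly \<Rightarrow> 'b poly poly" where
  "lift_const \<equiv> map_poly (\<lambda>c. [:c:])"

text \<open>Only the identity permutation contributes to the top coefficient of the determinant.\<close>

lemma det_unitriangular_char:
  fixes A :: "'b::comm_ring_1 poly mat"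
  assumes A: "A \<in> carrier_mat (n + e) (n + e)"
    and low: "\<And>i j. i < n \<Longrightarrow> j < i \<Longrightarrow> A $$ (i, j) = 0"
    and one: "\<And>i. i < n \<Longrightarrow> A $$ (i, i) = 1"
    and deg: "\<And>i j. i < n + e \<Longrightarrow> j < n + e \<Longrightarrow> i \<noteq> j \<or> i < n \<Longrightarrow> degree (A $$ (i, j)) = 0"
    and diag: "\<And>i. n \<le> i \<Longrightarrow> i < n + e \<Longrightarrow> A $$ (i, i) = [:0, 1:]"
  shows "degree (det A) = e" "lead_coeff (det A) = 1"
proof -
  let ?N = "{0..<n + e}"
  let ?P = "{p. p permutes ?N}"
  define T where "T p = signof p * (\<Prod>i\<in>?N. A $$ (i, p i))" for p
  have fin: "finite ?P" by (simp add: finite_permutations)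
  have det: "det A = T id + (\<Sum>p\<in>?P - {id}. T p)"
    unfolding det_def'[OF A] T_def[symmetric]
    by (rule sum.remove[OF fin]) (simp add: permutes_id)
  have split: "?N = {0..<n} \<union> {n..<n+e}" by auto
  have Tid: "T id = monom 1 e"
  proof -
    have "(\<Prod>i\<in>?N. A $$ (i, i)) = (\<Prod>i\<in>{0..<n}. A $$ (i, i)) * (\<Prod>i\<in>{n..<n+e}. A $$ (i, i))"
      unfolding split by (rule prod.union_disjoint) auto
    also have "(\<Prod>i\<in>{0..<n}. A $$ (i, i)) = 1" using one by simp
    also have "(\<Prod>i\<in>{n..<n+e}. A $$ (i, i)) = (\<Prod>i\<in>{n..<n+e}. [:0, 1:])"
      using diag by (intro prod.cong) auto
    also have "\<dots> = monom 1 e" by (simp add: monom_altdef)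
    finally show ?thesis by (simp add: T_def)
  qed
  have small: "coeff (T p) i = 0" if p: "p permutes ?N" "p \<noteq> id" and i: "e \<le> i" for p i
  proof (cases "\<exists>i<n. p i < i")
    case True
    then obtain l where l: "l < n" "p l < l" by auto
    have "(\<Prod>i\<in>?N. A $$ (i, p i)) = 0"
      by (rule prod_zero) (use l low in \<open>auto intro!: bexI[of _ l]\<close>)
    then show ?thesis by (simp add: T_def)
  next
    case False
    then have up: "\<And>i. i < n \<Longrightarrow> i \<le> p i" by (meson not_less)
    \<comment> \<open>Otherwise \<open>p\<close> would never decrease an index, and a permutation of
      an initial segment with that property is the identity. So the product misses at least one of
      the \<open>e\<close> diagonal factors \<open>[:0, 1:]\<close>, and its degree stays below
      \<open>e\<close>.\<close>
    have "\<exists>i\<in>{n..<n+e}. p i \<noteq> i"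
    proof (rule ccontr)
      assume "\<not> ?thesis"
      then have "\<forall>i\<in>?N. i \<le> p i" using up unfolding split by auto
      then show False using permutes_natset_ge[OF p(1)] p(2) by blast
    qed
    then obtain l where l: "l \<in> {n..<n+e}" "p l \<noteq> l" by blast
    have pi: "p i < n + e" if "i < n + e" for i using permutes_in_image[OF p(1), of i] that by auto
    have degT: "degree (\<Prod>i\<in>?N. A $$ (i, p i)) \<le> (\<Sum>i\<in>?N. degree (A $$ (i, p i)))"
      by (rule order_trans[OF degree_prod_sum_le]) auto
    have "(\<Sum>i\<in>?N. degree (A $$ (i, p i))) \<le> (\<Sum>i\<in>?N. if i \<in> {n..<n+e} - {l} then 1 else 0)"
    proof (rule sum_mono)
      fix i assume i: "i \<in> ?N"
      show "degree (A $$ (i, p i)) \<le> (if i \<in> {n..<n+e} - {l} then 1 else 0)"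
      proof (cases "i \<in> {n..<n+e} - {l}")
        case True
        then show ?thesis using diag[of i] deg[of i "p i"] pi[of i] by (cases "p i = i") auto
      next
        case False
        then have "degree (A $$ (i, p i)) = 0" using l i pi[of i] by (intro deg) auto
        then show ?thesis by simp
      qed
    qed
    also have "\<dots> = card ({n..<n+e} - {l})" by (subst sum.If_cases) (auto intro!: arg_cong[of _ _ card])
    also have "\<dots> < e" using l by (simp add: card_Diff_singleton)
    finally have "degree (\<Prod>i\<in>?N. A $$ (i, p i)) < i" using degT i by linarith
    then show ?thesis
      unfolding T_def by (cases p rule: sign_cases) (simp_all add: coeff_eq_0)
  qed
  have c: "coeff (det A) i = coeff (monom 1 e) i" if "e \<le> i" for i
    unfolding det coeff_add Tid coeff_sum using small that by simp
  have "coeff (det A) e = 1" using c[of e] by simp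
  moreover have "degree (det A) \<le> e" using c by (intro degree_le) (auto simp: coeff_monom)
  ultimately show "degree (det A) = e" "lead_coeff (det A) = 1"
    by (metis le_degree le_antisym zero_neq_one)+
qed

text \<open>The resultant is the subresultant of index 0. The last row of its matrix consists of
  multiples of \<open>f\<close> and \<open>g\<close> by powers of the variable, and expansion along
  this row gives the combination.\<close>

lemma resultant_combination:
  fixes f g :: "'b::comm_ring_1 poly"
  assumes "0 < degree f + degree g"
  shows "\<exists>A B. [:resultant f g:] = A * f + B * g"
proof -
  let ?n = "degree f + degree g"
  let ?M = "subresultant_mat 0 f g"
  have M: "?M \<in> carrier_mat ?n ?n" by (auto intro: carrier_matI)
  have "[:resultant f g:] = (\<Sum>j<?n. ?M $$ (?n - 1, j) * cofactor ?M (?n - 1) j)"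
    unfolding subresultant_resultant[symmetric] subresultant_def
    using laplace_expansion_row[OF M, of "?n - 1"] assms by simp
  also have "\<exists>A B. \<dots> = A * f + B * g"
  proof -
    have "\<exists>A B. ?M $$ (?n - 1, j) * cofactor ?M (?n - 1) j = A * f + B * g" if "j < ?n" for j
    proof (cases "j < degree g")
      case True
      then have "?M $$ (?n - 1, j) * cofactor ?M (?n - 1) j =
          (monom 1 (degree g - 1 - j) * cofactor ?M (?n - 1) j) * f + 0 * g"
        using that by (simp add: subresultant_index_mat)
      then show ?thesis by blast
    next
      case False
      then have "?M $$ (?n - 1, j) * cofactor ?M (?n - 1) j =
          0 * f + (monom 1 (degree f - 1 - (j - degree g)) * cofactor ?M (?n - 1) j) * g"
        using that by (simp add: subresultant_index_mat)
      then show ?thesis by blast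
    qed
    then obtain A B where "\<And>j. j < ?n \<Longrightarrow>
        ?M $$ (?n - 1, j) * cofactor ?M (?n - 1) j = A j * f + B j * g" by metis
    then have "(\<Sum>j<?n. ?M $$ (?n - 1, j) * cofactor ?M (?n - 1) j) =
        (\<Sum>j<?n. A j) * f + (\<Sum>j<?n. B j) * g"
      by (simp add: sum.distrib sum_distrib_right)
    then show ?thesis by blast
  qed
  finally show ?thesis .
qed

text \<open>The second argument \<open>w\<close> of the resultant is Z - t(Y)Y. It contains Z only
  in its coefficient of degree 0 in Y, which lands on the diagonal in the rows of the Sylvester
  matrix coming from \<open>w\<close>; the \<open>n\<close> rows coming from the monic
  \<open>q\<close> have 1 on the diagonal and no Z at all.\<close>

lemma subst_resultant_monic:
  fixes q :: "'b::comm_ring_1 poly"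
  assumes q: "lead_coeff q = 1"
  shows "degree (subst_resultant t q) = degree q" "lead_coeff (subst_resultant t q) = 1"
proof -
  define w where "w = [:[:0, 1:]:] - lift_const (t * [:0, 1:])"
  define n where "n = degree w"
  let ?A = "sylvester_mat (lift_const q) w"
  have A: "?A \<in> carrier_mat (n + degree q) (n + degree q)"
    using sylvester_carrier_mat[of "lift_const q" w] by (simp add: n_def add.commute)
  have w0: "coeff w 0 = [:0, 1:]" by (simp add: w_def)
  have wS: "degree (coeff w i) = 0" if "i > 0" for i
    using that by (auto simp: w_def coeff_pCons split: nat.splits)
  have ix: "?A $$ (i, j) = (if i < n then if i \<le> j \<and> j - i \<le> degree q
       then [:coeff q (degree q + i - j):] else 0
     else if i - n \<le> j \<and> j \<le> i then coeff w (i - j) else 0)"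
    if "i < n + degree q" "j < n + degree q" for i j
    using that by (subst sylvester_index_mat) (auto simp: n_def)
  have "degree (det ?A) = degree q \<and> lead_coeff (det ?A) = 1"
    by (intro conjI; rule det_unitriangular_char[OF A])
       (use q w0 wS in \<open>auto simp: ix simp flip: one_pCons\<close>)
  moreover have S: "subst_resultant t q = det ?A"
    by (simp only: subst_resultant_def resultant_def w_def)
  ultimately show "degree (subst_resultant t q) = degree q" "lead_coeff (subst_resultant t q) = 1"
    unfolding S by blast+
qed

text \<open>In an identity that writes the resultant as A q + B w, the variable Z may be replaced by
  t(Y)Y. This makes \<open>w\<close> vanish and leaves a multiple of \<open>q\<close>. It is the
  polynomial form of the fact that t(u)u is a zero of t * q for each zero u of
  \<open>q\<close>.\<close>

lemma dvd_pcompose_subst_resultant: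
  fixes q :: "'b::comm_ring_1 poly"
  assumes "0 < degree q"
  shows "q dvd pcompose (subst_resultant t q) (t * [:0, 1:])"
proof -
  define w0 where "w0 = t * [:0, 1:]"
  define w where "w = [:[:0, 1:]:] - lift_const w0"
  interpret h: map_poly_comm_ring_hom "\<lambda>c. pcompose c w0" ..
  obtain A B where AB: "[:subst_resultant t q:] = A * lift_const q + B * w"
    using resultant_combination[of "lift_const q" w] assms
    by (auto simp: subst_resultant_def w_def w0_def)
  \<comment> \<open>\<open>\<Phi>\<close> replaces the inner variable Z by \<open>w0\<close> and
    keeps the outer variable Y, both becoming polynomials in Y.\<close>
  define \<Phi> where "\<Phi> F = poly (map_poly (\<lambda>c. pcompose c w0) F) [:0, 1:]" for F
  have lift: "\<Phi> (lift_const f) = f" for f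
    by (induction f) (simp_all add: \<Phi>_def Polynomial.map_poly_pCons pcompose_const)
  have "\<Phi> [:subst_resultant t q:] = \<Phi> A * \<Phi> (lift_const q) + \<Phi> B * \<Phi> w"
    unfolding AB by (simp add: \<Phi>_def hom_distribs)
  moreover have "\<Phi> w = 0"
    using lift[of w0] by (simp add: w_def \<Phi>_def hom_distribs pcompose_pCons)
  moreover have "\<Phi> [:subst_resultant t q:] = pcompose (subst_resultant t q) w0"
    unfolding \<Phi>_def by (simp add: Polynomial.map_poly_pCons)
  ultimately show ?thesis by (simp add: lift w0_def)
qed

section \<open>Eisenstein polynomials over a chain ring\<close>

text \<open>
  The coefficient ring is a chain ring with prime \<open>P\<close> and \<open>P ^ Suc k = 0\<close>, so
  \<open>k + 1 = \<lceil>a / e\<rceil>\<close> for the type \<open>(a, e, f, p)\<close>.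
\<close>

locale eisenstein_setup =
  fixes P :: "'b::comm_ring_1" and k e a :: nat
  assumes P_nilpotent: "P ^ Suc k = 0" and P_power: "P ^ k \<noteq> 0"
    and P_dvd_or_unit: "P dvd x \<or> x dvd 1"
    and e_pos: "0 < e" and k_pos: "0 < k" and a_gt: "e * k < a" and a_le: "a \<le> e * Suc k"
begin

lemma e_less_a: "e < a"
  using a_gt k_pos by (metis One_nat_def Suc_leI le_less_trans mult.right_neutral mult_le_mono2)

lemma not_unit_P_dvd:
  assumes "P dvd x"
  shows "\<not> x dvd 1"
proof
  assume "x dvd 1"
  then have "P dvd 1" using assms dvd_trans by blast
  then have "P ^ Suc k dvd 1 ^ Suc k" by (intro dvd_power_same)
  then show False using P_nilpotent by (metis dvd_0_left_iff one_neq_zero power_one)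
qed

lemma unit_cong:
  assumes "P dvd x - y" "x dvd 1"
  shows "y dvd 1"
  using assms P_dvd_or_unit[of y] not_unit_P_dvd[of x] by (metis diff_add_cancel dvd_add)

lemma P_dvd_unit_mult:
  assumes "x dvd 1" "P dvd x * y"
  shows "P dvd y"
proof -
  obtain z where "x * z = 1" using assms(1) by (metis dvdE)
  then have "z * (x * y) = y" by (metis mult.assoc mult.commute mult_1)
  then show ?thesis using assms(2) by (metis dvd_mult)
qed

lemma unit_mult: "x dvd 1 \<Longrightarrow> y dvd 1 \<Longrightarrow> x * y dvd (1::'b)"
  using mult_dvd_mono[of x 1 y 1] by simp

lemma unit_power: "x dvd 1 \<Longrightarrow> x ^ n dvd (1::'b)"
  using dvd_power_same[of x 1 n] by simp

text \<open>If \<open>x\<close> were a unit, \<open>P ^ j\<close> itself would be 0. This is the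
  cancellation law that survives: a nonzero power of \<open>P\<close> can be removed from an
  equation if what remains is read modulo \<open>P\<close>.\<close>

lemma annihilator:
  assumes "P ^ j * x = 0" "j \<le> k"
  shows "P dvd x"
proof (rule ccontr)
  assume "\<not> P dvd x"
  then obtain z where "1 = x * z" using P_dvd_or_unit by (metis dvdE)
  then have "P ^ j = 0" using assms(1) by (metis mult.assoc mult.commute mult_1 mult_zero_left)
  then show False using assms(2) P_power by (metis le_add_diff_inverse mult_zero_left power_add)
qed

lemma annihilator_poly:
  assumes "smult (P ^ j) x = 0" "j \<le> k"
  shows "[:P:] dvd x"
  using assms annihilator by (metis coeff_0 coeff_smult const_poly_dvd_iff_coeffs)

definition eisenstein :: "'b poly \<Rightarrow> bool" where
  "eisenstein q \<longleftrightarrow> degree q = e \<and> lead_coeff q = 1 \<and> (\<forall>i<e. P dvd coeff q i) \<and>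
     P dvd coeff q 0 \<and> \<not> P ^ 2 dvd coeff q 0"

lemma eisenstein_cong:
  assumes "degree q = e" "lead_coeff q = 1" "\<forall>i<e. P dvd coeff q i"
  shows "[:P:] dvd q - monom 1 e"
  unfolding const_poly_dvd_iff_coeffs
proof
  fix i
  show "P dvd coeff (q - monom 1 e) i"
    using assms by (cases i e rule: linorder_cases) (auto simp: coeff_eq_0)
qed

lemma eisensteinD:
  assumes "eisenstein q"
  shows "degree q = e" "lead_coeff q = 1" "[:P:] dvd q - monom 1 e"
  using assms eisenstein_cong by (auto simp: eisenstein_def)

lemma eisenstein_constant:
  assumes "eisenstein q"
  obtains d where "coeff q 0 = P * d" "d dvd 1"
proof -
  obtain d where d: "coeff q 0 = P * d" using assms by (auto simp: eisenstein_def)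
  moreover have "\<not> P dvd d"
  proof
    assume "P dvd d"
    then have "P ^ 2 dvd coeff q 0" by (simp add: d power2_eq_square mult_dvd_mono)
    then show False using assms by (simp add: eisenstein_def)
  qed
  ultimately show ?thesis using that P_dvd_or_unit by blast
qed

lemma eisenstein_decomposition:
  assumes q: "eisenstein q"
  obtains y where "q = monom 1 e + smult P y" "coeff y 0 dvd 1"
proof -
  obtain y where "q - monom 1 e = smult P y" using eisensteinD(3)[OF q] by (auto elim: dvdE)
  then have y: "q = monom 1 e + smult P y" by (simp add: algebra_simps)
  obtain d where d: "coeff q 0 = P * d" "d dvd 1" by (rule eisenstein_constant[OF q])
  \<comment> \<open>\<open>P\<close> is a zero divisor, so the two cofactors of \<open>P\<close>
    agree only modulo \<open>P\<close>; to decide about units this suffices.\<close>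
  have "P ^ 1 * (d - coeff y 0) = 0" using d(1) e_pos by (simp add: y right_diff_distrib)
  then have "P dvd d - coeff y 0" by (rule annihilator) (use k_pos in simp)
  then have "coeff y 0 dvd 1" using unit_cong d(2) by blast
  then show ?thesis using that y by blast
qed

text \<open>The factor \<open>m\<close> makes the induction on \<open>n\<close> go through: it absorbs one factor \<open>t\<close> per step.\<close>

lemma coeffs_P_dvd_of_pcompose:
  assumes "coeff t 0 dvd 1" "coeff m 0 dvd 1"
    and "[:P:] dvd m * pcompose s (t * [:0, 1:]) - monom 1 n * h"
  shows "\<forall>i<n. P dvd coeff s i"
  using assms(2,3)
proof (induction n arbitrary: m s)
  case (Suc n)
  obtain c s' where s: "s = pCons c s'" by (cases s)
  define g where "g = m * t * pcompose s' (t * [:0, 1:]) - monom 1 n * h"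
  have eq: "m * pcompose s (t * [:0, 1:]) - monom 1 (Suc n) * h = smult c m + pCons 0 g"
  proof -
    have "monom 1 (Suc n) * h = [:0, 1:] * (monom 1 n * h)"
      by (simp add: monom_Suc)
    then show ?thesis by (simp add: s g_def pcompose_pCons algebra_simps)
  qed
  have "P dvd coeff (smult c m + pCons 0 g) 0"
    using Suc.prems(2) unfolding eq const_poly_dvd_iff_coeffs by blast
  then have c: "P dvd c" using P_dvd_unit_mult[OF Suc.prems(1), of c] by (simp add: mult.commute)
  then have "[:P:] dvd smult c m" by (simp add: const_poly_dvd_iff_coeffs)
  then have "[:P:] dvd pCons 0 g" using Suc.prems(2) unfolding eq by (metis dvd_add_right_iff)
  then have "[:P:] dvd g" unfolding const_poly_dvd_iff_coeffs by (metis coeff_pCons_Suc)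
  moreover have "coeff (m * t) 0 dvd 1"
    using unit_mult[OF Suc.prems(1) assms(1)] by (simp add: coeff_mult_0)
  ultimately have "\<forall>i<n. P dvd coeff s' i"
    using Suc.IH[of "m * t" s'] unfolding g_def by blast
  then show ?case using c by (simp add: s All_less_Suc2)
qed simp

text \<open>Modulo \<open>P\<close> the hypothesis says that Y^e divides r(tY). As \<open>t\<close>
  has a unit constant term, substituting tY does not change the order at 0, so \<open>r\<close>,
  being of degree below \<open>e\<close>, vanishes modulo \<open>P\<close>. Taking out
  \<open>P\<close> and repeating shows that \<open>r\<close> is a multiple of
  \<open>P ^ Suc k = 0\<close>.\<close>

lemma monic_dvd_pcompose_small_degree:
  assumes q: "degree q = e" "lead_coeff q = 1" "[:P:] dvd q - monom 1 e"
    and t: "coeff t 0 dvd 1" and r: "degree r < e" and d: "q dvd pcompose r (t * [:0, 1:])"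
  shows "r = 0"
proof -
  have "\<exists>r'. r = smult (P ^ j) r' \<and> degree r' < e" if "j \<le> Suc k" for j
    using that
  proof (induction j)
    case 0
    show ?case using r by auto
  next
    case (Suc j)
    then obtain r' where r': "r = smult (P ^ j) r'" "degree r' < e" by auto
    obtain h where h: "pcompose r (t * [:0, 1:]) = q * h" using d by (auto elim: dvdE)
    have e1: "smult (P ^ j) (pcompose r' (t * [:0, 1:])) = q * h"
      using h by (simp add: r' pcompose_smult)
    \<comment> \<open>Since \<open>q\<close> is monic, the cofactor \<open>h\<close> has to take
      over the factor \<open>P ^ j\<close>; only then can it be removed from both sides.\<close>
    then have "[:P ^ j:] dvd q * h" by (metis const_poly_dvd_iff_coeffs coeff_smult dvd_triv_left)
    then obtain h' where h': "h = [:P ^ j:] * h'" using const_dvd_monic_mult[OF q(2)] by (metis dvdE)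
    have "smult (P ^ j) (pcompose r' (t * [:0, 1:]) - q * h') = 0"
      using e1 h' by (simp add: smult_diff_right)
    then have "[:P:] dvd pcompose r' (t * [:0, 1:]) - q * h'"
      by (rule annihilator_poly) (use Suc.prems in simp)
    moreover have "[:P:] dvd (q - monom 1 e) * h'" using q(3) by simp
    ultimately have "[:P:] dvd (pcompose r' (t * [:0, 1:]) - q * h') + (q - monom 1 e) * h'"
      by (rule dvd_add)
    then have "[:P:] dvd 1 * pcompose r' (t * [:0, 1:]) - monom 1 e * h'"
      by (simp add: algebra_simps)
    then have "\<forall>i<e. P dvd coeff r' i" using coeffs_P_dvd_of_pcompose[OF t, of 1 r' e h'] by simp
    then have "P dvd coeff r' i" for i using r'(2) by (cases "i < e") (auto simp: coeff_eq_0)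
    then have "\<forall>i. \<exists>y. coeff r' i = P * y" by (auto elim: dvdE)
    then obtain y where y: "\<And>i. coeff r' i = P * y i" by metis
    \<comment> \<open>The \<open>y i\<close> are arbitrary quotients by \<open>P\<close>, possibly
      nonzero where \<open>r'\<close> has coefficient 0. Cutting them off at \<open>e\<close> keeps
      the degree bound for the next step.\<close>
    define r'' where "r'' = poly_of_list (map y [0..<e])"
    have c: "coeff r'' i = (if i < e then y i else 0)" for i
      by (simp add: r''_def coeff_Poly_eq nth_default_def)
    have "r' = smult P r''"
      by (rule poly_eqI) (use r'(2) in \<open>auto simp: c y[symmetric] coeff_eq_0\<close>)
    moreover have "degree r'' < e"
      using e_pos by (intro le_less_trans[OF degree_le[of "e - 1"]]) (auto simp: c)
    ultimately show ?case using r'(1) by (auto simp: mult.commute)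
  qed
  from this[of "Suc k"] show ?thesis using P_nilpotent by auto
qed

text \<open>Two candidates are monic of the same degree, so their difference has degree below
  \<open>e\<close> and the preceding lemma applies to it.\<close>

lemma subst_resultant_unique:
  assumes q: "eisenstein q" and t: "coeff t 0 dvd 1"
    and r: "degree r = e" "lead_coeff r = 1" "q dvd pcompose r (t * [:0, 1:])"
  shows "r = subst_resultant t q"
proof -
  let ?s = "subst_resultant t q"
  note qD = eisensteinD[OF q]
  have s: "degree ?s = e" "lead_coeff ?s = 1" "q dvd pcompose ?s (t * [:0, 1:])"
    using subst_resultant_monic[OF qD(2)] dvd_pcompose_subst_resultant[of q t] qD(1) e_pos by auto
  have "degree (r - ?s) < e"
  proof (cases "r = ?s")
    case False
    have "coeff (r - ?s) e = 0" using r s by simp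
    moreover have "degree (r - ?s) \<le> e" using r s by (intro degree_diff_le) auto
    ultimately show ?thesis using False
      by (metis leading_coeff_0_iff le_neq_implies_less right_minus_eq)
  qed (use e_pos in simp)
  moreover have "q dvd pcompose (r - ?s) (t * [:0, 1:])"
    using r(3) s(3) by (simp add: pcompose_diff)
  ultimately show ?thesis using monic_dvd_pcompose_small_degree[OF qD t] by (metis right_minus_eq)
qed

text \<open>Write the divisibility as s(tY) = q h with s = t * q. Modulo \<open>P\<close> the right
  side is Y^e h, so the lower coefficients of s vanish and s becomes Y^e; comparing Y^e t^e with Y^e
  h then shows that h(0) is congruent to t(0)^e, hence a unit. So s(0) = q(0) h(0) is no more
  divisible by \<open>P ^ 2\<close> than q(0) is.\<close>

lemma eisenstein_subst_resultant:
  assumes q: "eisenstein q" and t: "coeff t 0 dvd 1"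
  shows "eisenstein (subst_resultant t q)"
proof -
  let ?s = "subst_resultant t q"
  note qD = eisensteinD[OF q]
  have s: "degree ?s = e" "lead_coeff ?s = 1" "q dvd pcompose ?s (t * [:0, 1:])"
    using subst_resultant_monic[OF qD(2)] dvd_pcompose_subst_resultant[of q t] qD(1) e_pos by auto
  obtain h where h: "pcompose ?s (t * [:0, 1:]) = q * h" using s(3) by (auto elim: dvdE)
  have qh: "[:P:] dvd q * h - monom 1 e * h"
    using dvd_mult2[OF qD(3), of h] by (simp add: left_diff_distrib)
  then have low: "\<forall>i<e. P dvd coeff ?s i"
    by (intro coeffs_P_dvd_of_pcompose[OF t, of 1 ?s e h]) (simp, metis h mult_1)
  have "[:P:] dvd pcompose (?s - monom 1 e) (t * [:0, 1:])"
  proof -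
    obtain y where "?s - monom 1 e = [:P:] * y" using eisenstein_cong[OF s(1,2) low] by (metis dvdE)
    then show ?thesis by (simp add: pcompose_mult pcompose_smult del: mult_pCons_left) 
  qed
  moreover have "pcompose (monom 1 e) (t * [:0, 1:]) = monom 1 e * t ^ e"
    by (simp only: pcompose_monom_one mult_X_power)
  ultimately have "[:P:] dvd q * h - monom 1 e * t ^ e" by (simp only: pcompose_diff h)
  from dvd_diff[OF this qh] have "[:P:] dvd monom 1 e * (h - t ^ e)" by (simp add: algebra_simps)
  then have "P dvd coeff (monom 1 e * (h - t ^ e)) e" by (simp add: const_poly_dvd_iff_coeffs)
  then have "P dvd coeff (t ^ e) 0 - coeff h 0"
    by (simp add: coeff_monom_mult) (metis dvd_minus_iff minus_diff_eq)
  moreover have "coeff (t ^ e) 0 = coeff t 0 ^ e" by (simp add: coeff_0_power)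
  ultimately have hu: "coeff h 0 dvd 1" using unit_cong unit_power[OF t] by metis
  have "coeff ?s 0 = coeff q 0 * coeff h 0"
    using arg_cong[OF h, of "\<lambda>f. coeff f 0"] by (simp add: coeff_mult_0 pcompose_0' coeff_pcompose_0 poly_0_coeff_0)
  moreover have "\<not> P ^ 2 dvd coeff q 0 * coeff h 0"
  proof
    assume "P ^ 2 dvd coeff q 0 * coeff h 0"
    moreover obtain z where z: "coeff h 0 * z = 1" using hu by (metis dvdE)
    ultimately have "P ^ 2 dvd coeff q 0 * coeff h 0 * z" by simp
    then show False using q z by (simp add: eisenstein_def mult.assoc)
  qed
  ultimately show ?thesis using s low e_pos by (auto simp: eisenstein_def)
qed

text \<open>Modulo \<open>q\<close> the power Y^e equals a multiple of \<open>P\<close>. Each block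
  of \<open>e\<close> factors Y is thus traded for one factor \<open>P\<close>, and
  \<open>Suc k\<close> factors \<open>P\<close> give 0.\<close>

lemma eisenstein_dvd_monomial:
  assumes q: "eisenstein q" and "Suc k \<le> i + j"
  shows "q dvd smult (P ^ i) (monom 1 (e * j))"
  using assms(2)
proof (induction j arbitrary: i)
  case 0
  then have "P ^ i = 0" using P_nilpotent by (metis add.right_neutral le_add_diff_inverse mult_zero_left power_add)
  then show ?case by simp
next
  case (Suc j)
  obtain y where y: "q - monom 1 e = [:P:] * y" using eisensteinD(3)[OF q] by (auto elim: dvdE)
  have "smult (P ^ i) (monom 1 (e * Suc j)) = smult (P ^ i) (monom 1 (e * j) * monom 1 e)"
    by (simp add: mult_monom add.commute)
  also have "monom 1 e = q - [:P:] * y" using y by (simp add: algebra_simps)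
  also have "smult (P ^ i) (monom 1 (e * j) * (q - [:P:] * y)) =
      q * smult (P ^ i) (monom 1 (e * j)) - smult (P ^ Suc i) (monom 1 (e * j)) * y"
    by (simp add: algebra_simps smult_diff_right)
  finally have "smult (P ^ i) (monom 1 (e * Suc j)) =
      q * smult (P ^ i) (monom 1 (e * j)) - smult (P ^ Suc i) (monom 1 (e * j)) * y" .
  moreover have "q dvd smult (P ^ Suc i) (monom 1 (e * j))" using Suc.IH[of "Suc i"] Suc.prems by simp
  ultimately show ?case by (metis dvd_diff dvd_mult2 dvd_triv_left)
qed

lemma eisenstein_dvd_X_power:
  assumes "eisenstein q" shows "q dvd monom 1 (e * Suc k)"
  using eisenstein_dvd_monomial[OF assms, of 0 "Suc k"] by simp

text \<open>As \<open>e * k < a\<close>, a change of \<open>t\<close> by a multiple of Y^a provides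
  \<open>k\<close> blocks of \<open>e\<close> factors Y, one block less than \<open>q\<close> is
  known to divide. The missing one comes from the shape Y^e + P y of t * q: in the first summand the
  factor Y^e supplies it, in the second the factor \<open>P\<close> stands in for it.\<close>

lemma subst_resultant_cong:
  assumes q: "eisenstein q" and t: "coeff t 0 dvd 1" and tt': "monom 1 a dvd t' - t"
  shows "subst_resultant t' q = subst_resultant t q"
proof -
  let ?s = "subst_resultant t q"
  let ?w = "t * [:0, 1:]" and ?w' = "t' * [:0, 1:]"
  note qD = eisensteinD[OF q]
  have s: "degree ?s = e" "lead_coeff ?s = 1" "q dvd pcompose ?s ?w"
    using subst_resultant_monic[OF qD(2)] dvd_pcompose_subst_resultant[of q t] qD(1) e_pos by auto
  obtain h where h: "t' - t = monom 1 a * h" using tt' by (auto elim: dvdE)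
  have "coeff (t' - t) 0 = 0" using e_less_a by (simp add: h coeff_monom_mult)
  then have t': "coeff t' 0 dvd 1" using t by simp
  have a: "monom 1 a = monom 1 (e * k) * monom (1::'b) (a - e * k)"
    using a_gt by (simp add: mult_monom)
  obtain y where y: "?s - monom 1 e = [:P:] * y"
    using eisensteinD(3)[OF eisenstein_subst_resultant[OF q t]] by (auto elim: dvdE)
  have "pcompose ?s w = w ^ e + [:P:] * pcompose y w" for w
  proof -
    have "?s = monom 1 e + [:P:] * y" using y by (simp add: algebra_simps)
    then show ?thesis
      by (metis pcompose_add pcompose_const pcompose_monom_one pcompose_mult)
  qed
  then have "pcompose ?s ?w' - pcompose ?s ?w =
      monom 1 e * (t' ^ e - t ^ e) + [:P:] * (pcompose y ?w' - pcompose y ?w)"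
    by (simp only: mult_X_power) (simp add: algebra_simps)
  moreover have "q dvd monom 1 e * (t' ^ e - t ^ e)"
  proof -
    have "t' - t dvd t' ^ e - t ^ e" by (simp add: power_diff_sumr2)
    then obtain z where "t' ^ e - t ^ e = (t' - t) * z" by (auto elim: dvdE)
    then have "monom 1 e * (t' ^ e - t ^ e) =
        (monom 1 e * monom 1 (e * k)) * (monom 1 (a - e * k) * h * z)"
      unfolding h a by (simp add: mult_ac)
    also have "monom 1 e * monom 1 (e * k) = monom (1::'b) (e * Suc k)" by (simp add: mult_monom)
    finally show ?thesis using eisenstein_dvd_X_power[OF q] by simp
  qed
  moreover have "q dvd [:P:] * (pcompose y ?w' - pcompose y ?w)"
  proof -
    obtain z where "pcompose y ?w' - pcompose y ?w = (?w' - ?w) * z"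
      using pcompose_diff_dvd[of ?w' ?w y] by (auto elim: dvdE)
    also have "?w' - ?w = monom 1 a * h * [:0, 1:]"
      unfolding h[symmetric] by (simp only: left_diff_distrib)
    finally have "[:P:] * (pcompose y ?w' - pcompose y ?w) =
        ([:P:] * monom 1 (e * k)) * (monom 1 (a - e * k) * h * [:0, 1:] * z)"
      unfolding a by (simp only: mult_ac)
    moreover have "q dvd [:P:] * monom 1 (e * k)"
      using eisenstein_dvd_monomial[OF q, of 1 k] by simp
    ultimately show ?thesis by (metis dvd_mult2)
  qed
  ultimately have "q dvd pcompose ?s ?w' - pcompose ?s ?w" by simp
  then have "q dvd pcompose ?s ?w'" using s(3) by (metis diff_add_cancel dvd_add)
  then show ?thesis using subst_resultant_unique[OF q t' s(1,2)] by simp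
qed

section \<open>The substitution product on representatives\<close>

definition subst :: "'b poly \<Rightarrow> 'b poly \<Rightarrow> 'b poly" where
  "subst t1 t2 = pcompose t1 (t2 * [:0, 1:]) * t2"

lemma coeff_subst_0: "coeff (subst t1 t2) 0 = coeff t1 0 * coeff t2 0"
  by (simp add: subst_def coeff_mult_0 coeff_pcompose_0 poly_0_coeff_0)

lemma subst_unit: "coeff t1 0 dvd 1 \<Longrightarrow> coeff t2 0 dvd 1 \<Longrightarrow> coeff (subst t1 t2) 0 dvd 1"
  by (simp add: coeff_subst_0 unit_mult)

text \<open>Multiplication by Y turns the substitution product into composition of polynomials
  without constant term. Associativity and the law of the action are read off from this.\<close>

lemma subst_mult_X: "subst t1 t2 * [:0, 1:] = pcompose (t1 * [:0, 1:]) (t2 * [:0, 1:])"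
  by (simp only: subst_def pcompose_mult mult.assoc pcompose_pCons pcompose_0) simp

lemma subst_assoc: "subst (subst t1 t2) t3 = subst t1 (subst t2 t3)"
proof -
  have "subst t1 (subst t2 t3) = pcompose t1 (subst t2 t3 * [:0, 1:]) * subst t2 t3"
    by (simp only: subst_def)
  also have "\<dots> = pcompose (pcompose t1 (t2 * [:0, 1:])) (t3 * [:0, 1:]) * subst t2 t3"
    by (simp only: subst_mult_X pcompose_assoc)
  also have "\<dots> = subst (subst t1 t2) t3"
    by (simp only: subst_def pcompose_mult mult.assoc)
  finally show ?thesis ..
qed

lemma subst_1: "subst 1 t = t" "subst t 1 = t"
  by (simp_all add: subst_def pcompose_1 pcompose_idR[folded one_pCons])

text \<open>The substitution of tY sends Y^n to a multiple of Y^n, so congruences modulo Y^n survive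
  in the left argument; in the right argument they survive because \<open>w - w'\<close> divides the
  difference of the compositions with \<open>w\<close> and \<open>w'\<close>.\<close>

lemma subst_cong:
  assumes "monom 1 n dvd t1' - t1" "monom 1 n dvd t2' - t2"
  shows "monom 1 n dvd subst t1' t2' - subst t1 t2"
proof -
  let ?w = "t2 * [:0, 1:]" and ?w' = "t2' * [:0, 1:]"
  obtain h where h: "t1' - t1 = monom 1 n * h" using assms(1) by (auto elim: dvdE)
  have "subst t1' t2' - subst t1 t2 =
      pcompose (t1' - t1) ?w' * t2' + (pcompose t1 ?w' - pcompose t1 ?w) * t2'
      + pcompose t1 ?w * (t2' - t2)"
    by (simp only: subst_def pcompose_diff) (simp add: algebra_simps)
  moreover have "monom 1 n dvd pcompose (t1' - t1) ?w'"
    by (simp only: h pcompose_mult pcompose_monom_one mult_X_power mult.assoc dvd_triv_left)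
  moreover have "monom 1 n dvd pcompose t1 ?w' - pcompose t1 ?w"
  proof (rule dvd_trans[OF _ pcompose_diff_dvd])
    have "?w' - ?w = (t2' - t2) * [:0, 1:]" by (simp only: left_diff_distrib)
    then show "monom 1 n dvd ?w' - ?w" using assms(2) by (metis dvd_mult2)
  qed
  ultimately show ?thesis using assms(2) by (simp add: dvd_add dvd_mult dvd_mult2)
qed

text \<open>One step of successive approximation: if the correction \<open>h\<close> cancels the
  lowest coefficient of the error \<open>f\<close> divided by Y^n, the error moves up to order n +
  1. It serves for the inverses with respect to both products.\<close>

lemma monom_dvd_add_step:
  fixes f g h :: "'b poly"
  assumes "f = monom 1 n * g" "coeff (g + h) 0 = 0"
  shows "monom 1 (Suc n) dvd f + monom 1 n * h"
proof -
  obtain c g' where g': "g + h = pCons c g'" by (cases "g + h")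
  then have "g + h = [:0, 1:] * g'" using assms(2) by simp
  then have "f + monom 1 n * h = monom 1 n * ([:0, 1:] * g')"
    using assms(1) by (metis distrib_left)
  also have "\<dots> = monom 1 (Suc n) * g'" by (simp add: monom_Suc)
  finally show ?thesis by simp
qed

lemma inverse_mod_X_power:
  fixes t :: "'b poly"
  assumes "coeff t 0 dvd 1"
  shows "\<exists>s. monom 1 n dvd t * s - 1"
proof (induction n)
  case (Suc n)
  then obtain s g where g: "t * s - 1 = monom 1 n * g" by (auto elim: dvdE)
  obtain z where z: "coeff t 0 * z = 1" using assms by (metis dvdE)
  define c where "c = - (z * coeff g 0)"
  have "monom c n = smult c (monom 1 n)" by (simp add: smult_monom)
  then have "t * (s + monom c n) - 1 = (t * s - 1) + monom 1 n * smult c t"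
    by (simp add: algebra_simps)
  moreover have "coeff (g + smult c t) 0 = coeff g 0 - coeff t 0 * z * coeff g 0"
    by (simp add: c_def mult_ac)
  then have "coeff (g + smult c t) 0 = 0" by (simp add: z)
  ultimately have "monom 1 (Suc n) dvd t * (s + monom c n) - 1"
    using monom_dvd_add_step[OF g] by metis
  then show ?case ..
qed (simp add: monom_0 flip: one_pCons)

lemma unit_of_inverse_mod_X_power:
  fixes t s :: "'b poly"
  assumes "0 < n" "monom 1 n dvd t * s - 1"
  shows "coeff t 0 dvd 1"
proof -
  obtain h where "t * s - 1 = monom 1 n * h" using assms(2) by (auto elim: dvdE)
  then have "coeff (t * s - 1) 0 = 0" using assms(1) by (simp add: coeff_monom_mult)
  then have "coeff t 0 * coeff s 0 = 1" by (simp add: coeff_mult_0)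
  then show ?thesis by (metis dvd_triv_left)
qed

text \<open>The coefficients of \<open>s\<close> are found one after the other: a term c Y^(n+1) in
  \<open>s\<close> changes the product first at Y^(n+1), by \<open>c\<close> times a power of the
  unit t(0), so every error there can be cancelled.\<close>

lemma subst_left_inverse:
  assumes t: "coeff t 0 dvd 1"
  shows "\<exists>s. coeff s 0 dvd 1 \<and> monom 1 n dvd subst s t - 1"
proof -
  obtain z where z: "coeff t 0 * z = 1" using t by (metis dvdE)
  \<comment> \<open>The exponent is at least 1, so that \<open>coeff s 0 * coeff t 0 = 1\<close> can
    be read off even for \<open>n = 0\<close> in the claim.\<close>
  have "\<exists>s. monom 1 (Suc n) dvd subst s t - 1" for n
  proof (induction n)
    case 0
    have "coeff (subst [:z:] t - 1) 0 = 0" using z by (simp add: coeff_subst_0 mult.commute)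
    then have "monom 1 (Suc 0) dvd subst [:z:] t - 1"
      using monom_dvd_add_step[of "subst [:z:] t - 1" 0 "subst [:z:] t - 1" 0]
      by (simp add: monom_0 flip: one_pCons)
    then show ?case ..
  next
    case (Suc n)
    then obtain s g where g: "subst s t - 1 = monom 1 (Suc n) * g" by (auto elim: dvdE)
    \<comment> \<open>Substitution into c Y^(n+1) gives n + 1 factors \<open>t\<close> and the final
      multiplication one more; their constant terms are cancelled by as many factors
      \<open>z\<close>.\<close>
    define c where "c = - (z ^ Suc (Suc n) * coeff g 0)"
    have "pcompose (monom c (Suc n)) (t * [:0, 1:]) = smult c (monom 1 (Suc n) * t ^ Suc n)"
    proof -
      have "monom c (Suc n) = smult c (monom 1 (Suc n))" by (simp add: smult_monom)
      then show ?thesis by (simp only: pcompose_smult pcompose_monom_one mult_X_power)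
    qed
    then have "subst (s + monom c (Suc n)) t - 1 =
        (subst s t - 1) + monom 1 (Suc n) * smult c (t ^ Suc (Suc n))"
      by (simp only: subst_def pcompose_add) (simp add: algebra_simps)
    moreover have "coeff (g + smult c (t ^ Suc (Suc n))) 0 = 0"
    proof -
      have "coeff (smult c (t ^ Suc (Suc n))) 0 = c * coeff t 0 ^ Suc (Suc n)"
        by (simp only: coeff_smult coeff_0_power)
      also have "\<dots> = - ((coeff t 0 * z) ^ Suc (Suc n) * coeff g 0)"
        by (simp only: c_def power_mult_distrib) (simp add: algebra_simps)
      also have "\<dots> = - coeff g 0" by (simp add: z)
      finally show ?thesis by simp
    qed
    ultimately have "monom 1 (Suc (Suc n)) dvd subst (s + monom c (Suc n)) t - 1"
      using monom_dvd_add_step[OF g] by metis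
    then show ?case ..
  qed
  then obtain s where s: "monom 1 (Suc n) dvd subst s t - 1" by blast
  have "coeff s 0 dvd 1"
  proof -
    obtain h where "subst s t - 1 = monom 1 (Suc n) * h" using s by (auto elim: dvdE)
    then have "coeff (subst s t - 1) 0 = 0" by (simp add: coeff_monom_mult)
    then have "coeff s 0 * coeff t 0 = 1" by (simp add: coeff_subst_0)
    then show ?thesis by (metis dvd_triv_left)
  qed
  moreover have "monom 1 n dvd monom (1::'b) (Suc n)"
    by (metis dvd_triv_left mult_monom mult_1 plus_1_eq_Suc add.commute)
  ultimately show ?thesis using s dvd_trans by blast
qed

lemma subst_resultant_1:
  assumes "eisenstein q" shows "subst_resultant 1 q = q"
  using subst_resultant_unique[OF assms, of 1 q] eisensteinD[OF assms] by (simp add: pcompose_idR[folded one_pCons])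

text \<open>Composition with \<open>t2 * [:0, 1:]\<close> preserves divisibility, so
  \<open>q\<close> divides \<open>?q2\<close> composed with it, which divides \<open>?q1\<close>
  composed with both substitutions. Together these are the substitution belonging to
  \<open>subst t1 t2\<close>, and uniqueness applies.\<close>

lemma subst_resultant_subst:
  assumes q: "eisenstein q" and t1: "coeff t1 0 dvd 1" and t2: "coeff t2 0 dvd 1"
  shows "subst_resultant (subst t1 t2) q = subst_resultant t1 (subst_resultant t2 q)"
proof -
  let ?q2 = "subst_resultant t2 q"
  let ?q1 = "subst_resultant t1 ?q2"
  have q2: "eisenstein ?q2" and q1: "eisenstein ?q1"
    using q t1 t2 by (simp_all add: eisenstein_subst_resultant)
  have deg: "degree q = e" "degree ?q2 = e" using q q2 by (auto dest: eisensteinD)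
  have "q dvd pcompose ?q2 (t2 * [:0, 1:])"
    using dvd_pcompose_subst_resultant deg e_pos by metis
  moreover have "?q2 dvd pcompose ?q1 (t1 * [:0, 1:])"
    using dvd_pcompose_subst_resultant deg e_pos by metis
  then have "pcompose ?q2 (t2 * [:0, 1:]) dvd pcompose (pcompose ?q1 (t1 * [:0, 1:])) (t2 * [:0, 1:])"
    by (metis dvd_def pcompose_mult)
  ultimately have "q dvd pcompose (pcompose ?q1 (t1 * [:0, 1:])) (t2 * [:0, 1:])"
    by (rule dvd_trans)
  then have "q dvd pcompose ?q1 (subst t1 t2 * [:0, 1:])"
    by (simp only: subst_mult_X pcompose_assoc)
  then show ?thesis
    by (rule subst_resultant_unique[OF q subst_unit[OF t1 t2] eisensteinD(1,2)[OF q1], symmetric])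
qed

end

section \<open>Finite chain rings\<close>

text \<open>A finite local principal ideal ring with a chosen generator \<open>u\<close> of its
  maximal ideal and the exact nilpotency exponent \<open>a\<close> of \<open>u\<close>. Keeping
  \<open>u\<close> as a parameter allows a change of uniformizer; record rings cover both R and the
  rings on \<open>nat\<close>.\<close>

locale finite_chain_ring = cring R for R (structure) +
  fixes u and a :: nat
  assumes finite_carrier: "finite (carrier R)"
    and u_closed [simp, intro]: "u \<in> carrier R"
    and unit_or_multiple: "x \<in> carrier R \<Longrightarrow> x \<in> Units R \<or> (\<exists>y\<in>carrier R. x = u \<otimes> y)"
    and a_pos: "0 < a" and u_pow_a: "u [^] a = \<zero>" and u_pow: "u [^] (a - 1) \<noteq> \<zero>"
begin

declare Units_closed [simp]

lemma unit_cancel: "v \<in> Units R \<Longrightarrow> x \<in> carrier R \<Longrightarrow> inv v \<otimes> (v \<otimes> x) = x"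
  by (metis Units_closed Units_inv_closed Units_l_inv l_one m_assoc)

text \<open>For \<open>n \<le> a\<close> this is the set of elements of order at least
  \<open>n\<close>; \<open>max_ideal_pow\<close> below identifies it with the power of the maximal
  ideal.\<close>

definition V :: "nat \<Rightarrow> 'a set" where
  "V n = PIdl (u [^] n)"

lemma V_iff: "x \<in> V n \<longleftrightarrow> (\<exists>y\<in>carrier R. x = u [^] n \<otimes> y)"
  by (auto simp: V_def cgenideal_def m_comm)

lemma V_ideal: "ideal (V n) R"
  by (simp add: V_def cgenideal_ideal)

lemma V_closed [simp]: "x \<in> V n \<Longrightarrow> x \<in> carrier R"
  by (auto simp: V_iff)

lemma V_add: "x \<in> V n \<Longrightarrow> y \<in> V n \<Longrightarrow> x \<oplus> y \<in> V n"
  by (meson V_ideal additive_subgroup.a_closed ideal.axioms(1))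

lemma V_minus: "x \<in> V n \<Longrightarrow> \<ominus> x \<in> V n"
  by (meson V_ideal additive_subgroup.a_inv_closed ideal.axioms(1))

lemma V_diff: "x \<in> V n \<Longrightarrow> y \<in> V n \<Longrightarrow> x \<ominus> y \<in> V n"
  by (simp add: a_minus_def V_add V_minus)

lemma V_mult_l: "x \<in> V n \<Longrightarrow> y \<in> carrier R \<Longrightarrow> y \<otimes> x \<in> V n"
  by (meson V_ideal ideal.I_l_closed)

lemma V_mult_r: "x \<in> V n \<Longrightarrow> y \<in> carrier R \<Longrightarrow> x \<otimes> y \<in> V n"
  by (meson V_ideal ideal.I_r_closed)

lemma V_zero: "\<zero> \<in> V n"
  by (meson V_ideal additive_subgroup.zero_closed ideal.axioms(1))

lemma u_pow_V: "u [^] n \<in> V n"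
  unfolding V_iff by (rule bexI[of _ \<one>]) auto

lemma u_V: "u \<in> V 1"
  using u_pow_V[of 1] by simp

lemma V_0: "V 0 = carrier R"
  by (auto simp: V_iff)

lemma V_a: "V a = {\<zero>}"
  using V_zero[of a] by (auto simp: V_iff u_pow_a)

lemma V_mult: "x \<in> V m \<Longrightarrow> y \<in> V n \<Longrightarrow> x \<otimes> y \<in> V (m + n)"
proof -
  assume "x \<in> V m" "y \<in> V n"
  then obtain x' y' where "x' \<in> carrier R" "y' \<in> carrier R" "x = u [^] m \<otimes> x'" "y = u [^] n \<otimes> y'"
    by (auto simp: V_iff)
  moreover from this have "x \<otimes> y = u [^] (m + n) \<otimes> (x' \<otimes> y')"
    by (simp add: nat_pow_mult[symmetric] m_ac)
  ultimately show ?thesis unfolding V_iff by blast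
qed

lemma V_antimono: "m \<le> n \<Longrightarrow> V n \<subseteq> V m"
proof
  fix x assume "m \<le> n" "x \<in> V n"
  then obtain y where "y \<in> carrier R" "x = u [^] m \<otimes> u [^] (n - m) \<otimes> y"
    by (auto simp: V_iff nat_pow_mult)
  then have "x = u [^] m \<otimes> (u [^] (n - m) \<otimes> y)" "u [^] (n - m) \<otimes> y \<in> carrier R"
    by (simp_all add: m_assoc)
  then show "x \<in> V m" unfolding V_iff by blast
qed

lemma V_zero_ge: "a \<le> n \<Longrightarrow> V n = {\<zero>}"
  using V_antimono[of a n] V_a V_zero by blast

lemma one_neq_zero: "\<one> \<noteq> \<zero>"
  using u_pow one_zeroD by fastforce

lemma pow_V1:
  assumes "x \<in> V 1" shows "x [^] n \<in> V n"
proof (induction n)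
  case (Suc n) then show ?case using V_mult[OF Suc assms] by simp
qed (simp add: V_0)

lemma V1_not_unit:
  assumes "x \<in> V 1" shows "x \<notin> Units R"
proof
  assume "x \<in> Units R"
  then have "x [^] a \<in> Units R" by (rule Units_pow_closed)
  moreover have "x [^] a = \<zero>" using pow_V1[OF assms, of a] V_a by simp
  ultimately show False using one_neq_zero by (metis Units_r_inv Units_inv_closed l_null)
qed

lemma nonunit_iff: "x \<in> carrier R \<Longrightarrow> x \<in> V 1 \<longleftrightarrow> x \<notin> Units R"
  by (metis V1_not_unit V_iff nat_pow_eone u_closed unit_or_multiple)

lemma unit_add_V1:
  assumes "v \<in> Units R" "x \<in> V 1" shows "v \<oplus> x \<in> Units R"
proof (rule ccontr)
  assume n: "v \<oplus> x \<notin> Units R"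
  have c: "v \<in> carrier R" "x \<in> carrier R" using assms by auto
  then have "v \<oplus> x \<in> V 1" using n nonunit_iff by blast
  then have "(v \<oplus> x) \<ominus> x \<in> V 1" using assms(2) by (rule V_diff)
  also have "(v \<oplus> x) \<ominus> x = v" using c by algebra
  finally show False using V1_not_unit assms(1) by blast
qed

lemma factor_or_V:
  assumes "x \<in> carrier R"
  shows "(\<exists>n v. n < m \<and> v \<in> Units R \<and> x = v \<otimes> u [^] n) \<or> x \<in> V m"
proof (induction m)
  case (Suc m)
  then show ?case
  proof
    assume "x \<in> V m"
    then obtain y where y: "y \<in> carrier R" "x = u [^] m \<otimes> y" by (auto simp: V_iff)
    show ?case
    proof (cases "y \<in> Units R")
      case True
      then show ?thesis using y by (auto simp: m_comm)
    next
      case False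
      then obtain z where "z \<in> carrier R" "y = u \<otimes> z" using unit_or_multiple y by blast
      then have "x = u [^] Suc m \<otimes> z" using y by (simp add: m_assoc)
      then show ?thesis using \<open>z \<in> carrier R\<close> V_iff by blast
    qed
  qed (auto intro: less_SucI)
qed (use assms V_0 in simp)

lemma factorization:
  assumes "x \<in> carrier R"
  obtains n v where "n \<le> a" "v \<in> Units R" "x = v \<otimes> u [^] n"
proof -
  consider n v where "n < a" "v \<in> Units R" "x = v \<otimes> u [^] n" | "x \<in> V a"
    using factor_or_V[OF assms] by blast
  then show ?thesis
  proof cases
    case 1 then show ?thesis using that[of n v] by simp
  next
    \<comment> \<open>Zero gets the exponent \<open>a\<close> with the unit 1, in accordance with
      the convention that its order is \<open>a\<close>.\<close>
    case 2 then show ?thesis using that[of a \<one>] by (simp add: V_a u_pow_a)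
  qed
qed

lemma unit_mult_pow_V: "v \<in> Units R \<Longrightarrow> v \<otimes> u [^] n \<in> V n"
  by (simp add: V_mult_l u_pow_V)

text \<open>From u^n = u^(n+1) y follows u^n (1 - u y) = 0, and 1 - u y is a unit; so u^n = 0, which
  is excluded below the exponent \<open>a\<close>.\<close>

lemma unit_mult_pow_notin:
  assumes v: "v \<in> Units R" and "n < a"
  shows "v \<otimes> u [^] n \<notin> V (Suc n)"
proof
  assume "v \<otimes> u [^] n \<in> V (Suc n)"
  then have "inv v \<otimes> (v \<otimes> u [^] n) \<in> V (Suc n)" by (rule V_mult_l) (use v in auto)
  then have "u [^] n \<in> V (Suc n)" using v by (simp only: unit_cancel nat_pow_closed u_closed)
  then obtain y where y: "y \<in> carrier R" "u [^] n = u [^] Suc n \<otimes> y" by (auto simp: V_iff)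
  have w: "\<one> \<oplus> \<ominus> (u \<otimes> y) \<in> Units R"
    using y u_V by (intro unit_add_V1 V_minus V_mult_r) auto
  have c: "u [^] n \<in> carrier R" by simp
  have "u [^] n \<otimes> (\<one> \<oplus> \<ominus> (u \<otimes> y)) = u [^] n \<oplus> \<ominus> (u [^] Suc n \<otimes> y)"
    unfolding nat_pow_Suc using c y(1) u_closed by algebra
  also have "\<dots> = \<zero>" unfolding y(2)[symmetric] using c r_neg by blast
  finally have "u [^] n \<otimes> (\<one> \<oplus> \<ominus> (u \<otimes> y)) \<otimes> inv (\<one> \<oplus> \<ominus> (u \<otimes> y)) = \<zero>" using w by simp
  then have "u [^] n = \<zero>" using w c by (metis Units_closed Units_inv_closed Units_r_inv m_assoc r_one)
  then have "u [^] n \<otimes> u [^] (a - 1 - n) = \<zero>" by simp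
  then have "u [^] (a - 1) = \<zero>" using \<open>n < a\<close> by (simp add: nat_pow_mult)
  then show False using u_pow by blast
qed

lemma unit_mult_pow_in_V_iff:
  assumes v: "v \<in> Units R" and "n < a"
  shows "v \<otimes> u [^] n \<in> V m \<longleftrightarrow> m \<le> n"
proof
  assume m: "v \<otimes> u [^] n \<in> V m"
  show "m \<le> n"
  proof (rule ccontr)
    assume "\<not> m \<le> n"
    then have "V m \<subseteq> V (Suc n)" by (intro V_antimono) simp
    then show False using m unit_mult_pow_notin[OF assms] by blast
  qed
qed (use unit_mult_pow_V[OF v] V_antimono in blast)

text \<open>Orders are additive as long as the sum stays below \<open>a\<close>: if \<open>x\<close>
  had an order l < n, the product would have the order m + l < m + n \<le> a.\<close>

lemma V_cancel:
  assumes "x \<in> carrier R" "v \<in> Units R" "v \<otimes> u [^] m \<otimes> x \<in> V (m + n)" "m + n \<le> a"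
  shows "x \<in> V n"
proof -
  obtain l :: nat and w where lw: "w \<in> Units R" "x = w \<otimes> u [^] l" using factorization[OF assms(1)] by blast
  show ?thesis
  proof (cases "n \<le> l")
    case True
    then show ?thesis using unit_mult_pow_V[OF lw(1)] V_antimono lw(2) by blast
  next
    case False
    have "v \<otimes> u [^] m \<otimes> x = (v \<otimes> w) \<otimes> u [^] (m + l)"
      using lw assms(2) by (simp add: nat_pow_mult[symmetric] m_ac Units_closed)
    moreover have "v \<otimes> w \<in> Units R" "m + l < a" using False assms lw by auto
    ultimately have "m + n \<le> m + l" using assms(3) by (simp add: unit_mult_pow_in_V_iff)
    then show ?thesis using False by simp
  qed
qed

lemma ideal_is_V:
  assumes I: "ideal I R"
  shows "\<exists>n. I = V n"
proof -
  interpret I: ideal I R by fact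
  define n where "n = (LEAST n::nat. u [^] n \<in> I)"
  have "u [^] a \<in> I" using u_pow_a by simp
  then have n: "u [^] n \<in> I" unfolding n_def by (rule LeastI)
  have "I \<subseteq> V n"
  proof
    fix x assume x: "x \<in> I"
    then obtain v and m :: nat where m: "v \<in> Units R" "x = v \<otimes> u [^] m"
      using factorization[of x] I.Icarr by metis
    have "inv v \<otimes> x \<in> I" using x m(1) by (simp add: I.I_l_closed)
    then have "u [^] m \<in> I" using m by (simp only: unit_cancel nat_pow_closed u_closed)
    then have "n \<le> m" unfolding n_def by (rule Least_le)
    then show "x \<in> V n" using unit_mult_pow_V[OF m(1)] V_antimono m(2) by blast
  qed
  moreover have "V n \<subseteq> I"
    using n I.I_r_closed by (auto simp: V_iff)
  ultimately show ?thesis by blast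
qed

lemma maximalideal_iff: "maximalideal M R \<longleftrightarrow> M = V 1"
proof
  assume M: "maximalideal M R"
  interpret M: maximalideal M R by fact
  have "M \<subseteq> V 1"
  proof
    fix x assume x: "x \<in> M"
    show "x \<in> V 1"
    proof (rule ccontr)
      assume "x \<notin> V 1"
      then have "x \<in> Units R" using nonunit_iff[of x] x by auto
      then have "\<one> \<in> M" using x M.I_l_closed[of x "inv x"] by simp
      then show False using M.one_imp_carrier M.I_notcarr by blast
    qed
  qed
  moreover have "V 1 \<noteq> carrier R" using V1_not_unit by blast
  ultimately show "M = V 1" using M.I_maximal[OF V_ideal, of 1] V_closed by blast
next
  assume M: "M = V 1"
  show "maximalideal M R"
    unfolding M
  proof (rule maximalidealI[OF V_ideal])
    show "carrier R \<noteq> V 1" using V1_not_unit by blast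
  next
    fix J assume J: "ideal J R" "V 1 \<subseteq> J" "J \<subseteq> carrier R"
    then obtain n where n: "J = V n" using ideal_is_V by blast
    show "J = V 1 \<or> J = carrier R"
    proof (cases n)
      case (Suc m)
      then have "J \<subseteq> V 1" unfolding n by (intro V_antimono) simp
      then show ?thesis using J by blast
    qed (simp add: n V_0)
  qed
qed

lemma finite_local_pir: "finite_local_pir R"
  unfolding finite_local_pir_def
proof (intro conjI allI impI)
  show "\<exists>!M. maximalideal M R" by (auto simp: maximalideal_iff)
next
  fix I assume "ideal I R"
  then obtain n where "I = V n" using ideal_is_V by blast
  then show "principalideal I R" by (simp add: V_def cgenideal_is_principalideal)
qed (auto simp: cring_axioms finite_carrier)

lemma max_ideal: "max_ideal R = V 1"
  by (simp add: max_ideal_def maximalideal_iff)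

lemma max_ideal_pow: "max_ideal_pow R n = V n"
proof (induction n)
  case 0
  then show ?case by (simp add: max_ideal_pow_def ideals_set_def nat_pow_def V_0)
next
  case (Suc n)
  have "max_ideal_pow R (Suc n) = V n \<cdot> V 1"
    using Suc by (simp add: max_ideal_pow_def ideals_set_def nat_pow_def max_ideal)
  also have "\<dots> = V (Suc n)"
  proof
    show "V n \<cdot> V 1 \<subseteq> V (Suc n)"
    proof
      fix x assume "x \<in> V n \<cdot> V 1"
      then show "x \<in> V (Suc n)"
        by (induction rule: ideal_prod.induct) (use V_mult[of _ n _ 1] V_add in auto)
    qed
    show "V (Suc n) \<subseteq> V n \<cdot> V 1"
    proof
      fix x assume "x \<in> V (Suc n)"
      then obtain y where y: "y \<in> carrier R" "x = u [^] n \<otimes> (u \<otimes> y)"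
        by (auto simp: V_iff m_assoc)
      then show "x \<in> V n \<cdot> V 1"
        unfolding y(2) by (intro ideal_prod.prod u_pow_V V_mult_r u_V)
    qed
  qed
  finally show ?case .
qed

lemma nilpotency_index: "nilpotency_index R = a"
  unfolding nilpotency_index_def max_ideal_pow
proof (rule Least_equality)
  fix n assume "0 < n \<and> V n = {\<zero>}"
  then have "u [^] n = \<zero>" using u_pow_V[of n] by simp
  show "a \<le> n"
  proof (rule ccontr)
    assume "\<not> a \<le> n"
    then have "\<one> \<otimes> u [^] n \<notin> V (Suc n)" by (intro unit_mult_pow_notin) auto
    then show False using \<open>u [^] n = \<zero>\<close> V_zero by simp
  qed
qed (simp add: a_pos V_a)

lemma max_ideal_ord:
  assumes v: "v \<in> Units R" and "n \<le> a"
  shows "max_ideal_ord R (v \<otimes> u [^] n) = n"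
proof (cases "n = a")
  case True
  then have "v \<otimes> u [^] n = \<zero>" using v by (simp add: u_pow_a)
  then show ?thesis using True by (simp add: max_ideal_ord_def nilpotency_index)
next
  case False
  then have n: "n < a" using assms by simp
  then have "v \<otimes> u [^] n \<noteq> \<zero>" using unit_mult_pow_notin[OF v] V_zero by metis
  moreover have "(THE m. v \<otimes> u [^] n \<in> V m - V (Suc m)) = n"
    by (rule the_equality) (auto simp: unit_mult_pow_in_V_iff[OF v n])
  ultimately show ?thesis by (simp add: max_ideal_ord_def max_ideal_pow)
qed

lemma factorization_ord:
  assumes "x \<in> carrier R"
  obtains v where "v \<in> Units R" "x = v \<otimes> u [^] max_ideal_ord R x"
  using factorization[OF assms] max_ideal_ord by metis

lemma uniformizers:
  assumes "1 < a" shows "uniformizers R = {v \<otimes> u | v. v \<in> Units R}"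
proof -
  have "\<exists>v. v \<in> Units R \<and> x = v \<otimes> u" if "x \<in> uniformizers R" for x
  proof -
    have x: "x \<in> carrier R" "max_ideal_ord R x = 1" using that by (auto simp: uniformizers_def)
    show ?thesis by (rule factorization_ord[OF x(1)]) (use x(2) in auto)
  qed
  moreover have "v \<otimes> u \<in> uniformizers R" if "v \<in> Units R" for v
    using max_ideal_ord[OF that, of 1] that assms by (simp add: uniformizers_def)
  ultimately show ?thesis by blast
qed

text \<open>A unit multiple of \<open>u\<close> generates the same ideals. This makes all facts
  about \<open>u\<close> available at any uniformizer, in particular at a zero of an Eisenstein
  polynomial.\<close>

lemma uniformizer_chain:
  assumes "1 < a" "x \<in> uniformizers R"
  shows "finite_chain_ring R x a"
proof -
  obtain v where v: "v \<in> Units R" "x = v \<otimes> u" using uniformizers assms by blast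
  have pow: "x [^] n = v [^] n \<otimes> u [^] n" for n :: nat
    using v by (simp add: nat_pow_distrib Units_closed)
  show ?thesis
  proof unfold_locales
    fix y assume y: "y \<in> carrier R"
    show "y \<in> Units R \<or> (\<exists>z\<in>carrier R. y = x \<otimes> z)"
    proof (cases "y \<in> Units R")
      case False
      then obtain z where z: "z \<in> carrier R" "y = u \<otimes> z" using unit_or_multiple y by blast
      have "x \<otimes> (inv v \<otimes> z) = (v \<otimes> inv v) \<otimes> u \<otimes> z"
        using v z by (simp add: m_ac Units_closed del: Units_r_inv Units_l_inv)
      then have "y = x \<otimes> (inv v \<otimes> z)" using v z by simp
      moreover have "inv v \<otimes> z \<in> carrier R" using v z by simp
      ultimately show ?thesis by blast
    qed simp
  next
    show "x [^] (a - 1) \<noteq> \<zero>"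
    proof
      assume "x [^] (a - 1) = \<zero>"
      then have "v [^] (a - 1) \<otimes> u [^] (a - 1) \<in> V (Suc (a - 1))" using pow V_zero by simp
      then show False using unit_mult_pow_notin[of "v [^] (a - 1)" "a - 1"] v a_pos
        by (simp add: Units_pow_closed)
    qed
  qed (use finite_carrier a_pos v u_pow_a pow in \<open>auto simp: Units_closed\<close>)
qed

end

text \<open>The passage from the definition to the working hypotheses: the complement of the maximal
  ideal consists of units, its generator is nilpotent, and the exact exponent of the generator is
  the nilpotency index.\<close>

lemma finite_local_pir_chain:
  assumes "finite_local_pir R"
  shows "\<exists>u. finite_chain_ring R u (nilpotency_index R)"
proof -
  interpret cring R using assms by (simp add: finite_local_pir_def)
  have fin: "finite (carrier R)" using assms by (simp add: finite_local_pir_def)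
  obtain M where M: "maximalideal M R" and uniq: "\<And>M'. maximalideal M' R \<Longrightarrow> M' = M"
    using assms by (auto simp: finite_local_pir_def)
  interpret M: maximalideal M R by fact
  have "principalideal M R" using assms M.is_ideal by (simp add: finite_local_pir_def)
  then obtain u where u: "u \<in> carrier R" "M = PIdl\<^bsub>R\<^esub> u"
    using principalideal.generate cgenideal_eq_genideal by metis
  have unit_or: "x \<in> Units R \<or> x \<in> M" if x: "x \<in> carrier R" for x
  proof (rule disjCI)
    assume "x \<notin> M"
    \<comment> \<open>A non-unit outside \<open>M\<close> generates a proper ideal. Among the
      finitely many ideals there is a maximal proper one above it, and this would be a second
      maximal ideal.\<close>
    let ?C = "{I. ideal I R \<and> x \<in> I \<and> I \<noteq> carrier R}"
    have "?C \<subseteq> Pow (carrier R)" by (auto dest: ideal.Icarr)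
    then have finC: "finite ?C" by (rule finite_subset) (simp add: fin)
    show "x \<in> Units R"
    proof (rule ccontr)
      assume "x \<notin> Units R"
      then have "\<one>\<^bsub>R\<^esub> \<notin> PIdl\<^bsub>R\<^esub> x" using x
        by (auto simp: cgenideal_def Units_def m_comm)
      then have "PIdl\<^bsub>R\<^esub> x \<in> ?C" using x by (auto simp: cgenideal_ideal cgenideal_self)
      then obtain J where J: "J \<in> ?C" "\<forall>I\<in>?C. J \<subseteq> I \<longrightarrow> J = I"
        using finite_has_maximal2[OF finC] by meson
      have "maximalideal J R"
      proof (rule maximalidealI)
        fix I assume "ideal I R" "J \<subseteq> I" "I \<subseteq> carrier R"
        then show "I = J \<or> I = carrier R" using J by blast
      qed (use J in auto)
      then have "J = M" by (rule uniq)
      then show False using J \<open>x \<notin> M\<close> by blast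
    qed
  qed
  have one: "\<one>\<^bsub>R\<^esub> \<notin> M" using M.one_imp_carrier M.I_notcarr by blast
  have uM: "u \<in> M" using u cgenideal_self by blast
  have "\<exists>n::nat. u [^]\<^bsub>R\<^esub> n = \<zero>\<^bsub>R\<^esub>"
  proof -
    have "\<not> inj (\<lambda>n::nat. u [^]\<^bsub>R\<^esub> n)"
    proof
      assume "inj (\<lambda>n::nat. u [^]\<^bsub>R\<^esub> n)"
      moreover have "finite (range (\<lambda>n::nat. u [^]\<^bsub>R\<^esub> n))"
        using fin by (rule finite_subset[rotated]) (use u in auto)
      ultimately show False using finite_imageD by blast
    qed
    then obtain m n :: nat where mn: "m < n" "u [^]\<^bsub>R\<^esub> m = u [^]\<^bsub>R\<^esub> n"
      unfolding inj_def by (metis nat_neq_iff)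
    \<comment> \<open>Two powers of \<open>u\<close> coincide, so u^m is annihilated by
      \<open>w\<close>; and \<open>w\<close> lies outside \<open>M\<close>, hence is a unit.\<close>
    define w where "w = \<one>\<^bsub>R\<^esub> \<ominus>\<^bsub>R\<^esub> u [^]\<^bsub>R\<^esub> (n - m)"
    have "u [^]\<^bsub>R\<^esub> (n - m) \<in> M"
    proof -
      have "u [^]\<^bsub>R\<^esub> Suc (n - m - 1) \<in> M"
        unfolding nat_pow_Suc by (rule M.I_l_closed[OF uM nat_pow_closed[OF u(1)]])
      then show ?thesis using mn by (simp only: Suc_diff_1 zero_less_diff)
    qed
    moreover have "\<one>\<^bsub>R\<^esub> = w \<oplus>\<^bsub>R\<^esub> u [^]\<^bsub>R\<^esub> (n - m)"
      unfolding w_def using u nat_pow_closed[of u "n - m"] by algebra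
    ultimately have "w \<notin> M" using one by (metis M.a_closed)
    then have w: "w \<in> Units R" using unit_or[of w] u by (simp add: w_def)
    have "u [^]\<^bsub>R\<^esub> m \<otimes>\<^bsub>R\<^esub> w = u [^]\<^bsub>R\<^esub> m \<ominus>\<^bsub>R\<^esub> u [^]\<^bsub>R\<^esub> m \<otimes>\<^bsub>R\<^esub> u [^]\<^bsub>R\<^esub> (n - m)"
      unfolding w_def using u nat_pow_closed[of u "n - m"] nat_pow_closed[of u m] by algebra
    also have "u [^]\<^bsub>R\<^esub> m \<otimes>\<^bsub>R\<^esub> u [^]\<^bsub>R\<^esub> (n - m) = u [^]\<^bsub>R\<^esub> m"
      using nat_pow_mult[OF u(1), of m "n - m"] mn by simp
    finally have "u [^]\<^bsub>R\<^esub> m \<otimes>\<^bsub>R\<^esub> w = \<zero>\<^bsub>R\<^esub>" using u by (simp add: a_minus_def r_neg)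
    then have "u [^]\<^bsub>R\<^esub> m \<otimes>\<^bsub>R\<^esub> w \<otimes>\<^bsub>R\<^esub> inv\<^bsub>R\<^esub> w = \<zero>\<^bsub>R\<^esub>" using w by simp
    then have "u [^]\<^bsub>R\<^esub> m = \<zero>\<^bsub>R\<^esub>" using w u by (simp add: m_assoc Units_closed)
    then show ?thesis by blast
  qed
  then obtain n0 :: nat where n0: "u [^]\<^bsub>R\<^esub> n0 = \<zero>\<^bsub>R\<^esub>" by blast
  define a where "a = (LEAST n. u [^]\<^bsub>R\<^esub> (n::nat) = \<zero>\<^bsub>R\<^esub>)"
  have ua: "u [^]\<^bsub>R\<^esub> a = \<zero>\<^bsub>R\<^esub>" unfolding a_def
    using n0 LeastI[where P="\<lambda>n::nat. u [^]\<^bsub>R\<^esub> n = \<zero>\<^bsub>R\<^esub>"] by blast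
  have "\<one>\<^bsub>R\<^esub> \<noteq> \<zero>\<^bsub>R\<^esub>" using one M.zero_closed by metis
  then have a_pos: "0 < a" using ua by (cases a) auto
  have upow: "u [^]\<^bsub>R\<^esub> (a - 1) \<noteq> \<zero>\<^bsub>R\<^esub>" 
    using a_pos not_less_Least[of "a - 1" "\<lambda>n. u [^]\<^bsub>R\<^esub> n = \<zero>\<^bsub>R\<^esub>", folded a_def] by simp
  have um: "x \<in> Units R \<or> (\<exists>y\<in>carrier R. x = u \<otimes>\<^bsub>R\<^esub> y)" if x: "x \<in> carrier R" for x
  proof -
    have "\<exists>y\<in>carrier R. x = u \<otimes>\<^bsub>R\<^esub> y" if xM: "x \<in> M"
    proof -
      have "x \<in> PIdl\<^bsub>R\<^esub> u" using xM by (rule subst[OF u(2)])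
      then have "\<exists>y. x = y \<otimes>\<^bsub>R\<^esub> u \<and> y \<in> carrier R"
        unfolding cgenideal_def by (rule CollectD)
      then obtain y where y: "x = y \<otimes>\<^bsub>R\<^esub> u" "y \<in> carrier R" by (elim exE conjE)
      have "x = u \<otimes>\<^bsub>R\<^esub> y" unfolding y(1) by (rule m_comm[OF y(2) u(1)])
      then show ?thesis using y(2) by (rule bexI)
    qed
    then show ?thesis using unit_or[OF x] by blast
  qed
  have chain: "finite_chain_ring R u a"
    by (intro finite_chain_ring.intro finite_chain_ring_axioms.intro is_cring fin u(1) um a_pos ua upow)
  then have "nilpotency_index R = a" by (rule finite_chain_ring.nilpotency_index)
  then show ?thesis using chain by blast
qed

section \<open>Residue field and multiplicative representatives\<close>

context ring begin

lemma card_line_extension: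
  assumes K: "subfield K R" and E: "dimension n K E" and v: "v \<in> carrier R" "v \<notin> E"
    and fin: "finite K" "finite E"
  shows "finite (line_extension K v E)" "card (line_extension K v E) = card K * card E"
proof -
  note E_props = space_subgroup_props[OF K E]
  have Kc: "K \<subseteq> carrier R" using subfieldE(3)[OF K] .
  have ext: "line_extension K v E = (\<lambda>(k, x). k \<otimes> v \<oplus> x) ` (K \<times> E)"
    by (auto simp: line_extension_mem_iff image_iff) blast
  have "inj_on (\<lambda>(k, x). k \<otimes> v \<oplus> x) (K \<times> E)"
  proof (rule inj_onI, clarify)
    fix k x k' x' assume k: "k \<in> K" "k' \<in> K" and x: "x \<in> E" "x' \<in> E"
      and eq: "k \<otimes> v \<oplus> x = k' \<otimes> v \<oplus> x'"
    have c: "k \<in> carrier R" "k' \<in> carrier R" "x \<in> carrier R" "x' \<in> carrier R"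
      using k x Kc E_props(1) by auto
    have "(k \<ominus> k') \<otimes> v = (k \<otimes> v \<oplus> x) \<ominus> x \<ominus> k' \<otimes> v" using c v(1) by algebra
    also have "\<dots> = x' \<oplus> \<ominus> x" unfolding eq using c v(1) by algebra
    finally have "(k \<ominus> k') \<otimes> v \<in> E" using E_props(3,4) x by simp
    moreover have "k \<ominus> k' \<in> K"
      using k subringE(5,7)[OF subfieldE(1)[OF K]] by (simp add: a_minus_def)
    ultimately have "k \<ominus> k' = \<zero>" using E_props(6)[of "k \<ominus> k'" v] v by blast
    then have "k = k'" using c by simp
    then show "k = k' \<and> x = x'" using eq c v(1) by simp
  qed
  then show "card (line_extension K v E) = card K * card E" "finite (line_extension K v E)"
    unfolding ext using fin by (simp_all add: card_image card_cartesian_product)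
qed

lemma card_dimension:
  assumes K: "subfield K R" "finite K" and "dimension n K E"
  shows "finite E \<and> card E = card K ^ n"
  using assms(3,1,2)
proof (induction n K E rule: dimension.induct)
  case (Suc_dim v E n K)
  then show ?case using card_line_extension[of K n E v] by simp
qed simp

end

context field begin

lemma inv_eq_pow:
  assumes fin: "finite (carrier R)" and x: "x \<in> carrier R" "x \<noteq> \<zero>"
  shows "x [^] card (carrier R) = x" "inv x = x [^] (card (carrier R) - 2)"
proof -
  interpret M: group "Multiplicative_Group.mult_of R" by (rule field_mult_group)
  have "2 \<le> card (carrier R)"
    using card_mono[OF fin, of "{\<zero>, \<one>}"] one_not_zero by (simp add: card_insert_if split: if_splits)
  then have Q: "card (carrier R) = Suc (card (carrier R) - 1)"
    "card (carrier R) - 1 = Suc (card (carrier R) - 2)" by simp_all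
  have "x [^] (card (carrier R) - 1) = \<one>"
    using M.pow_order_eq_1[of x] x order_mult_of[OF fin] by (simp add: Multiplicative_Group.nat_pow_mult_of Coset.order_def)
  then show "x [^] card (carrier R) = x" using x by (subst Q(1)) simp
  have "x [^] (card (carrier R) - 2) \<otimes> x = \<one>"
    using \<open>x [^] (card (carrier R) - 1) = \<one>\<close> Q(2) by (metis nat_pow_Suc)
  then show "inv x = x [^] (card (carrier R) - 2)"
    using x by (intro comm_inv_char) (simp_all add: m_comm)
qed

text \<open>The characteristic is given by a least multiple, the degree by a dimension over the
  field generated by the empty set. Their link to the cardinality is what makes the power map in the
  definition of the representatives act trivially on the residue field.\<close>

lemma card_finite_field:
  assumes fin: "finite (carrier R)"
  shows "card (carrier R) =
    (LEAST n::nat. 0 < n \<and> add_pow R n \<one> = \<zero>) ^ dim (generate_field R {}) (carrier R)"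
proof -
  define c where "c = (LEAST n::nat. 0 < n \<and> add_pow R n \<one> = \<zero>)"
  \<comment> \<open>The multiples of 1 form the prime field: they are a subring, and it contains
    inverses because these are powers in a finite field.\<close>
  define G where "G = range (\<lambda>n::nat. add_pow R n \<one>)"
  have "0 < card (carrier R) \<and> add_pow R (card (carrier R)) \<one> = \<zero>"
  proof
    show "0 < card (carrier R)" using fin card_gt_0_iff by blast
    show "add_pow R (card (carrier R)) \<one> = \<zero>"
      using add.pow_order_eq_1[of \<one>] by (simp add: Coset.order_def)
  qed
  then have c: "0 < c" "add_pow R c \<one> = \<zero>"
    using LeastI[where P="\<lambda>n::nat. 0 < n \<and> add_pow R n \<one> = \<zero>", folded c_def] by blast+
  have c_least: "c \<le> n" if "0 < n" "add_pow R n \<one> = \<zero>" for n :: nat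
    unfolding c_def using that by (intro Least_le) blast
  have mult: "add_pow R m \<one> \<otimes> add_pow R n \<one> = add_pow R (m * n) \<one>" for m n :: nat
    by (simp add: add_pow_ldistr add_pow_rdistr add.nat_pow_pow mult.commute)
  have mod: "add_pow R n \<one> = add_pow R (n mod c) \<one>" for n :: nat
  proof -
    have "add_pow R n \<one> = add_pow R (c * (n div c)) \<one> \<oplus> add_pow R (n mod c) \<one>"
      by (simp add: add.nat_pow_mult)
    also have "add_pow R (c * (n div c)) \<one> = \<zero>" unfolding mult[symmetric] using c by simp
    finally show ?thesis by simp
  qed
  have sub: "subring G R"
  proof (rule subringI)
    fix x assume "x \<in> G"
    then obtain n :: nat where n: "x = add_pow R n \<one>" by (auto simp: G_def)
    have "add_pow R n \<one> \<oplus> add_pow R ((c - 1) * n) \<one> = add_pow R (c * n) \<one>"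
      using c(1) by (simp add: add.nat_pow_mult flip: mult_Suc)
    also have "\<dots> = \<zero>" unfolding mult[symmetric] using c by simp
    finally have "\<ominus> x = add_pow R ((c - 1) * n) \<one>"
      unfolding n by (metis add.inv_comm minus_equality add.nat_pow_closed one_closed)
    then show "\<ominus> x \<in> G" by (simp add: G_def)
  next
    have "add_pow R ((1::nat)) \<one> = \<one>" by simp
    then show "\<one> \<in> G" unfolding G_def by (metis rangeI)
  qed (auto simp: G_def mult add.nat_pow_mult)
  have "subfield G R"
  proof (rule subfieldI'[OF sub])
    fix k assume k: "k \<in> G - {\<zero>}"
    have "k [^] n \<in> G" for n :: nat
      using subringE(3,6)[OF sub] k by (induction n) auto
    then show "inv k \<in> G" using inv_eq_pow(2)[OF fin, of k] k subringE(1)[OF sub] by auto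
  qed
  moreover have "G \<subseteq> generate_field R {}"
  proof -
    have "add_pow R n \<one> \<in> generate_field R {}" for n :: nat
    proof (induction n)
      case 0
      have "\<one> \<oplus> \<ominus> \<one> \<in> generate_field R {}"
        by (intro generate_field.eng_add generate_field.a_inv generate_field.one)
      then show ?case by (simp add: r_neg)
    qed (auto intro: generate_field.eng_add generate_field.one)
    then show ?thesis by (auto simp: G_def)
  qed
  ultimately have G: "generate_field R {} = G"
    using generate_field_min_subfield1[of "{}" G] by blast
  have "G = (\<lambda>n. add_pow R n \<one>) ` {..<c}"
    unfolding G_def using mod c(1) by (auto intro!: image_eqI[of _ _ "_ mod c"])
  moreover have "inj_on (\<lambda>n. add_pow R n \<one>) {..<c}"
  proof (rule linorder_inj_onI)
    fix m n assume mn: "m < n" "m \<in> {..<c}" "n \<in> {..<c}"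
    show "add_pow R m \<one> \<noteq> add_pow R n \<one>"
    proof
      assume "add_pow R m \<one> = add_pow R n \<one>"
      also have "add_pow R n \<one> = add_pow R m \<one> \<oplus> add_pow R (n - m) \<one>" using mn(1) by (simp add: add.nat_pow_mult)
      finally have "add_pow R (n - m) \<one> = \<zero>" by (simp add: add.l_cancel_one')
      then show False using c_least[of "n - m"] mn by simp
    qed
  qed auto
  ultimately have "card G = c" by (simp add: card_image)
  have K: "subfield G R" "finite G"
    using \<open>subfield G R\<close> fin subfieldE(3) finite_subset by blast+
  obtain Us where Us: "set Us = carrier R" using finite_list fin by blast
  have "Span G Us = carrier R"
    using Span_in_carrier[OF subfieldE(3)[OF K(1)]] Span_base_incl[OF K(1)] Us by blast
  then have "dimension (dim G (carrier R)) G (carrier R)"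
    using Span_finite_dimension[OF K(1), of Us] finite_dimensionE[OF K(1)] Us by (simp add: over_def)
  then have "card (carrier R) = card G ^ dim G (carrier R)" using card_dimension[OF K] by blast
  then show ?thesis unfolding G c_def[symmetric] using \<open>card G = c\<close> by simp
qed

end

section \<open>The residue field of a chain ring and its characteristic\<close>

context finite_chain_ring begin

abbreviation num :: "nat \<Rightarrow> 'a" where "num n \<equiv> add_pow R n \<one>"

lemma num_closed [simp]: "num n \<in> carrier R"
  by simp

lemma num_mult: "num m \<otimes> num n = num (m * n)"
  by (simp add: add_pow_ldistr add_pow_rdistr add.nat_pow_pow mult.commute)

lemma field_residue: "field (residue_field R)"
  unfolding residue_field_def max_ideal
  by (rule maximalideal.quotient_is_field) (simp_all add: maximalideal_iff cring_axioms)

lemma carrier_residue: "carrier (residue_field R) = (\<lambda>x. V 1 +> x) ` carrier R"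
  by (auto simp: residue_field_def max_ideal FactRing_def A_RCOSETS_def')

lemma finite_residue: "finite (carrier (residue_field R))"
  unfolding carrier_residue using finite_carrier by simp

lemma residue_eq_iff:
  assumes "x \<in> carrier R" "y \<in> carrier R"
  shows "V 1 +> x = V 1 +> y \<longleftrightarrow> x \<ominus> y \<in> V 1"
  using quotient_eq_iff_same_a_r_cos[OF V_ideal, of x y 1] assms by blast

lemma residue_hom: "(\<lambda>x. V 1 +> x) \<in> Ring.ring_hom R (residue_field R)"
  unfolding residue_field_def max_ideal using ideal.rcos_ring_hom[OF V_ideal, of 1] by simp

lemma residue_zero_iff: "x \<in> carrier R \<Longrightarrow> V 1 +> x = \<zero>\<^bsub>residue_field R\<^esub> \<longleftrightarrow> x \<in> V 1"
proof -
  assume x: "x \<in> carrier R"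
  have "\<zero>\<^bsub>residue_field R\<^esub> = V 1 +> \<zero>"
    using a_coset_join2[OF zero_closed _ V_zero, of 1] ideal.axioms(1)[OF V_ideal, of 1]
    by (simp add: residue_field_def max_ideal FactRing_def additive_subgroup_def)
  then show ?thesis using x residue_eq_iff[OF x zero_closed] by (simp add: a_minus_def)
qed

lemma residue_num: "add_pow (residue_field R) n \<one>\<^bsub>residue_field R\<^esub> = V 1 +> num n"
proof (induction n)
  case 0
  then show ?case using residue_zero_iff[OF zero_closed] V_zero by (simp add: add_pow_def nat_pow_def)
next
  case (Suc n)
  have "add_pow (residue_field R) (Suc n) \<one>\<^bsub>residue_field R\<^esub> =
      (V 1 +> num n) \<oplus>\<^bsub>residue_field R\<^esub> (V 1 +> \<one>)"
    using Suc ring_hom_one[OF residue_hom] by (simp add: add_pow_def nat_pow_def)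
  also have "\<dots> = V 1 +> (num n \<oplus> \<one>)"
    using ring_hom_add[OF residue_hom, of "num n" \<one>] by simp
  finally show ?case by simp
qed

lemma residue_char_eq: "residue_char R = (LEAST n. 0 < n \<and> num n \<in> V 1)"
  by (simp only: residue_char_def residue_num residue_zero_iff[OF num_closed])

lemma card_residue: "card (carrier (residue_field R)) = residue_char R ^ residue_degree R"
  using field.card_finite_field[OF field_residue finite_residue]
  by (simp add: residue_char_def residue_degree_def)

lemma residue_char_pos: "0 < residue_char R" and num_residue_char: "num (residue_char R) \<in> V 1"
proof -
  have "add_pow R (card (carrier R)) \<one> = \<zero>"
    using add.pow_order_eq_1[of \<one>] by (simp add: Coset.order_def)
  moreover have "0 < card (carrier R)" using finite_carrier card_gt_0_iff by blast
  ultimately have "0 < card (carrier R) \<and> num (card (carrier R)) \<in> V 1" using V_zero by simp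
  then show "0 < residue_char R" "num (residue_char R) \<in> V 1"
    using LeastI[where P="\<lambda>n. 0 < n \<and> num n \<in> V 1", folded residue_char_eq] by blast+
qed

lemma residue_char_least: "0 < n \<Longrightarrow> num n \<in> V 1 \<Longrightarrow> residue_char R \<le> n"
  unfolding residue_char_eq by (rule Least_le) simp

lemma num_V1_iff: "num n \<in> V 1 \<longleftrightarrow> residue_char R dvd n"
proof
  assume n: "num n \<in> V 1"
  let ?p = "residue_char R"
  have "num (n mod ?p) \<oplus> num (?p * (n div ?p)) = num n" by (simp add: add.nat_pow_mult)
  then have "num (n mod ?p) = num n \<ominus> num (?p * (n div ?p))"
    by (metis add.inv_solve_right a_minus_def num_closed)
  moreover have "num (?p * (n div ?p)) \<in> V 1"
    unfolding num_mult[symmetric] by (intro V_mult_r num_residue_char num_closed)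
  ultimately have "num (n mod ?p) \<in> V 1" using V_diff[OF n] by simp
  then have "n mod ?p = 0"
    using residue_char_least[of "n mod ?p"] residue_char_pos by (meson mod_less_divisor not_gr_zero not_less)
  then show "?p dvd n" by auto
next
  assume "residue_char R dvd n"
  then obtain m where "n = residue_char R * m" by (auto elim: dvdE)
  then have "num n = num (residue_char R) \<otimes> num m" by (simp only: num_mult)
  then show "num n \<in> V 1" by (simp only:) (intro V_mult_r num_residue_char num_closed)
qed

lemma one_notin_V1: "\<one> \<notin> V 1"
  using V1_not_unit by blast

lemma prime_residue_char: "Factorial_Ring.prime (residue_char R)"
proof -
  have "1 < residue_char R"
    using residue_char_pos num_residue_char one_notin_V1 
    by (cases "residue_char R = 1") auto
  moreover have "m = 1 \<or> m = residue_char R" if m: "m dvd residue_char R" for m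
  proof (rule disjCI)
    obtain n where n: "residue_char R = m * n" using m by (auto elim: dvdE)
    assume "m \<noteq> residue_char R"
    moreover have "m \<le> residue_char R" using m residue_char_pos by (rule dvd_imp_le)
    ultimately have "\<not> residue_char R dvd m"
      using dvd_imp_le[of "residue_char R" m] n residue_char_pos by fastforce
    then have "num m \<in> Units R" using num_V1_iff nonunit_iff by auto
    have "\<not> num n \<in> Units R"
    proof
      assume "num n \<in> Units R"
      then have "num m \<otimes> num n \<in> Units R" using \<open>num m \<in> Units R\<close> by simp
      then show False using num_residue_char V1_not_unit n by (simp add: num_mult)
    qed
    then have "residue_char R dvd n" using num_V1_iff nonunit_iff by auto
    then have "residue_char R \<le> n" using n residue_char_pos by (intro dvd_imp_le) auto
    then show "m = 1" using n residue_char_pos by auto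
  qed
  ultimately show ?thesis by (simp add: prime_nat_iff)
qed

section \<open>Teichmueller representatives\<close>

definition Q :: nat where "Q = residue_char R ^ residue_degree R"

text \<open>By \<open>card_residue\<close>, \<open>Q\<close> is the number of elements of the
  residue field, all of which are fixed by the corresponding power map.\<close>

lemma pow_Q_cong: "x \<in> carrier R \<Longrightarrow> x [^] Q \<ominus> x \<in> V 1"
proof -
  assume x: "x \<in> carrier R"
  interpret F: field "residue_field R" by (rule field_residue)
  let ?c = "V 1 +> x"
  have cc: "?c \<in> carrier (residue_field R)" using x carrier_residue by blast
  have pow: "V 1 +> (x [^] n) = ?c [^]\<^bsub>residue_field R\<^esub> n" for n :: nat
    using x ring_hom_one[OF residue_hom] ring_hom_mult[OF residue_hom] by (induction n) simp_all
  have "?c [^]\<^bsub>residue_field R\<^esub> Q = ?c"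
  proof (cases "?c = \<zero>\<^bsub>residue_field R\<^esub>")
    case True
    have "0 < Q" unfolding Q_def using residue_char_pos by simp
    then show ?thesis unfolding True by (rule F.nat_pow_zero[OF gr_implies_not0])
  next
    case False
    then show ?thesis
      using F.inv_eq_pow(1)[OF finite_residue cc] by (simp add: card_residue Q_def)
  qed
  then show ?thesis using pow residue_eq_iff[of "x [^] Q" x] x by simp
qed

lemma Q_num: "num Q \<in> V 1" and Q_pos: "0 < Q"
proof -
  interpret F: field "residue_field R" by (rule field_residue)
  have "2 \<le> card (carrier (residue_field R))"
    using card_mono[OF finite_residue, of "{\<zero>\<^bsub>residue_field R\<^esub>, \<one>\<^bsub>residue_field R\<^esub>}"] F.one_not_zero
    by (simp add: card_insert_if split: if_splits)
  then have "residue_degree R \<noteq> 0" by (intro notI) (simp add: card_residue)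
  then show "num Q \<in> V 1" unfolding num_V1_iff Q_def by simp
  show "0 < Q" unfolding Q_def using residue_char_pos by simp
qed

text \<open>The binomial theorem up to second order in \<open>d\<close>; the exponent is a successor
  because the linear term carries the exponent \<open>n\<close>.\<close>

lemma pow_add_expansion:
  assumes z: "z \<in> carrier R" and d: "d \<in> carrier R"
  shows "\<exists>w\<in>carrier R. (z \<oplus> d) [^] Suc n = z [^] Suc n \<oplus> num (Suc n) \<otimes> (z [^] n \<otimes> d) \<oplus> d \<otimes> d \<otimes> w"
proof (induction n)
  case 0
  show ?case using z d by (intro bexI[of _ \<zero>]) simp_all
next
  case (Suc n)
  then obtain w where w: "w \<in> carrier R"
    "(z \<oplus> d) [^] Suc n = z [^] Suc n \<oplus> num (Suc n) \<otimes> (z [^] n \<otimes> d) \<oplus> d \<otimes> d \<otimes> w" by blast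
  define x N where "x = z [^] n" and "N = num (Suc n)"
  have c: "x \<in> carrier R" "N \<in> carrier R" using z by (simp_all add: x_def N_def)
  have N: "num (Suc (Suc n)) = N \<oplus> \<one>" by (simp add: N_def)
  have "(z \<oplus> d) [^] Suc (Suc n) = (x \<otimes> z \<oplus> N \<otimes> (x \<otimes> d) \<oplus> d \<otimes> d \<otimes> w) \<otimes> (z \<oplus> d)"
    using w(2) by (simp add: x_def N_def)
  also have "\<dots> = x \<otimes> z \<otimes> z \<oplus> (N \<oplus> \<one>) \<otimes> (x \<otimes> z \<otimes> d) \<oplus> d \<otimes> d \<otimes> (w \<otimes> z \<oplus> N \<otimes> x \<oplus> d \<otimes> w)"
    using c w(1) z d by algebra
  finally have "(z \<oplus> d) [^] Suc (Suc n) = z [^] Suc (Suc n) \<oplus>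
      num (Suc (Suc n)) \<otimes> (z [^] Suc n \<otimes> d) \<oplus> d \<otimes> d \<otimes> (w \<otimes> z \<oplus> N \<otimes> x \<oplus> d \<otimes> w)"
    unfolding N by (simp add: x_def)
  moreover have "w \<otimes> z \<oplus> N \<otimes> x \<oplus> d \<otimes> w \<in> carrier R" using c w(1) z d by simp
  ultimately show ?case by blast
qed

text \<open>The linear term gains an order because \<open>Q\<close> is zero in the residue field,
  the quadratic one because 2 n \<ge> n + 1.\<close>

lemma pow_Q_lift:
  assumes y: "y \<in> carrier R" and z: "z \<in> carrier R" and yz: "y \<ominus> z \<in> V n" and "0 < n"
  shows "y [^] Q \<ominus> z [^] Q \<in> V (Suc n)"
proof -
  define d where "d = y \<ominus> z"
  have d: "d \<in> carrier R" "d \<in> V n" using y z yz by (simp_all add: d_def)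
  have yd: "y = z \<oplus> d" unfolding d_def using y z by algebra
  obtain w where w: "w \<in> carrier R"
    "y [^] Q = z [^] Q \<oplus> num Q \<otimes> (z [^] (Q - 1) \<otimes> d) \<oplus> d \<otimes> d \<otimes> w"
    using pow_add_expansion[OF z d(1), of "Q - 1"] Q_pos by (auto simp: yd)
  have "y [^] Q \<ominus> z [^] Q = num Q \<otimes> (z [^] (Q - 1) \<otimes> d) \<oplus> d \<otimes> d \<otimes> w"
    unfolding w(2) using w(1) d z num_closed[of Q] nat_pow_closed[OF z, of Q] nat_pow_closed[OF z, of "Q - 1"]
    by algebra
  moreover have "num Q \<otimes> (z [^] (Q - 1) \<otimes> d) \<in> V (1 + n)"
    using d z by (intro V_mult Q_num V_mult_l) auto
  moreover have "d \<otimes> d \<in> V (n + n)" by (intro V_mult d)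
  then have "d \<otimes> d \<in> V (Suc n)" using V_antimono[of "Suc n" "n + n"] \<open>0 < n\<close> by auto
  ultimately show ?thesis using w(1) by (simp add: V_add V_mult_r)
qed

lemma residue_reps_eq: "residue_reps R = {r \<in> carrier R. r [^] Q = r}"
  by (simp add: residue_reps_def Q_def)

text \<open>The power map fixes both elements and yet raises the order of their difference by one
  each time, so the difference is 0.\<close>

lemma residue_reps_unique:
  assumes y: "y \<in> residue_reps R" and z: "z \<in> residue_reps R" and "y \<ominus> z \<in> V 1"
  shows "y = z"
proof -
  have c: "y \<in> carrier R" "z \<in> carrier R" "y [^] Q = y" "z [^] Q = z"
    using y z by (auto simp: residue_reps_eq)
  have "y \<ominus> z \<in> V (Suc n)" for n
  proof (induction n)
    case (Suc n)
    then show ?case using pow_Q_lift[OF c(1,2), of "Suc n"] c by simp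
  qed (use assms in simp)
  from this[of "a - 1"] have "y \<ominus> z = \<zero>" using V_a a_pos by simp
  then show ?thesis using c by simp
qed

text \<open>The Teichmueller limit: the sequence x^(Q^n) stays in the residue class of
  \<open>x\<close>, and consecutive members agree to order n + 1. From n = a on it is constant, and
  its value is fixed by the power map.\<close>

lemma residue_reps_exist:
  assumes x: "x \<in> carrier R"
  shows "\<exists>r\<in>residue_reps R. x \<ominus> r \<in> V 1"
proof -
  have step: "x [^] (Q ^ Suc n) \<ominus> x [^] (Q ^ n) \<in> V (Suc n)" for n
  proof (induction n)
    case 0 show ?case using pow_Q_cong[OF x] x by simp
  next
    case (Suc n)
    then have "(x [^] (Q ^ Suc n)) [^] Q \<ominus> (x [^] (Q ^ n)) [^] Q \<in> V (Suc (Suc n))"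
      using x by (intro pow_Q_lift) auto
    then show ?case using x by (simp add: nat_pow_pow mult_ac)
  qed
  have "x [^] (Q ^ n) \<ominus> x \<in> V 1" for n
  proof (induction n)
    case 0 show ?case using x V_zero[of 1] by (simp add: a_minus_def r_neg)
  next
    case (Suc n)
    have "x [^] (Q ^ Suc n) \<ominus> x [^] (Q ^ n) \<in> V 1"
      using step[of n] V_antimono[of 1 "Suc n"] by auto
    then have "(x [^] (Q ^ Suc n) \<ominus> x [^] (Q ^ n)) \<oplus> (x [^] (Q ^ n) \<ominus> x) \<in> V 1" using Suc V_add by blast
    also have "(x [^] (Q ^ Suc n) \<ominus> x [^] (Q ^ n)) \<oplus> (x [^] (Q ^ n) \<ominus> x) = x [^] (Q ^ Suc n) \<ominus> x"
      using x nat_pow_closed[OF x, of "Q ^ Suc n"] nat_pow_closed[OF x, of "Q ^ n"] by algebra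
    finally show ?case .
  qed
  then have "\<ominus> (x [^] (Q ^ a) \<ominus> x) \<in> V 1" by (rule V_minus)
  also have "\<ominus> (x [^] (Q ^ a) \<ominus> x) = x \<ominus> x [^] (Q ^ a)"
    using x nat_pow_closed[OF x, of "Q ^ a"] by algebra
  finally have "x \<ominus> x [^] (Q ^ a) \<in> V 1" .
  moreover have "x [^] (Q ^ a) \<in> residue_reps R"
  proof -
    have "x [^] (Q ^ Suc a) \<ominus> x [^] (Q ^ a) = \<zero>" using step[of a] V_zero_ge[of "Suc a"] by auto
    then have "x [^] (Q ^ Suc a) = x [^] (Q ^ a)" using x by simp
    then have "(x [^] (Q ^ a)) [^] Q = x [^] (Q ^ a)"
      using x by (simp add: nat_pow_pow mult.commute)
    then show ?thesis using x by (simp add: residue_reps_eq)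
  qed
  ultimately show ?thesis by blast
qed

end

section \<open>Rings given by a type\<close>

lemma whole_simps [simp]:
  "carrier (whole :: 'b::comm_ring_1 ring) = UNIV"
  "\<zero>\<^bsub>whole\<^esub> = (0 :: 'b)" "\<one>\<^bsub>whole\<^esub> = (1 :: 'b)"
  "x \<oplus>\<^bsub>whole\<^esub> y = (x + y :: 'b)" "x \<otimes>\<^bsub>whole\<^esub> y = (x * y :: 'b)"
  by (simp_all add: ring_of_type_algebra_def)

lemma cring_whole: "cring (whole :: 'b::comm_ring_1 ring)"
proof (rule cringI)
  show "abelian_group (whole :: 'b ring)"
    by (rule abelian_groupI) (auto simp: add_ac intro: exI[of _ "- _"] ab_left_minus)
  show "comm_monoid (whole :: 'b ring)"
    by (rule comm_monoidI) (auto simp: mult_ac)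
qed (simp add: distrib_right)

interpretation whole: cring "whole :: 'b::comm_ring_1 ring"
  by (rule cring_whole)

lemma whole_minus [simp]: "\<ominus>\<^bsub>whole\<^esub> x = (- x :: 'b::comm_ring_1)"
  using whole.minus_equality[of "- x" x] by simp

lemma whole_diff [simp]: "x \<ominus>\<^bsub>whole\<^esub> y = (x - y :: 'b::comm_ring_1)"
  by (simp add: a_minus_def)

lemma whole_pow [simp]: "x [^]\<^bsub>whole\<^esub> (n::nat) = (x ^ n :: 'b::comm_ring_1)"
  by (induction n) (simp_all add: mult.commute)

lemma whole_num [simp]: "add_pow whole (n::nat) 1 = (of_nat n :: 'b::comm_ring_1)"
proof -
  have "add_pow whole n \<one>\<^bsub>whole\<^esub> = (of_nat n :: 'b)"
    by (induction n) (simp_all add: add.commute del: whole_simps(3), simp_all add: add.commute)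
  then show ?thesis by simp
qed

lemma whole_Units: "Units whole = {x :: 'b::comm_ring_1. x dvd 1}"
  by (auto simp: Units_def dvd_def mult.commute)

section \<open>Evaluation of polynomials in a record ring\<close>

text \<open>Horner evaluation with coefficients moved by \<open>j\<close> into a record ring. Both
  \<open>poly (emb t) x\<close> and the finite sum in \<open>eisenstein_with_zero_in\<close> are
  values of this function, by \<open>poly_emb\<close> and \<open>ev_finsum\<close>.\<close>

definition eval_at :: "('s, 'm) ring_scheme \<Rightarrow> ('b::comm_ring_1 \<Rightarrow> 's) \<Rightarrow> 's \<Rightarrow> 'b poly \<Rightarrow> 's" where
  "eval_at S j x t = fold_coeffs (\<lambda>c y. j c \<oplus>\<^bsub>S\<^esub> x \<otimes>\<^bsub>S\<^esub> y) t \<zero>\<^bsub>S\<^esub>"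

locale ring_eval = cring S for S (structure) +
  fixes j :: "'c::comm_ring_1 \<Rightarrow> 'a"
  assumes j_hom: "j \<in> Ring.ring_hom whole S"
begin

lemma j_simps [simp]:
  "j c \<in> carrier S" "j (c + d) = j c \<oplus> j d" "j (c * d) = j c \<otimes> j d" "j 1 = \<one>"
  using ring_hom_closed[OF j_hom] ring_hom_add[OF j_hom] ring_hom_mult[OF j_hom] ring_hom_one[OF j_hom]
  by auto

lemma j_zero [simp]: "j 0 = \<zero>"
  using ring_hom_zero[OF j_hom] whole.ring_axioms ring_axioms by auto

lemma j_minus [simp]: "j (- c) = \<ominus> j c"
proof -
  have "j (- c) \<oplus> j c = \<zero>" using j_simps(2)[of "- c" c] by simp
  then show ?thesis by (rule minus_equality[symmetric]) auto
qed

lemma j_diff: "j (c - d) = j c \<ominus> j d"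
  using j_simps(2)[of c "- d"] by (simp add: a_minus_def)

lemma j_pow: "j (c ^ n) = j c [^] n"
  by (induction n) (simp_all add: m_comm)

lemma j_num: "j (of_nat n) = add_pow S n \<one>"
  by (induction n) (simp_all add: a_comm)

lemma j_unit: "c dvd 1 \<Longrightarrow> j c \<in> Units S"
proof -
  assume "c dvd 1"
  then obtain d where "c * d = 1" by (metis dvdE)
  then have "j c \<otimes> j d = \<one>" by (metis j_simps(3,4))
  then show ?thesis unfolding Units_def by (auto intro!: bexI[of _ "j d"] simp: m_comm[of "j d" "j c"])
qed

abbreviation ev :: "'a \<Rightarrow> 'c poly \<Rightarrow> 'a" where "ev \<equiv> eval_at S j"

lemma ev_0 [simp]: "ev x 0 = \<zero>"
  by (simp add: eval_at_def)

context fixes x assumes x [simp]: "x \<in> carrier S" begin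

lemma ev_pCons: "ev x (pCons c t) = j c \<oplus> x \<otimes> ev x t"
  by (cases "t = 0"; cases "c = 0") (simp_all add: eval_at_def)

lemma ev_closed [simp]: "ev x t \<in> carrier S"
  by (induction t) (simp_all add: ev_pCons)

lemma ev_const [simp]: "ev x [:c:] = j c"
  by (simp add: ev_pCons)

lemma ev_1 [simp]: "ev x 1 = \<one>"
  using ev_const[of 1] by (simp flip: one_pCons)

lemma ev_X [simp]: "ev x [:0, 1:] = x" "ev x (pCons 0 1) = x"
  by (simp_all add: ev_pCons)

lemma ev_add: "ev x (s + t) = ev x s \<oplus> ev x t"
proof (induction s t rule: poly_induct2)
  case (pCons c s d t)
  have "ev x (pCons c s + pCons d t) = (j c \<oplus> j d) \<oplus> x \<otimes> (ev x s \<oplus> ev x t)"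
    using pCons by (simp add: ev_pCons)
  also have "\<dots> = (j c \<oplus> x \<otimes> ev x s) \<oplus> (j d \<oplus> x \<otimes> ev x t)"
    by (simp add: r_distr a_ac)
  finally show ?case by (simp add: ev_pCons)
qed simp

lemma ev_smult: "ev x (smult c t) = j c \<otimes> ev x t"
  by (induction t) (simp_all add: ev_pCons r_distr m_lcomm)

lemma ev_mult: "ev x (s * t) = ev x s \<otimes> ev x t"
  by (induction s) (simp_all add: ev_pCons ev_add ev_smult l_distr m_assoc)

lemma ev_minus: "ev x (- t) = \<ominus> ev x t"
  by (induction t) (simp_all add: ev_pCons r_minus minus_add)

lemma ev_diff: "ev x (s - t) = ev x s \<ominus> ev x t"
  using ev_add[of s "- t"] by (simp add: ev_minus a_minus_def)

lemma ev_pow: "ev x (t ^ n) = ev x t [^] n"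
  by (induction n) (simp_all add: ev_mult m_comm)

lemma ev_monom: "ev x (Polynomial.monom c n) = j c \<otimes> x [^] n"
  by (simp add: monom_altdef ev_smult ev_pow)

lemma ev_hom: "ev x \<in> Ring.ring_hom whole S"
  by (rule ring_hom_memI) (simp_all add: ev_add ev_mult)

lemma ev_finsum:
  assumes "Polynomial.degree t \<le> n"
  shows "ev x t = (\<Oplus>i\<in>{..n}. j (poly.coeff t i) \<otimes> x [^] i)"
  using assms
proof (induction t arbitrary: n)
  case (pCons c t)
  show ?case
  proof (cases n)
    case 0
    then have "t = 0" using pCons.prems by (simp split: if_splits)
    then show ?thesis using 0 by (simp add: ev_pCons)
  next
    case (Suc m)
    then have "Polynomial.degree t \<le> m" using pCons.prems by (simp split: if_splits)
    have "(\<Oplus>i\<in>{..n}. j (poly.coeff (pCons c t) i) \<otimes> x [^] i) =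
        (\<Oplus>i\<in>{..m}. j (poly.coeff t i) \<otimes> x [^] Suc i) \<oplus> j c"
      unfolding Suc by (subst finsum_Suc2) auto
    also have "(\<Oplus>i\<in>{..m}. j (poly.coeff t i) \<otimes> x [^] Suc i) =
        (\<Oplus>i\<in>{..m}. x \<otimes> (j (poly.coeff t i) \<otimes> x [^] i))"
      by (intro finsum_cong') (auto simp: m_ac)
    also have "\<dots> = x \<otimes> ev x t"
      unfolding pCons.IH[OF \<open>Polynomial.degree t \<le> m\<close>] by (subst finsum_rdistr) auto
    finally show ?thesis by (simp add: ev_pCons a_comm)
  qed
qed (simp add: finsum_zero')

end

lemma ev_pcompose:
  assumes x: "x \<in> carrier S"
  shows "ev x (pcompose s t) = ev (ev x t) s"
  by (induction s) (use x in \<open>simp_all add: pcompose_pCons ev_add ev_mult ev_pCons\<close>)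

end

text \<open>An extension of the coefficient ring with the same residue field in which
  \<open>P\<close> acquires the order \<open>e\<close>. It is applied to R over its own coefficient
  ring and to every ring of the same type, with \<open>j\<close> given by the identification
  \<open>\<iota>\<close>.\<close>

locale coefficient_extension =
  eisenstein_setup P k e a + finite_chain_ring S u a + ring_eval S j
  for P :: "'c::comm_ring_1" and k e a and S :: "('a, 'm) ring_scheme" (structure)
    and u and j :: "'c \<Rightarrow> 'a" +
  assumes j_P: "\<exists>v\<in>Units S. j P = v \<otimes> u [^] e"
    and j_residue: "x \<in> carrier S \<Longrightarrow> \<exists>c. x \<ominus> j c \<in> V 1"
begin

lemma j_P_mult: "P dvd c \<Longrightarrow> j c \<in> V e"
proof -
  assume "P dvd c"
  then obtain d where d: "c = P * d" by (auto elim: dvdE)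
  obtain v where "v \<in> Units S" "j P = v \<otimes> u [^] e" using j_P by blast
  then show ?thesis unfolding d j_simps(3) by (intro V_mult_r) (simp_all add: unit_mult_pow_V)
qed

lemma j_V1_iff: "j c \<in> V 1 \<longleftrightarrow> P dvd c"
proof
  assume "j c \<in> V 1"
  then show "P dvd c" using P_dvd_or_unit[of c] j_unit[of c] V1_not_unit by blast
next
  assume "P dvd c"
  then have "j c \<in> V e" by (rule j_P_mult)
  then show "j c \<in> V 1" using V_antimono[of 1 e] e_pos by auto
qed

lemma j_P_pow:
  obtains v where "v \<in> Units S" "j P [^] n = v \<otimes> u [^] (e * n)"
proof -
  obtain v where v: "v \<in> Units S" "j P = v \<otimes> u [^] e" using j_P by blast
  then have "j P [^] n = v [^] n \<otimes> u [^] (e * n)" by (simp add: nat_pow_distrib nat_pow_pow)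
  then show ?thesis using that[of "v [^] n"] v by (simp add: Units_pow_closed)
qed

lemma P_power_factor:
  assumes "x \<noteq> 0"
  obtains i v where "i \<le> k" "x = P ^ i * v" "v dvd 1"
proof -
  have "(\<exists>i<m. \<exists>v. v dvd 1 \<and> x = P ^ i * v) \<or> P ^ m dvd x" for m
  proof (induction m)
    case (Suc m)
    then show ?case
    proof
      assume "P ^ m dvd x"
      then obtain y where y: "x = P ^ m * y" by (auto elim: dvdE)
      show ?case
      proof (cases "P dvd y")
        case True
        then have "P ^ Suc m dvd x" unfolding y power_Suc2 by (rule mult_dvd_mono[OF dvd_refl])
        then show ?thesis ..
      next
        case False
        then show ?thesis using P_dvd_or_unit[of y] y by blast
      qed
    qed (auto intro: less_SucI)
  qed simp
  from this[of "Suc k"] show ?thesis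
  proof
    assume "P ^ Suc k dvd x"
    then have "x = 0" using P_nilpotent by (metis dvd_0_left_iff)
    then show ?thesis using assms by blast
  qed (use that in \<open>auto simp: less_Suc_eq_le\<close>)
qed

text \<open>A nonzero element is \<open>P ^ i\<close> times a unit with \<open>i \<le> k\<close>,
  and its image has order \<open>e * i\<close>, which is less than \<open>a\<close>.\<close>

lemma j_inj: "j c = j d \<Longrightarrow> c = d"
proof (rule ccontr)
  assume eq: "j c = j d" and "c \<noteq> d"
  then have "c - d \<noteq> 0" by simp
  then obtain i v where iv: "i \<le> k" "c - d = P ^ i * v" "v dvd 1" by (rule P_power_factor)
  obtain w where w: "w \<in> Units S" "j P [^] i = w \<otimes> u [^] (e * i)" by (rule j_P_pow)
  have "j (c - d) = (w \<otimes> j v) \<otimes> u [^] (e * i)"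
    unfolding iv(2) j_simps(3) j_pow w(2) using w(1) by (simp add: m_ac)
  moreover have "w \<otimes> j v \<in> Units S" using w(1) j_unit[OF iv(3)] by simp
  moreover have "e * i < a" using a_gt iv(1) by (meson le_less_trans mult_le_mono2)
  ultimately have "j (c - d) \<noteq> \<zero>" using unit_mult_pow_notin V_zero by metis
  then show False using eq by (simp add: j_diff a_minus_def r_neg)
qed

lemma uniformizers_eq: "uniformizers S = {v \<otimes> u | v. v \<in> Units S}"
  using uniformizers e_less_a e_pos by simp

lemma u_uniformizer: "u \<in> uniformizers S"
  unfolding uniformizers_eq by (auto intro!: exI[of _ \<one>])

lemma V_approximation:
  assumes "n \<le> e" "x \<in> carrier S"
  shows "\<exists>t. (t = 0 \<or> Polynomial.degree t < n) \<and> x \<ominus> ev u t \<in> V n"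
  using assms(1)
proof (induction n)
  case 0
  show ?case using assms(2) by (intro exI[of _ 0]) (simp add: V_0)
next
  case (Suc n)
  then obtain t where t: "t = 0 \<or> Polynomial.degree t < n" "x \<ominus> ev u t \<in> V n" by auto
  then obtain y where y: "y \<in> carrier S" "x \<ominus> ev u t = u [^] n \<otimes> y" by (auto simp: V_iff)
  obtain c where c: "y \<ominus> j c \<in> V 1" using j_residue y(1) by blast
  let ?t = "t + Polynomial.monom c n"
  have "Polynomial.degree ?t < Suc n"
    using t(1) degree_monom_le[of c n] by (auto simp: less_Suc_eq_le intro!: degree_add_le)
  moreover have "x \<ominus> ev u ?t = (x \<ominus> ev u t) \<ominus> u [^] n \<otimes> j c"
    unfolding ev_add[OF u_closed] ev_monom[OF u_closed]
    using assms(2) ev_closed[OF u_closed, of t] nat_pow_closed[OF u_closed, of n] j_simps(1)[of c] by algebra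
  then have "x \<ominus> ev u ?t = u [^] n \<otimes> (y \<ominus> j c)"
    unfolding y(2) using y(1) nat_pow_closed[OF u_closed, of n] j_simps(1)[of c] by algebra
  then have "x \<ominus> ev u ?t \<in> V (Suc n)" using V_mult[OF u_pow_V[of n] c] by simp
  ultimately show ?case by blast
qed

text \<open>Successive approximation in blocks of \<open>e\<close> orders. Within a block the powers
  of \<open>u\<close> below \<open>e\<close> serve; the factor \<open>u [^] (e * m)\<close> in front
  of the next block is exchanged for \<open>P ^ m\<close>, which goes into the coefficients. So the
  degree never reaches \<open>e\<close>.\<close>

lemma ev_surj_degree:
  assumes "x \<in> carrier S"
  shows "\<exists>t. Polynomial.degree t < e \<and> x = ev u t"
proof -
  have "\<exists>t. (t = 0 \<or> Polynomial.degree t < e) \<and> x \<ominus> ev u t \<in> V (e * m)" for m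
  proof (induction m)
    case 0
    show ?case using assms by (intro exI[of _ 0]) (simp add: V_0)
  next
    case (Suc m)
    then obtain t where t: "t = 0 \<or> Polynomial.degree t < e" "x \<ominus> ev u t \<in> V (e * m)" by auto
    then obtain y where y: "y \<in> carrier S" "x \<ominus> ev u t = u [^] (e * m) \<otimes> y" by (auto simp: V_iff)
    obtain v where v: "v \<in> Units S" "j P [^] m = v \<otimes> u [^] (e * m)" by (rule j_P_pow)
    define z where "z = inv v \<otimes> y"
    have z: "z \<in> carrier S" using v y by (simp add: z_def)
    have xz: "x \<ominus> ev u t = j (P ^ m) \<otimes> z"
    proof -
      have "j (P ^ m) \<otimes> z = u [^] (e * m) \<otimes> (v \<otimes> (inv v \<otimes> y))"
        unfolding j_pow v(2) z_def using v(1) y(1) by (simp add: m_ac del: Units_r_inv Units_l_inv)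
      also have "v \<otimes> (inv v \<otimes> y) = y" using v(1) y(1) by (simp add: m_assoc[symmetric])
      finally show ?thesis using y(2) by simp
    qed
    obtain s where s: "s = 0 \<or> Polynomial.degree s < e" "z \<ominus> ev u s \<in> V e"
      using V_approximation[OF order_refl z] by blast
    let ?t = "t + smult (P ^ m) s"
    have "?t = 0 \<or> Polynomial.degree ?t < e"
      using t(1) s(1) by (auto intro: degree_add_less le_less_trans[OF degree_smult_le])
    moreover have "x \<ominus> ev u ?t = (x \<ominus> ev u t) \<ominus> j (P ^ m) \<otimes> ev u s"
      unfolding ev_add[OF u_closed] ev_smult[OF u_closed]
      using assms ev_closed[OF u_closed, of t] ev_closed[OF u_closed, of s] j_simps(1)[of "P ^ m"] by algebra
    then have "x \<ominus> ev u ?t = j (P ^ m) \<otimes> (z \<ominus> ev u s)"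
      unfolding xz using z ev_closed[OF u_closed, of s] j_simps(1)[of "P ^ m"] by algebra
    moreover have "j (P ^ m) \<in> V (e * m)" unfolding j_pow v(2) by (rule unit_mult_pow_V[OF v(1)])
    ultimately have "(?t = 0 \<or> Polynomial.degree ?t < e) \<and> x \<ominus> ev u ?t \<in> V (e * Suc m)"
      using V_mult[OF _ s(2), of "j (P ^ m)" "e * m"] by (simp add: add.commute)
    then show ?case by blast
  qed
  from this[of "Suc k"] obtain t where t: "t = 0 \<or> Polynomial.degree t < e" "x \<ominus> ev u t \<in> V (e * Suc k)"
    by blast
  then have "x \<ominus> ev u t = \<zero>" using V_zero_ge[OF a_le] by simp
  then have "x = ev u t" using assms by simp
  then show ?thesis using t(1) e_pos by (intro exI[of _ t]) auto
qed

text \<open>From P = v u^e with a unit v one gets u^e = P v^(-1). Writing v^(-1) as t(u) with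
  \<open>t\<close> of degree below \<open>e\<close> turns this into the zero \<open>u\<close> of Y^e
  - P t, and t(0) is a unit because t(u) is.\<close>

lemma eisenstein_zero_exists: "\<exists>q. eisenstein q \<and> ev u q = \<zero>"
proof -
  obtain v where v: "v \<in> Units S" "j P = v \<otimes> u [^] e" using j_P by blast
  obtain t where t: "Polynomial.degree t < e" "inv v = ev u t"
    using ev_surj_degree[of "inv v"] v by auto
  define q where "q = Polynomial.monom 1 e - smult P t"
  have dt: "Polynomial.degree (smult P t) < e" using t(1) degree_smult_le le_less_trans by blast
  have "j P \<otimes> ev u t = inv v \<otimes> (v \<otimes> u [^] e)"
    unfolding t(2)[symmetric] v(2) using v(1) by (intro m_comm) auto
  then have "u [^] e = j P \<otimes> ev u t" using v(1) by (simp add: unit_cancel)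
  then have "ev u q = \<zero>"
    by (simp add: q_def ev_diff ev_monom ev_smult a_minus_def r_neg)
  moreover have "eisenstein q"
  proof -
    have ce: "poly.coeff q e = 1" using dt by (simp add: q_def coeff_eq_0 t(1))
    have "Polynomial.degree q \<le> e"
      unfolding q_def using dt by (intro degree_diff_le) (auto intro: degree_monom_le)
    then have d: "Polynomial.degree q = e" using ce by (metis le_degree le_antisym zero_neq_one)
    have low: "poly.coeff q i = - (P * poly.coeff t i)" if "i < e" for i
      using that by (simp add: q_def)
    have t0: "poly.coeff t 0 dvd 1"
    proof (rule ccontr)
      assume "\<not> poly.coeff t 0 dvd 1"
      then have "P dvd poly.coeff t 0" using P_dvd_or_unit by blast
      then have "j (poly.coeff t 0) \<in> V 1" by (simp only: j_V1_iff)
      moreover obtain c s where "t = pCons c s" by (cases t)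
      ultimately have "ev u t \<in> V 1"
        by (simp only: ev_pCons[OF u_closed] coeff_pCons_0) (intro V_add V_mult_r u_V ev_closed u_closed)
      then show False using V1_not_unit v t(2) by (metis Units_inv_Units)
    qed
    have "\<not> P ^ 2 dvd poly.coeff q 0"
    proof
      assume "P ^ 2 dvd poly.coeff q 0"
      then obtain z where z: "- (P * poly.coeff t 0) = P ^ 2 * z"
        unfolding low[OF e_pos] by (rule dvdE)
      have "P ^ 1 * (poly.coeff t 0 + P * z) = P * poly.coeff t 0 + P ^ 2 * z"
        by (simp add: power2_eq_square distrib_left mult.assoc)
      also have "\<dots> = 0" unfolding z[symmetric] by simp
      finally have "P ^ 1 * (poly.coeff t 0 + P * z) = 0" .
      then have "P dvd poly.coeff t 0 + P * z" by (rule annihilator) (use k_pos in simp)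
      then have "P dvd poly.coeff t 0" by (simp add: dvd_add_left_iff)
      then show False using t0 not_unit_P_dvd by blast
    qed
    then show ?thesis unfolding eisenstein_def using d ce low e_pos by auto
  qed
  ultimately show ?thesis by blast
qed

lemma ev_P_mult:
  assumes "x \<in> carrier S" "[:P:] dvd t"
  shows "ev x t \<in> V e"
proof -
  obtain s where "t = smult P s" using assms(2) by (auto elim: dvdE)
  then show ?thesis using assms(1) j_P_mult[OF dvd_refl] by (simp add: ev_smult V_mult_r)
qed

text \<open>With q = Y^e + P y one has x^e = - P y(x). The right side has positive order, so
  \<open>x\<close> is a non-unit; then y(x) is a unit because y(0) is, and x^e has order exactly
  \<open>e\<close>. Only the order 1 is left for \<open>x\<close>.\<close>

lemma eisenstein_zero_uniformizer:
  assumes q: "eisenstein q" and x: "x \<in> carrier S" and z: "ev x q = \<zero>"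
  shows "x \<in> uniformizers S"
proof -
  obtain n v where n: "n \<le> a" "v \<in> Units S" "x = v \<otimes> u [^] n" by (rule factorization[OF x])
  obtain y where q': "q = Polynomial.monom 1 e + smult P y" and y0: "poly.coeff y 0 dvd 1"
    by (rule eisenstein_decomposition[OF q])
  have xe: "x [^] e = \<ominus> (j P \<otimes> ev x y)"
  proof -
    have "x [^] e \<oplus> j P \<otimes> ev x y = \<zero>"
      using z x unfolding q' by (simp add: ev_add ev_monom ev_smult)
    then show ?thesis using x by (intro minus_equality[symmetric]) auto
  qed
  have xV: "x [^] e \<in> V e" unfolding xe using x by (intro V_minus V_mult_r j_P_mult) auto
  have xe2: "x [^] e = v [^] e \<otimes> u [^] (n * e)"
    unfolding n(3) using n(2) by (simp add: nat_pow_distrib nat_pow_pow)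
  have ve: "v [^] e \<in> Units S" using n(2) by (rule Units_pow_closed)
  have "n \<noteq> 0"
  proof
    assume "n = 0"
    then have "x [^] e \<in> Units S" using xe2 ve by simp
    moreover have "x [^] e \<in> V 1" using xV V_antimono[of 1 e] e_pos by auto
    ultimately show False using V1_not_unit by blast
  qed
  then have xV1: "x \<in> V 1" using n unit_mult_pow_V[OF n(2), of n] V_antimono[of 1 n] by auto
  have yu: "ev x y \<in> Units S"
  proof -
    obtain c s where s: "y = pCons c s" by (cases y)
    then have "j c \<in> Units S" using y0 j_unit by simp
    then show ?thesis unfolding s ev_pCons[OF x] using x xV1 by (intro unit_add_V1 V_mult_r) auto
  qed
  have "n \<le> 1"
  proof (rule ccontr)
    assume "\<not> n \<le> 1"
    then have "Suc e \<le> n * e" using e_pos by (cases n) auto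
    then have "x [^] e \<in> V (Suc e)" unfolding xe2 using unit_mult_pow_V[OF ve] V_antimono by blast
    then have "\<ominus> (j P \<otimes> ev x y) \<in> V (Suc e)" unfolding xe .
    then have m: "j P \<otimes> ev x y \<in> V (Suc e)" using V_minus x by fastforce
    obtain w where w: "w \<in> Units S" "j P = w \<otimes> u [^] e" using j_P by blast
    have "j P \<otimes> ev x y = (w \<otimes> ev x y) \<otimes> u [^] e" unfolding w(2) using w(1) x by (simp add: m_ac)
    then show False using m unit_mult_pow_notin[of "w \<otimes> ev x y" e] w(1) yu e_less_a by simp
  qed
  then have "n = 1" using \<open>n \<noteq> 0\<close> by simp
  then show ?thesis unfolding uniformizers_eq using n by auto
qed

text \<open>Neatness makes \<open>a = e * Suc k\<close>, so no power of \<open>u\<close> is lost when \<open>P\<close> is factored out.\<close>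

lemma ev_small_degree_inj:
  assumes neat: "a = e * Suc k" and d: "Polynomial.degree t < e" and z: "ev u t = \<zero>"
  shows "t = 0"
proof -
  have coeffs: "\<forall>i<n. P dvd poly.coeff s i" if "ev u s \<in> V n" "n \<le> e" for n s
    using that
  proof (induction n arbitrary: s)
    case (Suc n)
    obtain c s' where s: "s = pCons c s'" by (cases s)
    have ev: "ev u s = j c \<oplus> u \<otimes> ev u s'" by (simp add: s ev_pCons)
    have "ev u s \<in> V 1" using Suc.prems(1) V_antimono[of 1 "Suc n"] by auto
    then have "ev u s \<ominus> u \<otimes> ev u s' \<in> V 1" by (intro V_diff V_mult_r u_V) auto
    also have "ev u s \<ominus> u \<otimes> ev u s' = j c"
      unfolding ev using j_simps(1)[of c] u_closed ev_closed[OF u_closed, of s'] by algebra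
    finally have c: "P dvd c" by (simp only: j_V1_iff)
    then have "j c \<in> V (Suc n)" using j_P_mult V_antimono[OF Suc.prems(2)] by blast
    with Suc.prems(1) have "ev u s \<ominus> j c \<in> V (Suc n)" by (rule V_diff)
    also have "ev u s \<ominus> j c = u \<otimes> ev u s'"
      unfolding ev using j_simps(1)[of c] u_closed ev_closed[OF u_closed, of s'] by algebra
    also have "u = \<one> \<otimes> u [^] (1::nat)" by simp
    finally have "ev u s' \<in> V n"
      using V_cancel[of "ev u s'" \<one> 1 n] Suc.prems(2) e_less_a by simp
    then have "\<forall>i<n. P dvd poly.coeff s' i" using Suc.IH Suc.prems(2) by simp
    then show ?case using c by (simp add: s All_less_Suc2)
  qed simp
  have "\<exists>s. t = smult (P ^ i) s \<and> Polynomial.degree s < e" if "i \<le> Suc k" for i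
    using that
  proof (induction i)
    case 0 show ?case using d by auto
  next
    case (Suc i)
    then obtain s where s: "t = smult (P ^ i) s" "Polynomial.degree s < e" by auto
    obtain v where v: "v \<in> Units S" "j P [^] i = v \<otimes> u [^] (e * i)" by (rule j_P_pow)
    have "v \<otimes> u [^] (e * i) \<otimes> ev u s = \<zero>" using z by (simp add: s(1) ev_smult j_pow v(2))
    moreover have "e * i + e \<le> a" using Suc.prems unfolding neat
      by (metis add.commute mult_Suc_right mult_le_mono2)
    ultimately have "ev u s \<in> V e" using V_cancel[of "ev u s" v "e * i" e] v(1) V_zero by simp
    then have "\<forall>j<e. P dvd poly.coeff s j" using coeffs by blast
    then have "P dvd poly.coeff s j" for j using s(2) by (cases "j < e") (auto simp: coeff_eq_0)
    then have "[:P:] dvd s" by (simp add: const_poly_dvd_iff_coeffs)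
    \<comment> \<open>The quotient by \<open>P\<close> is a choice; sending 0 to 0 is what
      \<open>coeff_map_poly\<close> asks for and adds no coefficients beyond those of
      \<open>s\<close>.\<close>
    define r where "r = map_poly (\<lambda>c. if c = 0 then 0 else (SOME y. c = P * y)) s"
    have r: "poly.coeff s j = P * poly.coeff r j" for j
    proof (cases "poly.coeff s j = 0")
      case False
      have "\<exists>y. poly.coeff s j = P * y" using \<open>P dvd poly.coeff s j\<close> by (auto elim: dvdE)
      from someI_ex[OF this] show ?thesis using False by (simp add: r_def coeff_map_poly)
    qed (simp add: r_def coeff_map_poly)
    have "s = smult P r" by (rule poly_eqI) (simp add: r)
    moreover have "Polynomial.degree r < e"
      using s(2) degree_map_poly_le[of _ s] unfolding r_def by (rule le_less_trans[rotated])
    ultimately show ?case using s(1) by (auto simp: mult.commute)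
  qed
  from this[of "Suc k"] show ?thesis using P_nilpotent by auto
qed

lemma ev_kernel:
  assumes neat: "a = e * Suc k" and q: "eisenstein q" "ev u q = \<zero>"
  shows "ev u t = \<zero> \<longleftrightarrow> q dvd t"
proof
  assume t: "ev u t = \<zero>"
  obtain b r where br: "t = q * b + r" "r = 0 \<or> Polynomial.degree r < Polynomial.degree q"
    by (rule monic_division[OF eisensteinD(2)[OF q(1)]])
  have "ev u r = \<zero>" using t q(2) by (simp add: br(1) ev_add ev_mult)
  then have "r = 0" using ev_small_degree_inj[OF neat] br(2) eisensteinD(1)[OF q(1)] by auto
  then show "q dvd t" using br(1) by simp
qed (use q in \<open>auto elim!: dvdE simp: ev_mult\<close>)

lemma eisenstein_zero_unique:
  assumes neat: "a = e * Suc k" and "eisenstein q" "ev u q = \<zero>" "eisenstein q'" "ev u q' = \<zero>"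
  shows "q = q'"
proof -
  note D = eisensteinD[OF assms(2)] eisensteinD[OF assms(4)]
  have "poly.coeff (q - q') e = 0" using D by simp
  moreover have "Polynomial.degree (q - q') \<le> e" using D by (intro degree_diff_le) auto
  ultimately have "q - q' = 0 \<or> Polynomial.degree (q - q') < e"
    by (metis leading_coeff_0_iff le_neq_implies_less)
  moreover have "ev u (q - q') = \<zero>" using assms by (simp add: ev_diff)
  ultimately show ?thesis using ev_small_degree_inj[OF neat, of "q - q'"] by auto
qed

text \<open>At a point of the maximal ideal the value of \<open>t\<close> is congruent to the image
  of its constant term.\<close>

lemma ev_unit_iff: "x \<in> V 1 \<Longrightarrow> ev x t \<in> Units S \<longleftrightarrow> poly.coeff t 0 dvd 1"
proof -
  assume x: "x \<in> V 1"
  obtain c s where s: "t = pCons c s" by (cases t)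
  have ev: "ev x t = j c \<oplus> x \<otimes> ev x s" using x by (simp add: s ev_pCons)
  have m: "x \<otimes> ev x s \<in> V 1" using x by (simp add: V_mult_r)
  show ?thesis
  proof
    assume "poly.coeff t 0 dvd 1"
    then have "j c \<in> Units S" using j_unit s by simp
    then show "ev x t \<in> Units S" unfolding ev using m by (rule unit_add_V1)
  next
    assume unit: "ev x t \<in> Units S"
    show "poly.coeff t 0 dvd 1"
    proof (rule ccontr)
      assume "\<not> poly.coeff t 0 dvd 1"
      then have "P dvd c" using P_dvd_or_unit[of c] s by simp
      then have "j c \<in> V 1" by (simp only: j_V1_iff)
      then have "ev x t \<in> V 1" unfolding ev using m by (rule V_add)
      then show False using unit V1_not_unit by blast
    qed
  qed
qed

lemma ev_subst_resultant_zero: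
  assumes q: "eisenstein q" and x: "x \<in> carrier S" and z: "ev x q = \<zero>"
  shows "ev (ev x t \<otimes> x) (subst_resultant t q) = \<zero>"
proof -
  have "q dvd pcompose (subst_resultant t q) (t * [:0, 1:])"
    using dvd_pcompose_subst_resultant eisensteinD(1)[OF q] e_pos by metis
  then obtain h where h: "pcompose (subst_resultant t q) (t * [:0, 1:]) = q * h" by (auto elim: dvdE)
  have "ev (ev x t \<otimes> x) (subst_resultant t q) = ev x (pcompose (subst_resultant t q) (t * [:0, 1:]))"
    using x by (simp only: ev_pcompose ev_mult ev_X)
  then show ?thesis using x z by (simp only: h ev_mult ev_closed l_null)
qed

end

section \<open>The coefficient ring as a type\<close>

text \<open>With the coefficient ring as a type of its own, its polynomials, divisibility and
  resultants are those of the type classes, and the results of \<open>eisenstein_setup\<close> apply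
  to it.\<close>

typedef (overloaded) 'a omega = "carrier (coeff_ring (whole :: 'a::comm_ring_1 ring))"
  unfolding coeff_ring_def using generate_ring.one by auto

setup_lifting type_definition_omega

lemma carrier_coeff_ring: "carrier (coeff_ring S) = generate_ring S (residue_reps S)"
  by (simp add: coeff_ring_def)

lemma coeff_ring_closed:
  fixes x y :: "'a::comm_ring_1"
  assumes "x \<in> carrier (coeff_ring whole)" "y \<in> carrier (coeff_ring whole)"
  shows "x + y \<in> carrier (coeff_ring whole)" "x * y \<in> carrier (coeff_ring whole)"
    "- x \<in> carrier (coeff_ring whole)" "x - y \<in> carrier (coeff_ring whole)"
  using assms generate_ring.eng_add[of x "whole :: 'a ring" _ y] generate_ring.eng_mult[of x "whole :: 'a ring" _ y]
    generate_ring.a_inv[of x "whole :: 'a ring"] generate_ring.a_inv[of y "whole :: 'a ring"]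
    generate_ring.eng_add[of x "whole :: 'a ring" _ "- y"]
  unfolding carrier_coeff_ring by auto

lemma coeff_ring_0_1:
  "(0 :: 'a::comm_ring_1) \<in> carrier (coeff_ring whole)" "(1 :: 'a) \<in> carrier (coeff_ring whole)"
  unfolding carrier_coeff_ring
  using whole.zero_in_generate generate_ring.one[of "whole :: 'a ring"] by auto

instantiation omega :: (comm_ring_1) comm_ring_1
begin

lift_definition zero_omega :: "'a omega" is 0 by (rule coeff_ring_0_1)
lift_definition one_omega :: "'a omega" is 1 by (rule coeff_ring_0_1)
lift_definition plus_omega :: "'a omega \<Rightarrow> 'a omega \<Rightarrow> 'a omega" is "(+)" by (rule coeff_ring_closed)
lift_definition minus_omega :: "'a omega \<Rightarrow> 'a omega \<Rightarrow> 'a omega" is "(-)" by (rule coeff_ring_closed)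
lift_definition times_omega :: "'a omega \<Rightarrow> 'a omega \<Rightarrow> 'a omega" is "(*)" by (rule coeff_ring_closed)
lift_definition uminus_omega :: "'a omega \<Rightarrow> 'a omega" is "uminus" by (rule coeff_ring_closed)

instance
  by standard (transfer; simp add: algebra_simps)+

end

interpretation Rep: inj_comm_ring_hom "Rep_omega :: 'a::comm_ring_1 omega \<Rightarrow> 'a"
  by unfold_locales
     (simp_all add: zero_omega.rep_eq one_omega.rep_eq plus_omega.rep_eq times_omega.rep_eq
       flip: Rep_omega_inject)

lemma range_Rep_omega: "range Rep_omega = carrier (coeff_ring (whole :: 'a::comm_ring_1 ring))"
  by (rule type_definition.Rep_range[OF type_definition_omega])

lemma Rep_omega_ring_hom: "Rep_omega \<in> Ring.ring_hom whole (whole :: 'a::comm_ring_1 ring)"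
  by (rule ring_hom_memI) (simp_all add: hom_distribs)

text \<open>The inner binomial coefficients of a prime are divisible by it. For the iteration, a
  congruence modulo \<open>p\<close> is raised to the power \<open>p\<close> by the factorization of
  a difference of powers.\<close>

lemma prime_dvd_freshman:
  fixes x y :: "'b::comm_ring_1"
  assumes p: "Factorial_Ring.prime p"
  shows "of_nat p dvd (x + y) ^ (p ^ n) - (x ^ (p ^ n) + y ^ (p ^ n))"
proof (induction n)
  case (Suc n)
  define c where "c = x ^ (p ^ n)"
  define d where "d = y ^ (p ^ n)"
  have "0 < p" using p by (simp add: prime_gt_0_nat)
  have split: "{..p} = insert 0 (insert p {0<..<p})" using \<open>0 < p\<close> by auto
  have "(c + d) ^ p = (\<Sum>i\<le>p. of_nat (p choose i) * c ^ i * d ^ (p - i))" by (rule binomial_ring)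
  also have "\<dots> = d ^ p + c ^ p + (\<Sum>i\<in>{0<..<p}. of_nat (p choose i) * c ^ i * d ^ (p - i))"
    unfolding split using \<open>0 < p\<close> by (subst sum.insert) auto
  finally have eq: "(c + d) ^ p - (c ^ p + d ^ p) =
      (\<Sum>i\<in>{0<..<p}. of_nat (p choose i) * c ^ i * d ^ (p - i))" by simp
  have 1: "of_nat p dvd (c + d) ^ p - (c ^ p + d ^ p)"
    unfolding eq
  proof (rule dvd_sum)
    fix i assume "i \<in> {0<..<p}"
    then have "p dvd p choose i" using p by (intro dvd_choose_prime) auto
    then have "of_nat p dvd (of_nat (p choose i) :: 'b)" by (metis dvd_def of_nat_mult)
    then show "of_nat p dvd of_nat (p choose i) * c ^ i * d ^ (p - i)" by (intro dvd_mult2)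
  qed
  have "of_nat p dvd ((x + y) ^ (p ^ n)) ^ p - (c + d) ^ p"
  proof (rule dvd_trans)
    show "of_nat p dvd (x + y) ^ (p ^ n) - (c + d)" using Suc by (simp add: c_def d_def)
    show "(x + y) ^ (p ^ n) - (c + d) dvd ((x + y) ^ (p ^ n)) ^ p - (c + d) ^ p"
      by (simp add: power_diff_sumr2)
  qed
  moreover have "((x + y) ^ (p ^ n)) ^ p - (c ^ p + d ^ p) =
      (((x + y) ^ (p ^ n)) ^ p - (c + d) ^ p) + ((c + d) ^ p - (c ^ p + d ^ p))" by simp
  ultimately have "of_nat p dvd ((x + y) ^ (p ^ n)) ^ p - (c ^ p + d ^ p)" using 1 by (metis dvd_add)
  then show ?case by (simp add: c_def d_def mult.commute flip: power_mult)
qed simp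

text \<open>\<open>Suc k\<close> is a / e rounded up, the exponent at which the powers of
  \<open>p\<close> vanish. The parameter \<open>u\<close> may be any uniformizer, while the others
  are invariants of the ring.\<close>

locale finite_local_setup =
  fixes u :: "'a::comm_ring_1" and a e k p f :: nat
  assumes chain: "finite_chain_ring (whole :: 'a ring) u a"
    and e_def: "ramification_index (whole :: 'a ring) = e"
    and p_def: "residue_char (whole :: 'a ring) = p"
    and f_def: "residue_degree (whole :: 'a ring) = f"
    and e_less_a: "e < a" and k_def: "k = (a - 1) div e"
begin

sublocale R: finite_chain_ring "whole :: 'a ring" u a
  by (rule chain)

lemma of_nat_p_factor: "\<exists>v\<in>Units (whole :: 'a ring). of_nat p = v * u ^ e"
proof -
  obtain v where "v \<in> Units (whole :: 'a ring)" "of_nat p = v * u ^ max_ideal_ord whole (of_nat p :: 'a)"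
    by (rule R.factorization_ord[of "of_nat p"]) auto
  moreover have "max_ideal_ord whole (of_nat p :: 'a) = e"
    using e_def by (simp add: ramification_index_def p_def)
  ultimately show ?thesis by auto
qed

lemma prime_p: "Factorial_Ring.prime p"
  using R.prime_residue_char by (simp add: p_def)

lemma e_pos: "0 < e"
proof (rule ccontr)
  assume "\<not> 0 < e"
  then obtain v where v: "v \<in> Units (whole :: 'a ring)" "of_nat p = v" using of_nat_p_factor by auto
  moreover have "of_nat p \<in> R.V 1" using R.num_residue_char by (simp add: p_def)
  ultimately show False using R.V1_not_unit by blast
qed

lemma k_bounds: "0 < k" "e * k < a" "a \<le> e * Suc k"
proof -
  have a: "0 < a" using e_less_a by simp
  show "0 < k" unfolding k_def using e_less_a e_pos by (simp add: div_greater_zero_iff)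
  have "e * k \<le> a - 1" unfolding k_def by (rule times_div_less_eq_dividend)
  then show "e * k < a" using a by simp
  have "a - 1 < e * Suc k" unfolding k_def using dividend_less_times_div[OF e_pos, of "a - 1"] by simp
  then show "a \<le> e * Suc k" by simp
qed

lemma R_Q: "R.Q = p ^ f"
  by (simp add: R.Q_def p_def f_def)

text \<open>The power map is additive and multiplicative modulo \<open>p\<close> and fixes the
  generators of the coefficient ring. The congruence has to be modulo \<open>p\<close> inside the
  coefficient ring, which is stronger than the same congruence in R; hence the induction over the
  generation of the ring.\<close>

lemma omega_pow_cong: "of_nat p dvd x ^ (p ^ f) - x" for x :: "'a omega"
proof -
  let ?P = "of_nat p :: 'a omega"
  have Q: "0 < p ^ f" using prime_p by (simp add: prime_gt_0_nat)
  have add: "?P dvd (x + y) ^ (p ^ f) - (x + y)" if "?P dvd x ^ (p ^ f) - x" "?P dvd y ^ (p ^ f) - y" for x y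
  proof -
    have "(x + y) ^ (p ^ f) - (x + y) =
        ((x + y) ^ (p ^ f) - (x ^ (p ^ f) + y ^ (p ^ f))) + ((x ^ (p ^ f) - x) + (y ^ (p ^ f) - y))"
      by (simp add: algebra_simps)
    then show ?thesis using that prime_dvd_freshman[OF prime_p, of x y f] by (metis dvd_add)
  qed
  have "\<exists>x. Rep_omega x = r \<and> ?P dvd x ^ (p ^ f) - x"
    if "r \<in> generate_ring whole (residue_reps (whole :: 'a ring))" for r
    using that
  proof (induction rule: generate_ring.induct)
    case one
    then show ?case by (intro exI[of _ 1]) simp
  next
    case (incl h)
    then have "h \<in> range Rep_omega" unfolding range_Rep_omega carrier_coeff_ring by (rule generate_ring.incl)
    then obtain x where x: "Rep_omega x = h" by auto
    have "h ^ (p ^ f) = h" using incl by (simp add: R.residue_reps_eq R_Q)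
    then have "Rep_omega (x ^ (p ^ f)) = Rep_omega x" using x by (simp add: hom_distribs)
    then have "x ^ (p ^ f) = x" by (simp only: Rep_omega_inject)
    then show ?case using x by (intro exI[of _ x]) simp
  next
    case (a_inv h)
    then obtain x where x: "Rep_omega x = h" "?P dvd x ^ (p ^ f) - x" by blast
    \<comment> \<open>Additivity applied to x + (- x) = 0 gives the power of - x uniformly for odd
      and even \<open>p\<close>.\<close>
    have "?P dvd x ^ (p ^ f) + (- x) ^ (p ^ f)"
      using prime_dvd_freshman[OF prime_p, of x "- x" f] Q by (simp add: zero_power) (metis dvd_minus_iff minus_add_distrib minus_diff_eq diff_conv_add_uminus)
    then have "?P dvd (x ^ (p ^ f) + (- x) ^ (p ^ f)) - (x ^ (p ^ f) - x)" using x(2) by (rule dvd_diff)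
    then show ?case using x(1) by (intro exI[of _ "- x"]) (simp add: hom_distribs)
  next
    case (eng_add h1 h2)
    then obtain x y where "Rep_omega x = h1" "?P dvd x ^ (p ^ f) - x" "Rep_omega y = h2" "?P dvd y ^ (p ^ f) - y"
      by blast
    then show ?case using add by (intro exI[of _ "x + y"]) (simp add: hom_distribs)
  next
    case (eng_mult h1 h2)
    then obtain x y where xy: "Rep_omega x = h1" "?P dvd x ^ (p ^ f) - x" "Rep_omega y = h2" "?P dvd y ^ (p ^ f) - y"
      by blast
    have "(x * y) ^ (p ^ f) - x * y = x ^ (p ^ f) * (y ^ (p ^ f) - y) + (x ^ (p ^ f) - x) * y"
      by (simp add: power_mult_distrib algebra_simps)
    then have "?P dvd (x * y) ^ (p ^ f) - x * y" using xy by (simp add: dvd_add dvd_mult dvd_mult2)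
    then show ?case using xy by (intro exI[of _ "x * y"]) (simp add: hom_distribs)
  qed
  then show ?thesis
    using Rep_omega[of x] unfolding carrier_coeff_ring by (metis Rep_omega_inject)
qed

lemma finite_UNIV: "finite (UNIV :: 'a set)" "finite (UNIV :: 'a omega set)"
proof -
  show 1: "finite (UNIV :: 'a set)" using R.finite_carrier by simp
  show "finite (UNIV :: 'a omega set)"
    by (rule finite_imageD[of Rep_omega]) (auto intro: finite_subset[OF _ 1] injI simp: Rep_omega_inject)
qed

text \<open>If the image in R is a unit, the powers of \<open>x\<close> repeat by finiteness, so an
  inverse is itself a power of \<open>x\<close> and stays in the coefficient ring. Otherwise
  \<open>x\<close> is nilpotent, and it is congruent modulo \<open>p\<close> to a power of itself
  whose exponent is at least \<open>a\<close>, that is, to 0.\<close>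

lemma omega_p_dvd_or_unit: "of_nat p dvd x \<or> x dvd 1" for x :: "'a omega"
proof (cases "Rep_omega x dvd 1")
  case True
  have "\<not> inj (\<lambda>n::nat. x ^ n)"
    using finite_UNIV(2) by (metis finite_subset infinite_UNIV_nat finite_imageD subset_UNIV)
  then obtain m n :: nat where mn: "m < n" "x ^ m = x ^ n" unfolding inj_def by (metis nat_neq_iff)
  obtain y where "Rep_omega x * y = 1" using True by (metis dvdE)
  then have inv: "Rep_omega x ^ m * y ^ m = 1" by (simp flip: power_mult_distrib)
  define z where "z = Rep_omega x ^ (n - m)"
  have "Rep_omega x ^ m = Rep_omega x ^ n" using mn(2) by (metis Rep.hom_power)
  also have "\<dots> = Rep_omega x ^ m * z" unfolding z_def using mn(1) by (simp flip: power_add)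
  finally have "Rep_omega x ^ m * (1 - z) = 0" by (simp add: right_diff_distrib)
  moreover have "1 - z = (Rep_omega x ^ m * y ^ m) * (1 - z)" using inv by simp
  then have "1 - z = y ^ m * (Rep_omega x ^ m * (1 - z))" by (simp only: mult_ac)
  ultimately have "1 - z = 0" by simp
  then have "Rep_omega x ^ (n - m) = 1" by (simp add: z_def)
  then have "Rep_omega (x ^ (n - m)) = Rep_omega 1" by (simp add: hom_distribs)
  then have "x ^ (n - m) = 1" by (simp only: Rep_omega_inject)
  then have "x * x ^ (n - m - 1) = 1" using mn(1) by (metis Suc_diff_1 power_Suc zero_less_diff)
  then show ?thesis by (metis dvd_triv_left)
next
  case False
  then have x: "Rep_omega x \<in> R.V 1" using R.nonunit_iff by (simp add: whole_Units)
  have "Rep_omega x ^ n = 0" if "a \<le> n" for n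
    using R.pow_V1[OF x, of n] R.V_zero_ge[OF that] by simp
  then have nil: "x ^ n = 0" if "a \<le> n" for n
    using that by (metis Rep.hom_power Rep.hom_0_iff)
  have "of_nat p dvd x ^ ((p ^ f) ^ n) - x" for n
  proof (induction n)
    case (Suc n)
    have "x ^ ((p ^ f) ^ n) - x dvd (x ^ ((p ^ f) ^ n)) ^ (p ^ f) - x ^ (p ^ f)"
      by (simp add: power_diff_sumr2)
    then have "of_nat p dvd (x ^ ((p ^ f) ^ n)) ^ (p ^ f) - x ^ (p ^ f)" using Suc dvd_trans by blast
    from dvd_add[OF this omega_pow_cong[of x]]
    show ?case by (simp add: mult.commute flip: power_mult)
  qed simp
  moreover have "a \<le> (p ^ f) ^ a"
  proof -
    have "p dvd p ^ f" using R.Q_num unfolding R.num_V1_iff R_Q p_def .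
    then have "p \<le> p ^ f" using prime_gt_0_nat[OF prime_p] by (intro dvd_imp_le) auto
    then have "1 < p ^ f" using prime_gt_1_nat[OF prime_p] by linarith
    then show ?thesis using power_gt_expt[of "p ^ f" a] by simp
  qed
  ultimately have "of_nat p dvd - x" using nil by (metis diff_0)
  then show ?thesis by simp
qed

sublocale eisenstein_setup "of_nat p :: 'a omega" k e a
proof
  have pow: "\<exists>v\<in>Units (whole :: 'a ring). of_nat p ^ n = v * u ^ (e * n)" for n
  proof -
    obtain v where v: "v \<in> Units (whole :: 'a ring)" "of_nat p = v * u ^ e" using of_nat_p_factor by blast
    have "v ^ n \<in> Units (whole :: 'a ring)" using whole.Units_pow_closed[OF v(1), of n] by simp
    then show ?thesis by (auto simp: v(2) power_mult_distrib power_mult)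
  qed
  have "(of_nat p :: 'a) ^ Suc k = 0"
    using pow[of "Suc k"] R.V_zero_ge[OF k_bounds(3)] R.u_pow_V[of "e * Suc k"] by auto
  then show "(of_nat p :: 'a omega) ^ Suc k = 0" by (metis Rep.hom_power Rep.hom_of_nat Rep.hom_0_iff)
  have "(of_nat p :: 'a) ^ k \<noteq> 0"
  proof -
    obtain v where v: "v \<in> Units (whole :: 'a ring)" "of_nat p ^ k = v * u ^ (e * k)" using pow by blast
    then have "of_nat p ^ k \<notin> R.V (Suc (e * k))"
      using R.unit_mult_pow_notin[OF v(1) k_bounds(2)] by simp
    then show ?thesis using R.V_zero[of "Suc (e * k)"] by auto
  qed
  then show "(of_nat p :: 'a omega) ^ k \<noteq> 0" by (metis Rep.hom_power Rep.hom_of_nat Rep.hom_zero)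
qed (use omega_p_dvd_or_unit e_pos k_bounds in auto)

sublocale E: coefficient_extension "of_nat p :: 'a omega" k e a "whole :: 'a ring" u Rep_omega
proof
  show "Rep_omega \<in> Ring.ring_hom whole (whole :: 'a ring)" by (rule Rep_omega_ring_hom)
  show "\<exists>v\<in>Units (whole :: 'a ring). Rep_omega (of_nat p) = v \<otimes>\<^bsub>whole\<^esub> u [^]\<^bsub>whole\<^esub> e"
    using of_nat_p_factor by (simp add: hom_distribs)
next
  fix x :: 'a
  obtain r where r: "r \<in> residue_reps (whole :: 'a ring)" "x \<ominus>\<^bsub>whole\<^esub> r \<in> R.V 1"
    using R.residue_reps_exist[of x] by auto
  then have "r \<in> range Rep_omega" unfolding range_Rep_omega carrier_coeff_ring by (intro generate_ring.incl)
  then show "\<exists>c. x \<ominus>\<^bsub>whole\<^esub> Rep_omega c \<in> R.V 1" using r by auto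
qed

end

section \<open>Polynomials over the coefficient ring\<close>

abbreviation emb :: "'a::comm_ring_1 omega poly \<Rightarrow> 'a poly" where
  "emb \<equiv> map_poly Rep_omega"

interpretation Emb: map_poly_inj_comm_ring_hom "Rep_omega :: 'a::comm_ring_1 omega \<Rightarrow> 'a" ..

interpretation Emb2: map_poly_inj_comm_ring_hom "emb :: 'a::comm_ring_1 omega poly \<Rightarrow> 'a poly" ..

lemma image_constant: "x \<in> A \<Longrightarrow> (\<And>y. y \<in> A \<Longrightarrow> f y = c) \<Longrightarrow> f ` A = {c}"
  by auto

lemma coeff_emb [simp]: "poly.coeff (emb t) i = Rep_omega (poly.coeff t i)"
  by (simp add: coeff_map_poly)

lemma emb_X [simp]: "emb [:0, 1:] = [:0, 1:]" "emb (pCons 0 1) = pCons 0 1"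
  by (rule poly_eqI; simp add: coeff_pCons split: nat.split)+

lemma emb_monom [simp]: "emb (Polynomial.monom 1 n) = Polynomial.monom 1 n"
  by (rule poly_eqI) simp

lemma emb_pcompose: "emb (pcompose s t) = pcompose (emb s) (emb t)"
  by (induction s) (simp_all add: pcompose_pCons Emb.hom_add Emb.hom_mult Polynomial.map_poly_pCons)

text \<open>The embedding is injective, so degrees are preserved and the Sylvester matrices
  correspond entry by entry. This carries results over \<open>omega\<close> to resultants taken over
  R.\<close>

lemma emb_subst_resultant: "emb (subst_resultant t q) = subst_resultant (emb t) (emb q)"
proof -
  have lift: "lift_const (emb s) = map_poly emb (lift_const s)" for s :: "'a omega poly"
    by (rule poly_eqI) (simp add: coeff_map_poly Polynomial.map_poly_pCons)
  have "map_poly emb [:[:0, 1 :: 'a omega:]:] = [:[:0, 1:]:]"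
    by (rule poly_eqI) (simp add: coeff_map_poly coeff_pCons split: nat.split)
  then have "[:[:0, 1:]:] - lift_const (emb t * [:0, 1:]) =
      map_poly emb ([:[:0, 1:]:] - lift_const (t * [:0, 1:]))"
    by (simp only: Emb2.hom_minus lift[symmetric] Emb.hom_mult emb_X)
  then show ?thesis
    unfolding subst_resultant_def lift by (simp only: Emb.resultant_hom)
qed

lemma carrier_coeff_ring_polys: "carrier coeff_ring_polys = range (emb :: 'a::comm_ring_1 omega poly \<Rightarrow> 'a poly)"
proof
  show "carrier coeff_ring_polys \<subseteq> range (emb :: 'a omega poly \<Rightarrow> 'a poly)"
  proof
    fix q :: "'a poly" assume "q \<in> carrier coeff_ring_polys"
    then have q: "poly.coeff q i \<in> carrier (coeff_ring whole)" for i by (simp add: coeff_ring_polys_def)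
    have "Abs_omega 0 = (0 :: 'a omega)" by (simp add: zero_omega_def)
    then have "q = emb (map_poly Abs_omega q)"
      by (intro poly_eqI) (simp add: coeff_map_poly Abs_omega_inverse[OF q])
    then show "q \<in> range emb" by blast
  qed
  show "range (emb :: 'a omega poly \<Rightarrow> 'a poly) \<subseteq> carrier coeff_ring_polys"
    using Rep_omega by (auto simp: coeff_ring_polys_def)
qed

lemma coeff_ring_polys_simps [simp]:
  "\<zero>\<^bsub>coeff_ring_polys\<^esub> = 0" "\<one>\<^bsub>coeff_ring_polys\<^esub> = 1"
  "x \<oplus>\<^bsub>coeff_ring_polys\<^esub> y = x + y" "x \<otimes>\<^bsub>coeff_ring_polys\<^esub> y = x * y"
  by (simp_all add: coeff_ring_polys_def)

lemma cring_coeff_ring_polys: "cring (coeff_ring_polys :: 'a::comm_ring_1 poly ring)"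
proof (rule cringI)
  show "abelian_group (coeff_ring_polys :: 'a poly ring)"
  proof (rule abelian_groupI)
    fix x :: "'a poly" assume "x \<in> carrier coeff_ring_polys"
    then obtain t where "x = emb t" by (auto simp: carrier_coeff_ring_polys)
    then show "\<exists>y\<in>carrier coeff_ring_polys. y \<oplus>\<^bsub>coeff_ring_polys\<^esub> x = \<zero>\<^bsub>coeff_ring_polys\<^esub>"
      unfolding carrier_coeff_ring_polys
      by (intro bexI[of _ "emb (- t)"]) (simp add: Emb.hom_uminus, rule rangeI)
  next
    show "\<zero>\<^bsub>coeff_ring_polys\<^esub> \<in> carrier (coeff_ring_polys :: 'a poly ring)"
      unfolding carrier_coeff_ring_polys by (intro image_eqI[of _ _ 0]) simp_all
  qed (auto simp: carrier_coeff_ring_polys add_ac simp flip: Emb.hom_add)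
  show "comm_monoid (coeff_ring_polys :: 'a poly ring)"
  proof (rule comm_monoidI)
    show "\<one>\<^bsub>coeff_ring_polys\<^esub> \<in> carrier (coeff_ring_polys :: 'a poly ring)"
      unfolding carrier_coeff_ring_polys by (intro image_eqI[of _ _ 1]) simp_all
  qed (auto simp: carrier_coeff_ring_polys mult_ac simp flip: Emb.hom_mult)
qed (simp add: distrib_right)

lemma poly_emb: "poly (emb t) x = eval_at whole Rep_omega x t"
proof -
  interpret ring_eval "whole :: 'a ring" Rep_omega
    by unfold_locales (rule Rep_omega_ring_hom)
  show ?thesis by (induction t) (simp_all add: Polynomial.map_poly_pCons ev_pCons)
qed

context finite_local_setup begin

lemma p_multiples_iff: "Rep_omega x \<in> p_multiples n \<longleftrightarrow> of_nat p ^ n dvd x" for x :: "'a omega"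
proof
  assume "Rep_omega x \<in> p_multiples n"
  then obtain y where "Rep_omega x = of_nat p ^ n * Rep_omega y"
    unfolding p_multiples_def range_Rep_omega[symmetric] by (auto simp: p_def)
  then have "Rep_omega x = Rep_omega (of_nat p ^ n * y)" by (simp add: hom_distribs)
  then show "of_nat p ^ n dvd x" by (simp only: Rep_omega_inject) simp
next
  assume "of_nat p ^ n dvd x"
  then obtain y where "x = of_nat p ^ n * y" by (auto elim: dvdE)
  then have "Rep_omega x = of_nat p ^ n * Rep_omega y" by (simp add: hom_distribs)
  then show "Rep_omega x \<in> p_multiples n"
    unfolding p_multiples_def range_Rep_omega[symmetric] by (auto simp: p_def)
qed

lemma emb_eisenstein: "emb q \<in> eisenstein_polys \<longleftrightarrow> eisenstein q"
proof -
  have "lead_coeff (emb q) = 1 \<longleftrightarrow> lead_coeff q = 1" by (simp add: Rep.hom_1_iff)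
  moreover have "emb q \<in> carrier coeff_ring_polys" by (simp add: carrier_coeff_ring_polys)
  ultimately show ?thesis
    by (auto simp: eisenstein_polys_def eisenstein_def e_def p_multiples_iff)
qed

lemma eisenstein_polys_eq: "eisenstein_polys = emb ` {q. eisenstein q}"
proof -
  have "eisenstein_polys \<subseteq> range (emb :: 'a omega poly \<Rightarrow> 'a poly)"
    unfolding carrier_coeff_ring_polys[symmetric] by (auto simp: eisenstein_polys_def)
  then show ?thesis using emb_eisenstein by blast
qed

lemma trunc_ideal_eq: "(trunc_ideal :: 'a poly set) = emb ` {t. Polynomial.monom 1 a dvd t}"
proof -
  have "(trunc_ideal :: 'a poly set) = {emb (s * Polynomial.monom 1 a) | s. True}"
    by (auto simp: trunc_ideal_def R.nilpotency_index cgenideal_def carrier_coeff_ring_polys Emb.hom_mult)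
  also have "\<dots> = emb ` {t. Polynomial.monom 1 a dvd t}"
    by (auto simp: dvd_def mult.commute)
  finally show ?thesis .
qed

text \<open>The class of \<open>t\<close> in T, realized as a set of polynomials over R; it is the
  coset of \<open>emb t\<close> by \<open>coset_eq_cls\<close>.\<close>

definition cls :: "'a omega poly \<Rightarrow> 'a poly set" where
  "cls t = emb ` {s. Polynomial.monom 1 a dvd s - t}"

lemma coset_eq_cls: "trunc_ideal +>\<^bsub>coeff_ring_polys\<^esub> emb t = cls t"
proof -
  have "trunc_ideal +>\<^bsub>coeff_ring_polys\<^esub> emb t = (\<lambda>s. emb (s + t)) ` {s. Polynomial.monom 1 a dvd s}"
    by (auto simp: a_r_coset_def' trunc_ideal_eq Emb.hom_add)
  also have "\<dots> = emb ` ((\<lambda>s. s + t) ` {s. Polynomial.monom 1 a dvd s})" by (simp only: image_image)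
  also have "(\<lambda>s. s + t) ` {s. Polynomial.monom 1 a dvd s} = {s. Polynomial.monom 1 a dvd s - t}"
    by (auto intro!: image_eqI[of _ _ "_ - t"])
  finally show ?thesis by (simp add: cls_def)
qed

lemma emb_in_cls: "emb s \<in> cls t \<longleftrightarrow> Polynomial.monom 1 a dvd s - t"
  by (auto simp: cls_def)

lemma cls_self: "emb t \<in> cls t"
  by (simp add: emb_in_cls)

lemma cls_eq_iff: "cls s = cls t \<longleftrightarrow> Polynomial.monom 1 a dvd s - t"
proof
  assume "cls s = cls t" then show "Polynomial.monom 1 a dvd s - t" using cls_self emb_in_cls by blast
next
  assume st: "Polynomial.monom 1 a dvd s - t"
  have "Polynomial.monom 1 a dvd r - s \<longleftrightarrow> Polynomial.monom 1 a dvd r - t" for r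
    using dvd_add_left_iff[OF st, of "r - s"] by simp
  then show "cls s = cls t" by (simp add: cls_def)
qed

lemma trunc_ideal_ideal: "ideal trunc_ideal (coeff_ring_polys :: 'a poly ring)"
proof -
  have "Polynomial.monom 1 a \<in> carrier (coeff_ring_polys :: 'a poly ring)"
    unfolding carrier_coeff_ring_polys by (rule image_eqI[of _ _ "Polynomial.monom 1 a"]) simp_all
  then show ?thesis
    unfolding trunc_ideal_def R.nilpotency_index by (rule cring.cgenideal_ideal[OF cring_coeff_ring_polys])
qed

lemma carrier_trunc_ring: "carrier (trunc_ring :: 'a poly set ring) = range cls"
proof -
  have "carrier (trunc_ring :: 'a poly set ring) =
      (\<lambda>x. trunc_ideal +>\<^bsub>coeff_ring_polys\<^esub> x) ` range emb"
    by (auto simp: trunc_ring_def FactRing_def A_RCOSETS_def' carrier_coeff_ring_polys)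
  then show ?thesis by (simp only: image_image coset_eq_cls)
qed

lemma trunc_ring_mult: "cls s \<otimes>\<^bsub>trunc_ring\<^esub> cls t = cls (s * t)"
proof -
  have "trunc_ideal +>\<^bsub>coeff_ring_polys\<^esub> (emb s \<otimes>\<^bsub>coeff_ring_polys\<^esub> emb t) =
      (trunc_ideal +>\<^bsub>coeff_ring_polys\<^esub> emb s) \<otimes>\<^bsub>trunc_ring\<^esub> (trunc_ideal +>\<^bsub>coeff_ring_polys\<^esub> emb t)"
    unfolding trunc_ring_def
    by (rule ring_hom_mult[OF ideal.rcos_ring_hom[OF trunc_ideal_ideal]])
      (simp_all add: carrier_coeff_ring_polys)
  then show ?thesis by (simp add: coset_eq_cls flip: Emb.hom_mult)
qed

lemma trunc_ring_one: "\<one>\<^bsub>trunc_ring\<^esub> = cls 1"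
proof -
  have "\<one>\<^bsub>trunc_ring :: 'a poly set ring\<^esub> = trunc_ideal +>\<^bsub>coeff_ring_polys\<^esub> emb 1"
    by (simp add: trunc_ring_def FactRing_def)
  then show ?thesis by (simp only: coset_eq_cls)
qed

lemma carrier_subst_group: "carrier subst_group = cls ` {t. poly.coeff t 0 dvd 1}"
proof -
  have unit: "cls t \<in> Units trunc_ring \<longleftrightarrow> poly.coeff t 0 dvd 1" for t
  proof
    assume "cls t \<in> Units trunc_ring"
    then obtain s where "cls t \<otimes>\<^bsub>trunc_ring\<^esub> cls s = \<one>\<^bsub>trunc_ring\<^esub>"
      by (auto simp: Units_def carrier_trunc_ring)
    then have "Polynomial.monom 1 a dvd t * s - 1"
      by (simp add: trunc_ring_mult trunc_ring_one cls_eq_iff)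
    then show "poly.coeff t 0 dvd 1" by (rule unit_of_inverse_mod_X_power[OF R.a_pos])
  next
    assume "poly.coeff t 0 dvd 1"
    then obtain s where "Polynomial.monom 1 a dvd t * s - 1" using inverse_mod_X_power by blast
    then have "cls t \<otimes>\<^bsub>trunc_ring\<^esub> cls s = \<one>\<^bsub>trunc_ring\<^esub>"
      by (simp add: trunc_ring_mult trunc_ring_one cls_eq_iff)
    moreover from this have "cls s \<otimes>\<^bsub>trunc_ring\<^esub> cls t = \<one>\<^bsub>trunc_ring\<^esub>"
      by (simp add: trunc_ring_mult mult.commute)
    ultimately show "cls t \<in> Units trunc_ring" by (auto simp: Units_def carrier_trunc_ring)
  qed
  have "Units trunc_ring \<subseteq> range cls" by (auto simp: Units_def carrier_trunc_ring)
  then show ?thesis using unit by (auto simp: subst_group_def)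
qed

lemma subst_mult_cls: "subst_mult (cls s) (cls t) = cls (subst s t)"
proof -
  have "trunc_ideal +>\<^bsub>coeff_ring_polys\<^esub> (pcompose (emb s') (emb t' * [:0, 1:]) * emb t') = cls (subst s t)"
    if "Polynomial.monom 1 a dvd s' - s" "Polynomial.monom 1 a dvd t' - t" for s' t'
  proof -
    have "pcompose (emb s') (emb t' * [:0, 1:]) * emb t' = emb (subst s' t')"
      by (simp only: subst_def Emb.hom_mult emb_pcompose emb_X)
    then show ?thesis using subst_cong[OF that] by (simp only: coset_eq_cls cls_eq_iff)
  qed
  then have "subst_mult (cls s) (cls t) =
      (\<Union>s'\<in>{s'. Polynomial.monom 1 a dvd s' - s}. \<Union>t'\<in>{t'. Polynomial.monom 1 a dvd t' - t}. cls (subst s t))"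
    unfolding subst_mult_def by (auto simp: cls_def[of s] cls_def[of t])
  also have "\<dots> = cls (subst s t)" by (auto dest: spec[of _ s] spec[of _ t])
  finally show ?thesis .
qed

lemma subst_group_simps [simp]:
  "x \<otimes>\<^bsub>subst_group\<^esub> y = subst_mult x y" "\<one>\<^bsub>subst_group\<^esub> = cls 1"
  by (simp_all add: subst_group_def trunc_ring_one)

lemma group_subst_group: "group (subst_group :: 'a poly set monoid)"
proof (rule groupI)
  fix x :: "'a poly set" assume "x \<in> carrier subst_group"
  then obtain t where t: "x = cls t" "poly.coeff t 0 dvd 1" by (auto simp: carrier_subst_group)
  then obtain s where s: "poly.coeff s 0 dvd 1" "Polynomial.monom 1 a dvd subst s t - 1"
    using subst_left_inverse by blast
  then have "cls s \<otimes>\<^bsub>subst_group\<^esub> x = \<one>\<^bsub>subst_group\<^esub>"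
    by (simp add: t(1) subst_mult_cls cls_eq_iff)
  then show "\<exists>y\<in>carrier subst_group. y \<otimes>\<^bsub>subst_group\<^esub> x = \<one>\<^bsub>subst_group\<^esub>"
    using s(1) by (auto simp: carrier_subst_group)
qed (auto simp: carrier_subst_group subst_mult_cls subst_assoc subst_1 intro!: imageI subst_unit)

text \<open>All representatives of a class give the same resultant by
  \<open>subst_resultant_cong\<close>, so \<open>the_elem\<close> is taken of a singleton.\<close>

lemma poly_action_cls:
  assumes "poly.coeff t 0 dvd 1" "eisenstein q"
  shows "poly_action (cls t) (emb q) = emb (subst_resultant t q)"
proof -
  have "(\<lambda>t. subst_resultant t (emb q)) ` cls t = {emb (subst_resultant t q)}"
  proof -
    have "subst_resultant (emb s) (emb q) = emb (subst_resultant t q)" if "Polynomial.monom 1 a dvd s - t" for s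
      using subst_resultant_cong[OF assms(2,1) that] by (simp flip: emb_subst_resultant)
    then show ?thesis by (intro image_constant[OF cls_self]) (auto simp: cls_def)
  qed
  then show ?thesis using assms(2) by (simp add: poly_action_def emb_eisenstein)
qed

lemma uniformizer_V1: "x \<in> uniformizers (whole :: 'a ring) \<Longrightarrow> x \<in> R.V 1"
  unfolding E.uniformizers_eq using R.V_mult_l R.u_V by auto

lemma unif_action_cls:
  assumes x: "x \<in> uniformizers whole"
  shows "unif_action (cls t) x = poly (emb t) x * x"
proof -
  have "x ^ a = 0" using R.pow_V1[OF uniformizer_V1[OF x], of a] R.V_a by simp
  then have eq: "poly (emb s) x = poly (emb t) x" if st: "Polynomial.monom 1 a dvd s - t" for s
  proof -
    obtain h where "s - t = Polynomial.monom 1 a * h" using st by (auto elim: dvdE)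
    then have "emb s - emb t = Polynomial.monom 1 a * emb h"
      by (metis Emb.hom_minus Emb.hom_mult emb_monom)
    then have "poly (emb s) x - poly (emb t) x = 0"
      using \<open>x ^ a = 0\<close> by (simp add: poly_monom flip: poly_diff)
    then show ?thesis by simp
  qed
  have "(\<lambda>t. poly t x * x) ` cls t = {poly (emb t) x * x}"
  proof (rule image_constant[OF cls_self])
    fix y assume "y \<in> cls t"
    then obtain s where "y = emb s" "Polynomial.monom 1 a dvd s - t" by (auto simp: cls_def)
    then show "poly y x * x = poly (emb t) x * x" using eq[of s] by (simp only:)
  qed
  then show ?thesis using x by (simp add: unif_action_def)
qed

end

section \<open>The actions on Eisenstein polynomials and on uniformizers\<close>

text \<open>Bijectivity comes from the inverse group elements, so closure, extensionality and the
  two laws of an action are all that has to be verified.\<close>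

lemma group_actionI:
  assumes G: "group G"
    and closed: "\<And>g x. g \<in> carrier G \<Longrightarrow> x \<in> E \<Longrightarrow> \<phi> g x \<in> E"
    and ext: "\<And>g. g \<in> carrier G \<Longrightarrow> \<phi> g \<in> extensional E"
    and one: "\<And>x. x \<in> E \<Longrightarrow> \<phi> \<one>\<^bsub>G\<^esub> x = x"
    and mult: "\<And>g h x. g \<in> carrier G \<Longrightarrow> h \<in> carrier G \<Longrightarrow> x \<in> E \<Longrightarrow> \<phi> (g \<otimes>\<^bsub>G\<^esub> h) x = \<phi> g (\<phi> h x)"
  shows "group_action G E \<phi>"
proof -
  interpret group G by fact
  have Bij: "\<phi> g \<in> Bij E" if g: "g \<in> carrier G" for g
  proof -
    have "bij_betw (\<phi> g) E E"
    proof (rule bij_betw_byWitness[where f' = "\<phi> (inv\<^bsub>G\<^esub> g)"])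
      show "\<forall>x\<in>E. \<phi> (inv\<^bsub>G\<^esub> g) (\<phi> g x) = x" "\<forall>x\<in>E. \<phi> g (\<phi> (inv\<^bsub>G\<^esub> g) x) = x"
        using g one mult[of "inv\<^bsub>G\<^esub> g" g] mult[of g "inv\<^bsub>G\<^esub> g"] by auto
    qed (use g closed in auto)
    then show ?thesis using ext[OF g] by (simp add: Bij_def)
  qed
  have "\<phi> \<in> hom G (BijGroup E)"
  proof (rule homI)
    fix g h assume gh: "g \<in> carrier G" "h \<in> carrier G"
    have "\<phi> (g \<otimes>\<^bsub>G\<^esub> h) = compose E (\<phi> g) (\<phi> h)"
      by (rule extensionalityI[of _ E]) (use gh ext mult in \<open>auto simp: compose_def\<close>)
    then show "\<phi> (g \<otimes>\<^bsub>G\<^esub> h) = \<phi> g \<otimes>\<^bsub>BijGroup E\<^esub> \<phi> h"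
      using gh Bij by (simp add: BijGroup_def)
  qed (simp add: BijGroup_def Bij)
  then show ?thesis
    by (simp add: group_action_def group_hom_def group_hom_axioms_def G group_BijGroup)
qed

lemma action_extensional [simp]:
  "poly_action T \<in> extensional eisenstein_polys" "unif_action T \<in> extensional (uniformizers whole)"
  by (simp_all add: poly_action_def unif_action_def)

context finite_local_setup begin

lemma group_action_polys: "group_action subst_group (eisenstein_polys :: 'a poly set) poly_action"
proof (rule group_actionI[OF group_subst_group])
  fix T T' :: "'a poly set" and r :: "'a poly"
  assume "T \<in> carrier subst_group" "T' \<in> carrier subst_group" "r \<in> eisenstein_polys"
  then obtain s t q where "T = cls s" "poly.coeff s 0 dvd 1" "T' = cls t" "poly.coeff t 0 dvd 1"
    "r = emb q" "eisenstein q"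
    by (auto simp: carrier_subst_group eisenstein_polys_eq)
  then show "poly_action (T \<otimes>\<^bsub>subst_group\<^esub> T') r = poly_action T (poly_action T' r)"
    by (simp add: subst_mult_cls poly_action_cls eisenstein_subst_resultant subst_unit subst_resultant_subst)
next
  fix T :: "'a poly set"
  show "poly_action T \<in> extensional eisenstein_polys" by simp
qed (auto simp: carrier_subst_group eisenstein_polys_eq poly_action_cls eisenstein_subst_resultant
    subst_resultant_1)

interpretation polys: group_action subst_group "eisenstein_polys :: 'a poly set" poly_action
  by (rule group_action_polys)

lemma uniformizer_mult:
  assumes t: "poly.coeff t 0 dvd 1" and x: "x \<in> uniformizers (whole :: 'a ring)"
  shows "poly (emb t) x * x \<in> uniformizers whole"
proof -
  obtain v where v: "v \<in> Units (whole :: 'a ring)" "x = v * u" using x unfolding E.uniformizers_eq by auto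
  have "E.ev x t \<in> Units (whole :: 'a ring)" using E.ev_unit_iff[OF uniformizer_V1[OF x]] t by blast
  then have "poly (emb t) x * v \<in> Units (whole :: 'a ring)"
    using whole.Units_m_closed[OF _ v(1), of "E.ev x t"] by (simp add: poly_emb)
  then show ?thesis unfolding E.uniformizers_eq using v(2)
    by (auto intro!: exI[of _ "poly (emb t) x * v"] simp: mult.assoc)
qed

lemma chain_at:
  assumes "x \<in> uniformizers (whole :: 'a ring)" shows "finite_chain_ring (whole :: 'a ring) x a"
  using R.uniformizer_chain[OF _ assms] e_less_a e_pos by linarith

text \<open>Facts proved for the fixed parameter \<open>u\<close> are transported by this to an
  arbitrary uniformizer, with the same invariants and hence the same Eisenstein polynomials and
  actions.\<close>

lemma setup_at:
  assumes "x \<in> uniformizers (whole :: 'a ring)" shows "finite_local_setup x a e k p f"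
  by (intro finite_local_setup.intro chain_at[OF assms] e_def p_def f_def e_less_a k_def)

lemma transitive_action_uniformizers: "transitive_action subst_group (uniformizers (whole :: 'a ring)) unif_action"
proof (intro transitive_action.intro transitive_action_axioms.intro)
  show "group_action subst_group (uniformizers (whole :: 'a ring)) unif_action"
  proof (rule group_actionI[OF group_subst_group])
    fix T T' :: "'a poly set" and x :: 'a
    assume "T \<in> carrier subst_group" "T' \<in> carrier subst_group" and x: "x \<in> uniformizers whole"
    then obtain s t where st: "T = cls s" "poly.coeff s 0 dvd 1" "T' = cls t" "poly.coeff t 0 dvd 1"
      by (auto simp: carrier_subst_group)
    have "poly (emb (subst s t)) x * x = poly (emb s) (poly (emb t) x * x) * (poly (emb t) x * x)"
      by (simp add: subst_def Emb.hom_mult emb_pcompose poly_pcompose mult_ac del: mult_pCons_right)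
    then show "unif_action (T \<otimes>\<^bsub>subst_group\<^esub> T') x = unif_action T (unif_action T' x)"
      using st x by (simp add: subst_mult_cls unif_action_cls uniformizer_mult)
  qed (auto simp: carrier_subst_group unif_action_cls uniformizer_mult)
next
  fix x y :: 'a assume x: "x \<in> uniformizers whole" and y: "y \<in> uniformizers whole"
  interpret X: finite_local_setup x a e k p f by (rule setup_at[OF x])
  obtain v where v: "v \<in> Units (whole :: 'a ring)" "y = v * x" using y unfolding X.E.uniformizers_eq by auto
  \<comment> \<open>R is generated over its coefficient ring by \<open>x\<close>, so the unit
    \<open>v\<close> with y = v x is a value t(x), and \<open>t\<close> has a unit constant term
    because t(x) is a unit.\<close>
  obtain t where t: "v = E.ev x t" using X.E.ev_surj_degree[of v] by auto
  have "poly.coeff t 0 dvd 1" using X.E.ev_unit_iff[OF X.R.u_V] v(1) t by blast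
  moreover have "unif_action (cls t) x = y" using x v t by (simp add: unif_action_cls poly_emb)
  ultimately show "\<exists>g\<in>carrier subst_group. unif_action g x = y" by (auto simp: carrier_subst_group)
qed

interpretation unifs: transitive_action subst_group "uniformizers (whole :: 'a ring)" unif_action
  by (rule transitive_action_uniformizers)

lemma zero_uniformizer:
  assumes "q \<in> eisenstein_polys" "poly q x = 0"
  shows "x \<in> uniformizers (whole :: 'a ring)"
  using assms E.eisenstein_zero_uniformizer[of _ x] by (auto simp: eisenstein_polys_eq poly_emb)

lemma poly_action_zero:
  assumes q: "q \<in> eisenstein_polys" and z: "poly q x = 0" and T: "T \<in> carrier subst_group"
  shows "poly (poly_action T q) (unif_action T x) = (0 :: 'a)"
proof -
  obtain t r where "T = cls t" "poly.coeff t 0 dvd 1" "q = emb r" "eisenstein r"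
    using T q by (auto simp: carrier_subst_group eisenstein_polys_eq)
  then show ?thesis
    using E.ev_subst_resultant_zero[of r x t] z zero_uniformizer[OF q z]
    by (simp add: poly_action_cls unif_action_cls poly_emb)
qed

lemma eisenstein_with_zero_closed:
  assumes "q \<in> eisenstein_with_zero" "T \<in> carrier subst_group"
  shows "poly_action T q \<in> (eisenstein_with_zero :: 'a poly set)"
  using assms poly_action_zero[of q _ T] polys.element_image[OF assms(2), of q]
  by (auto simp: eisenstein_with_zero_def)

lemma eisenstein_with_zero_orbits:
  "\<exists>\<O> \<subseteq> orbits subst_group (eisenstein_polys :: 'a poly set) poly_action. eisenstein_with_zero = \<Union>\<O>"
proof (intro exI conjI)
  show "orbit subst_group poly_action ` eisenstein_with_zero \<subseteq> orbits subst_group (eisenstein_polys :: 'a poly set) poly_action"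
    by (auto simp: orbits_def eisenstein_with_zero_def)
  show "(eisenstein_with_zero :: 'a poly set) = \<Union> (orbit subst_group poly_action ` eisenstein_with_zero)"
  proof
    show "(eisenstein_with_zero :: 'a poly set) \<subseteq> \<Union> (orbit subst_group poly_action ` eisenstein_with_zero)"
      using polys.orbit_refl by (fastforce simp: eisenstein_with_zero_def)
    show "\<Union> (orbit subst_group poly_action ` eisenstein_with_zero) \<subseteq> (eisenstein_with_zero :: 'a poly set)"
      using eisenstein_with_zero_closed by (auto simp: orbit_def)
  qed
qed

lemma uniformizer_zero_in_orbit:
  assumes q: "q \<in> eisenstein_with_zero" and x: "x \<in> uniformizers (whole :: 'a ring)"
  shows "\<exists>q' \<in> orbit subst_group poly_action q. poly q' x = 0"
proof -
  obtain y where y: "q \<in> eisenstein_polys" "poly q y = 0" using q by (auto simp: eisenstein_with_zero_def)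
  obtain T where "T \<in> carrier subst_group" "unif_action T y = x"
    using unifs.unique_orbit[OF zero_uniformizer[OF y] x] by blast
  then show ?thesis using poly_action_zero[OF y] by (auto simp: orbit_def)
qed

text \<open>The action of \<open>T\<close> on uniformizers maps the zeros of \<open>q\<close>
  injectively to zeros of T * q. Membership in an orbit is symmetric, so the inequality of
  cardinalities holds in both directions.\<close>

lemma card_zeros_orbit:
  assumes "\<Omega> \<in> orbits subst_group (eisenstein_polys :: 'a poly set) poly_action" "q \<in> \<Omega>" "q' \<in> \<Omega>"
  shows "card {x. poly q x = 0} = card {x. poly q' x = 0}"
proof -
  have le: "card {x. poly r x = 0} \<le> card {x. poly (poly_action T r) x = 0}"
    if r: "r \<in> eisenstein_polys" and T: "T \<in> carrier subst_group" for r :: "'a poly" and T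
  proof (rule card_inj_on_le)
    show "inj_on (unif_action T) {x. poly r x = 0}"
      using unifs.inj_prop[OF T] zero_uniformizer[OF r] by (auto intro: inj_on_subset)
    show "unif_action T ` {x. poly r x = 0} \<subseteq> {x. poly (poly_action T r) x = 0}"
      using poly_action_zero[OF r _ T] by auto
    show "finite {x. poly (poly_action T r) x = 0}" using finite_UNIV(1) by (rule finite_subset[rotated]) simp
  qed
  have le_orbit: "card {x. poly r x = 0} \<le> card {x. poly r' x = 0}"
    if "r \<in> eisenstein_polys" "r' \<in> orbit subst_group poly_action r" for r r' :: "'a poly"
    using le[OF that(1)] that(2) by (auto simp: orbit_def)
  obtain r where r: "r \<in> eisenstein_polys" "\<Omega> = orbit subst_group poly_action r"
    using assms(1) by (auto simp: orbits_def)
  have E: "q \<in> eisenstein_polys" "q' \<in> eisenstein_polys"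
    using assms(2,3) r polys.element_image by (auto simp: orbit_def)
  have "q' \<in> orbit subst_group poly_action q" "q \<in> orbit subst_group poly_action q'"
    using polys.orbit_trans polys.orbit_sym E r assms(2,3) by metis+
  then show ?thesis using le_orbit E by (metis le_antisym)
qed

text \<open>Between \<open>e * k < a\<close> and \<open>a \<le> e * Suc k\<close> the upper bound is
  the only multiple of \<open>e\<close>.\<close>

lemma neat_iff: "neat (whole :: 'a ring) \<longleftrightarrow> a = e * Suc k"
proof
  assume "neat (whole :: 'a ring)"
  then have "e dvd a" by (simp add: neat_def e_def R.nilpotency_index)
  then obtain m where m: "a = e * m" by (auto elim: dvdE)
  have "k < m" using k_bounds(2) unfolding m by simp
  moreover have "m \<le> Suc k" using k_bounds(3) e_pos unfolding m mult_le_cancel1 by simp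
  ultimately have "m = Suc k" by simp
  then show "a = e * Suc k" using m by simp
qed (simp add: neat_def e_def R.nilpotency_index)

lemma eisenstein_with_zeroI: "q \<in> eisenstein_polys \<Longrightarrow> poly q x = 0 \<Longrightarrow> q \<in> eisenstein_with_zero"
  by (auto simp: eisenstein_with_zero_def)

lemma zero_poly_exists:
  assumes "x \<in> uniformizers (whole :: 'a ring)"
  shows "\<exists>q \<in> eisenstein_polys. poly q x = 0"
proof -
  interpret X: finite_local_setup x a e k p f by (rule setup_at[OF assms])
  show ?thesis using X.E.eisenstein_zero_exists by (auto simp: eisenstein_polys_eq poly_emb)
qed

lemma zero_poly_unique:
  assumes "neat (whole :: 'a ring)" "q \<in> eisenstein_polys" "poly q x = 0" "q' \<in> eisenstein_polys" "poly q' x = (0::'a)"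
  shows "q = q'"
proof -
  interpret X: finite_local_setup x a e k p f
    by (rule setup_at[OF zero_uniformizer[OF assms(2,3)]])
  show ?thesis
    using assms(2-) X.E.eisenstein_zero_unique[OF iffD1[OF neat_iff assms(1)]]
    by (auto simp: eisenstein_polys_eq poly_emb)
qed

text \<open>If \<open>r\<close> has a zero x, then x is a uniformizer and also a zero of some
  polynomial in the orbit of \<open>q\<close>. In the neat case an Eisenstein polynomial is
  determined by a zero, so this polynomial is \<open>r\<close>.\<close>

lemma eisenstein_with_zero_orbit:
  assumes neat: "neat (whole :: 'a ring)" and q: "q \<in> eisenstein_with_zero"
  shows "(eisenstein_with_zero :: 'a poly set) = orbit subst_group poly_action q"
proof
  show "orbit subst_group poly_action q \<subseteq> (eisenstein_with_zero :: 'a poly set)"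
    using eisenstein_with_zero_closed[OF q] by (auto simp: orbit_def)
  show "(eisenstein_with_zero :: 'a poly set) \<subseteq> orbit subst_group poly_action q"
  proof
    fix r :: "'a poly" assume "r \<in> eisenstein_with_zero"
    then obtain x where r: "r \<in> eisenstein_polys" "poly r x = 0" by (auto simp: eisenstein_with_zero_def)
    obtain q' where q': "q' \<in> orbit subst_group poly_action q" "poly q' x = 0"
      using uniformizer_zero_in_orbit[OF q zero_uniformizer[OF r]] by blast
    have "q' \<in> eisenstein_polys"
      using q'(1) q polys.element_image by (auto simp: orbit_def eisenstein_with_zero_def)
    then show "r \<in> orbit subst_group poly_action q"
      using zero_poly_unique[OF neat r _ q'(2)] q'(1) by simp
  qed
qed

lemma neat_epimorphism:
  assumes neat: "neat (whole :: 'a ring)"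
  shows "(\<forall>u \<in> uniformizers (whole :: 'a ring). \<exists>!q. q \<in> eisenstein_with_zero \<and> poly q u = 0) \<and>
    (let \<theta> = (\<lambda>u::'a. THE q. q \<in> eisenstein_with_zero \<and> poly q u = 0)
     in \<theta> ` uniformizers whole = eisenstein_with_zero \<and>
       (\<forall>t \<in> carrier subst_group. \<forall>u \<in> uniformizers whole. \<theta> (unif_action t u) = poly_action t (\<theta> u)))"
proof -
  define \<theta> where "\<theta> = (\<lambda>u::'a. THE q. q \<in> eisenstein_with_zero \<and> poly q u = 0)"
  have ex1: "\<exists>!q. q \<in> eisenstein_with_zero \<and> poly q x = 0" if "x \<in> uniformizers (whole :: 'a ring)" for x
    using zero_poly_exists[OF that] zero_poly_unique[OF neat, of _ x]
    by (auto simp: eisenstein_with_zero_def)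
  have \<theta>I: "\<theta> x = q" if "q \<in> eisenstein_polys" "poly q x = 0" for q x
    unfolding \<theta>_def using that ex1[OF zero_uniformizer[OF that]] eisenstein_with_zeroI[OF that]
    by (intro the1_equality) auto
  have \<theta>: "\<theta> x \<in> eisenstein_polys" "poly (\<theta> x) x = 0" if "x \<in> uniformizers (whole :: 'a ring)" for x
    using zero_poly_exists[OF that] \<theta>I[of _ x] by auto
  have img: "\<theta> ` uniformizers whole = eisenstein_with_zero"
  proof
    show "\<theta> ` uniformizers whole \<subseteq> eisenstein_with_zero"
      using \<theta> eisenstein_with_zeroI by blast
    show "eisenstein_with_zero \<subseteq> \<theta> ` uniformizers whole"
    proof
      fix q :: "'a poly" assume "q \<in> eisenstein_with_zero"
      then obtain x where q: "q \<in> eisenstein_polys" "poly q x = 0" by (auto simp: eisenstein_with_zero_def)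
      show "q \<in> \<theta> ` uniformizers whole"
        by (rule image_eqI[of _ _ x]) (simp_all add: \<theta>I[OF q] zero_uniformizer[OF q])
    qed
  qed
  have act: "\<theta> (unif_action T x) = poly_action T (\<theta> x)"
    if T: "T \<in> carrier subst_group" and x: "x \<in> uniformizers (whole :: 'a ring)" for T x
    using polys.element_image[OF T \<theta>(1)[OF x] refl] poly_action_zero[OF \<theta>[OF x] T] by (rule \<theta>I)
  show ?thesis
    unfolding Let_def \<theta>_def[symmetric] by (intro conjI ballI ex1 img act)
qed

end

section \<open>Digit expansions and the factor g\<close>

context finite_local_setup begin

lemma pow_mult_V: "u ^ n * y \<in> R.V n"
  using R.V_mult_r[OF R.u_pow_V[of n], of y] by simp

text \<open>\<open>digits\<close> is a definite description, so existence and uniqueness of the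
  expansion are both required before anything can be said about it.\<close>

lemma digits_spec:
  fixes x :: 'a
  shows "(\<forall>i<a. digits u x i \<in> residue_reps whole) \<and> x = (\<Sum>i<a. digits u x i * u ^ i)"
proof -
  \<comment> \<open>Equality is weakened to congruence modulo \<open>V n\<close>, which makes an
    induction on the number of digits possible; for \<open>n = a\<close> it is equality.\<close>
  define spec where "spec r n \<longleftrightarrow> (\<forall>i<n. r i \<in> residue_reps (whole :: 'a ring)) \<and> (\<forall>i\<ge>n. r i = 0) \<and>
    x - (\<Sum>i<n. r i * u ^ i) \<in> R.V n" for r and n :: nat
  have "\<exists>r. spec r n" for n
  proof (induction n)
    case 0 then show ?case by (intro exI[of _ "\<lambda>_. 0"]) (simp add: spec_def R.V_0)
  next
    case (Suc n)
    then obtain r where r: "spec r n" by blast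
    then obtain y where y: "x - (\<Sum>i<n. r i * u ^ i) = u ^ n * y" by (auto simp: spec_def R.V_iff)
    obtain d where d: "d \<in> residue_reps (whole :: 'a ring)" "y - d \<in> R.V 1"
      using R.residue_reps_exist[of y] by auto
    have "x - (\<Sum>i<Suc n. (r(n := d)) i * u ^ i) = u ^ n * (y - d)"
      using y by (simp add: algebra_simps)
    also have "\<dots> \<in> R.V (Suc n)" using R.V_mult[OF R.u_pow_V[of n] d(2)] by simp
    finally show ?case using r d(1) by (intro exI[of _ "r(n := d)"]) (auto simp: spec_def less_Suc_eq)
  qed
  then obtain r where r: "spec r a" by blast
  have unique: "s = r" if s: "spec s a" for s
  proof
    fix i
    show "s i = r i"
    proof (induction i rule: less_induct)
      case (less i)
      show ?case
      proof (cases "i < a")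
        case True
        have sum0: "(\<Sum>j<a. (s j - r j) * u ^ j) = 0"
          using s r R.V_a by (simp add: spec_def left_diff_distrib sum_subtractf)
        have ivl: "{..<a} = insert i ({..<i} \<union> {i<..<a})" using True by auto
        have "(\<Sum>j<a. (s j - r j) * u ^ j) =
            (\<Sum>j<i. (s j - r j) * u ^ j) + (s i - r i) * u ^ i + (\<Sum>j\<in>{i<..<a}. (s j - r j) * u ^ j)"
          unfolding ivl by (subst sum.insert, simp_all) (rule sum.union_disjoint; auto)
        moreover have "(\<Sum>j<i. (s j - r j) * u ^ j) = 0" using less by simp
        moreover have "(\<Sum>j\<in>{i<..<a}. (s j - r j) * u ^ j) = u ^ Suc i * (\<Sum>j\<in>{i<..<a}. (s j - r j) * u ^ (j - Suc i))"
          unfolding sum_distrib_left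
        proof (intro sum.cong refl)
          fix j assume "j \<in> {i<..<a}"
          then have "u ^ j = u ^ Suc i * u ^ (j - Suc i)" by (simp flip: power_add power_Suc)
          then show "(s j - r j) * u ^ j = u ^ Suc i * ((s j - r j) * u ^ (j - Suc i))"
            by (simp only: mult_ac)
        qed
        ultimately have "(s i - r i) * u ^ i = - (u ^ Suc i * (\<Sum>j\<in>{i<..<a}. (s j - r j) * u ^ (j - Suc i)))"
          using sum0 by (simp add: eq_neg_iff_add_eq_0)
        also have "\<dots> = u ^ Suc i * - (\<Sum>j\<in>{i<..<a}. (s j - r j) * u ^ (j - Suc i))" by simp
        also have "\<dots> \<in> R.V (Suc i)" by (rule pow_mult_V)
        \<comment> \<open>With all earlier digits equal, the term of index \<open>i\<close> equals a
          multiple of u^(i+1). A unit coefficient is impossible then, so both digits lie in one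
          residue class and coincide.\<close>
        finally have "s i - r i \<notin> Units (whole :: 'a ring)"
          using R.unit_mult_pow_notin[OF _ True, of "s i - r i"] by auto
        then have "s i - r i \<in> R.V 1" using R.nonunit_iff[of "s i - r i"] by simp
        then show ?thesis using R.residue_reps_unique[of "s i" "r i"] s r True by (simp add: spec_def)
      qed (use s r in \<open>simp add: spec_def\<close>)
    qed
  qed
  have spec_a: "spec s a \<longleftrightarrow> (\<forall>i<a. s i \<in> residue_reps whole) \<and> (\<forall>i\<ge>a. s i = 0) \<and> x = (\<Sum>i<a. s i * u ^ i)" for s
    by (simp add: spec_def R.V_a)
  have "digits u x = r"
    unfolding digits_def R.nilpotency_index Let_def spec_a[symmetric]
    using r unique by (rule the_equality)
  then show ?thesis using r spec_a by blast
qed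

text \<open>Cutting the expansion off at \<open>a - e\<close> is harmless: after multiplication by
  u^e the omitted terms contain u^a = 0.\<close>

lemma digit_poly_zero:
  assumes "of_nat p = \<epsilon> * u ^ e"
  shows "poly (digit_poly u \<epsilon>) u * u ^ e = of_nat p"
proof -
  have zero: "u ^ n = 0" if "a \<le> n" for n
    using R.u_pow_V[of n] R.V_zero_ge[OF that] by simp
  have "of_nat p = (\<Sum>i<a. digits u \<epsilon> i * u ^ i * u ^ e)"
    using assms digits_spec[of \<epsilon>] by (simp flip: sum_distrib_right)
  also have "\<dots> = (\<Sum>i<a - e. digits u \<epsilon> i * u ^ i * u ^ e)"
    by (rule sum.mono_neutral_right) (auto simp: mult.assoc zero simp flip: power_add)
  also have "\<dots> = poly (digit_poly u \<epsilon>) u * u ^ e"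
    by (simp add: digit_poly_def R.nilpotency_index e_def poly_sum poly_monom sum_distrib_right)
  finally show ?thesis ..
qed

lemma digit_poly_range: "\<exists>d. digit_poly u \<epsilon> = emb d"
proof -
  have "poly.coeff (digit_poly u \<epsilon>) i \<in> carrier (coeff_ring whole)" for i
  proof (cases "i < a - e")
    case True
    then have "digits u \<epsilon> i \<in> residue_reps whole" using digits_spec[of \<epsilon>] by auto
    then show ?thesis
      using True unfolding carrier_coeff_ring
      by (simp add: digit_poly_def R.nilpotency_index e_def coeff_sum generate_ring.incl)
  next
    case False
    then show ?thesis using coeff_ring_0_1(1)
      by (simp add: digit_poly_def R.nilpotency_index e_def coeff_sum)
  qed
  then have "digit_poly u \<epsilon> \<in> carrier coeff_ring_polys" by (simp add: coeff_ring_polys_def)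
  then show ?thesis by (auto simp: carrier_coeff_ring_polys)
qed

lemma degree_digit_poly: "Polynomial.degree (digit_poly u \<epsilon>) < a - e"
proof -
  have "Polynomial.degree (digit_poly u \<epsilon>) \<le> a - e - 1"
    unfolding digit_poly_def R.nilpotency_index e_def
    by (intro degree_sum_le) (auto intro: order_trans[OF degree_monom_le])
  then show ?thesis using e_less_a by simp
qed

lemma cong_mod_p_emb: "cong_mod_p (emb s) (emb t) \<longleftrightarrow> [:of_nat p:] dvd s - t" for s t :: "'a omega poly"
  unfolding cong_mod_p_def const_poly_dvd_iff_coeffs Emb.hom_minus[symmetric] coeff_emb p_multiples_iff
  by simp

text \<open>The congruence to Y^e fixes the degree and the lower coefficients. If p^2 divided g(0),
  the product formula would give p (1 + p z y) = 0, so \<open>p\<close> would divide 1 + p z y and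
  hence 1.\<close>

lemma eisenstein_of_factor:
  assumes "lead_coeff g = 1" "[:of_nat p:] dvd g - Polynomial.monom 1 e"
    and "poly.coeff g 0 * y = - of_nat p"
  shows "eisenstein g"
proof -
  let ?P = "of_nat p :: 'a omega"
  have c: "?P dvd poly.coeff (g - Polynomial.monom 1 e) i" for i
    using assms(2) const_poly_dvd_iff_coeffs by blast
  have n1: "\<not> ?P dvd 1" using not_unit_P_dvd[of 1] by auto
  have "Polynomial.degree g = e"
  proof (rule linorder_cases)
    assume "Polynomial.degree g < e"
    then show ?thesis using c[of e] n1 by (simp add: coeff_eq_0)
  next
    assume "e < Polynomial.degree g"
    then show ?thesis using c[of "Polynomial.degree g"] n1 assms(1) by simp
  qed
  moreover have low: "?P dvd poly.coeff g i" if "i < e" for i using c[of i] that by simp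
  moreover have "\<not> ?P ^ 2 dvd poly.coeff g 0"
  proof
    assume "?P ^ 2 dvd poly.coeff g 0"
    then obtain z where "poly.coeff g 0 = ?P ^ 2 * z" by (auto elim: dvdE)
    then have "?P ^ 1 * (1 + ?P * (z * y)) = 0"
      using assms(3) by (simp add: power2_eq_square algebra_simps)
    then have "?P dvd 1 + ?P * (z * y)" by (rule annihilator) (use k_pos in simp)
    then show False using n1 by (simp add: dvd_add_left_iff)
  qed
  ultimately show ?thesis using assms(1) e_pos by (simp add: eisenstein_def)
qed

text \<open>g_0 vanishes at \<open>u\<close>, so the Eisenstein polynomial \<open>q\<close> of
  \<open>u\<close> divides it, and cancelling the monic Y^e modulo \<open>p\<close> gives the
  congruence for the cofactor. Conversely let h h1 be any factorization with the prescribed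
  congruences. Then h is Eisenstein since h(0) h1(0) = - p, and h1(u) is a unit, so h(u) = 0 and h =
  q.\<close>

lemma hensel_factor:
  assumes neat: "neat (whole :: 'a ring)" and \<epsilon>: "\<epsilon> \<in> Units (whole :: 'a ring)" "of_nat p = \<epsilon> * u ^ e"
  shows "hensel_factor u \<epsilon> \<in> eisenstein_with_zero"
proof -
  let ?P = "of_nat p :: 'a omega"
  let ?X = "Polynomial.monom (1 :: 'a omega)"
  obtain d where d: "digit_poly u \<epsilon> = emb d" using digit_poly_range by blast
  define G where "G = ?X a + d * ?X e - [:?P:]"
  have "emb [:?P:] = (of_nat p :: 'a poly)"
    by (rule poly_eqI) (simp add: of_nat_poly coeff_pCons Rep.hom_of_nat split: nat.split)
  then have embG: "emb G = Polynomial.monom 1 a + digit_poly u \<epsilon> * Polynomial.monom 1 e - of_nat p"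
    by (simp only: G_def d Emb.hom_minus Emb.hom_add Emb.hom_mult emb_monom)
  have evd: "E.ev u d * u ^ e = of_nat p"
    using digit_poly_zero[OF \<epsilon>(2)] unfolding d poly_emb .
  have evG: "E.ev u G = 0"
    using evd R.u_pow_a E.ev_const[OF R.u_closed, of "of_nat p"]
    by (simp add: G_def E.ev_diff E.ev_add E.ev_mult E.ev_monom hom_distribs)
  \<comment> \<open>Otherwise p would have order greater than \<open>e\<close>. This non-membership
    is what later makes the value of the second factor at \<open>u\<close> a unit.\<close>
  have ann: "\<not> E.ev u d \<in> R.V 1"
  proof
    assume "E.ev u d \<in> R.V 1"
    then have "\<epsilon> * u ^ e \<in> R.V (1 + e)" using R.V_mult[OF _ R.u_pow_V[of e]] evd \<epsilon>(2) by fastforce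
    then show False using R.unit_mult_pow_notin[OF \<epsilon>(1) e_less_a] by simp
  qed
  have dd: "Polynomial.degree d < a - e" using degree_digit_poly[of \<epsilon>] by (simp add: d)
  have G: "lead_coeff G = 1" "G \<noteq> 0"
  proof -
    have "Polynomial.degree (d * ?X e) < a"
      using dd degree_mult_le[of d "?X e"] degree_monom_le[of "1::'a omega" e] by linarith
    then have c: "poly.coeff G a = 1" "Polynomial.degree G \<le> a"
      using e_less_a unfolding G_def
      by (auto simp: coeff_eq_0 coeff_pCons degree_monom_le split: nat.split
            intro!: degree_diff_le degree_add_le)
    then have "Polynomial.degree G = a" by (metis le_degree le_antisym zero_neq_one)
    then show "lead_coeff G = 1" using c(1) by simp
    then show "G \<noteq> 0" by auto
  qed
  obtain q where q: "eisenstein q" "E.ev u q = 0" using E.eisenstein_zero_exists by auto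
  have kernel: "E.ev u t = 0 \<longleftrightarrow> q dvd t" for t
    using E.ev_kernel[OF iffD1[OF neat_iff neat] q(1)] q(2) by simp
  then obtain g1 where g1: "G = q * g1" using evG by (auto elim: dvdE)
  have [simp]: "emb s \<in> carrier coeff_ring_polys" for s by (simp add: carrier_coeff_ring_polys)
  define spec where "spec g \<longleftrightarrow> g \<in> carrier coeff_ring_polys \<and> lead_coeff g = 1 \<and> cong_mod_p g (Polynomial.monom 1 e) \<and>
           (\<exists>g1 \<in> carrier coeff_ring_polys. lead_coeff g1 = 1 \<and>
              cong_mod_p g1 (Polynomial.monom 1 (a - e) + digit_poly u \<epsilon>) \<and> emb G = g * g1)" for g
  have "spec (emb q)"
  proof -
    have "g1 \<noteq> 0" using g1 G(2) by auto
    have "lead_coeff g1 = 1"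
      using monic_mult_degree[OF eisensteinD(2)[OF q(1)] \<open>g1 \<noteq> 0\<close>] G(1) g1 by simp
    have "[:?P:] dvd q * g1 - ?X e * g1"
      using dvd_mult2[OF eisensteinD(3)[OF q(1)], of g1] by (simp add: left_diff_distrib)
    moreover have "[:?P:] dvd G - ?X e * (?X (a - e) + d)"
    proof -
      have "G - ?X e * (?X (a - e) + d) = - [:?P:]"
        using e_less_a by (simp add: G_def algebra_simps mult_monom)
      then show ?thesis by simp
    qed
    ultimately have "[:?P:] dvd (G - ?X e * (?X (a - e) + d)) - (q * g1 - ?X e * g1)"
      by (rule dvd_diff[rotated])
    then have "[:?P:] dvd ?X e * (g1 - (?X (a - e) + d))" unfolding g1[symmetric] by (simp add: algebra_simps)
    then have "[:?P:] dvd g1 - (?X (a - e) + d)" by (rule const_dvd_monic_mult[rotated]) (simp add: degree_monom_eq)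
    then have "cong_mod_p (emb g1) (Polynomial.monom 1 (a - e) + digit_poly u \<epsilon>)"
      unfolding d cong_mod_p_emb[symmetric] by (simp add: Emb.hom_add)
    moreover have "cong_mod_p (emb q) (Polynomial.monom 1 e)"
      using eisensteinD(3)[OF q(1)] unfolding cong_mod_p_emb[symmetric] by simp
    moreover have "emb G = emb q * emb g1" unfolding g1 by (simp add: Emb.hom_mult)
    moreover have "lead_coeff (emb q) = 1" "lead_coeff (emb g1) = 1"
      using eisensteinD(2)[OF q(1)] \<open>lead_coeff g1 = 1\<close> by simp_all
    ultimately show ?thesis unfolding spec_def by (auto intro!: bexI[of _ "emb g1"])
  qed
  moreover have "g = emb q" if "spec g" for g
  proof -
    obtain h h1 where h: "g = emb h" "lead_coeff (emb h) = 1" "cong_mod_p (emb h) (Polynomial.monom 1 e)"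
      "cong_mod_p (emb h1) (Polynomial.monom 1 (a - e) + digit_poly u \<epsilon>)" "emb G = emb h * emb h1"
      using \<open>spec g\<close> by (auto simp: spec_def carrier_coeff_ring_polys)
    have Gh: "G = h * h1" using h(5) by (simp flip: Emb.hom_mult)
    have c: "[:?P:] dvd h - ?X e" using h(3) unfolding cong_mod_p_emb[symmetric] by simp
    have c1: "[:?P:] dvd h1 - (?X (a - e) + d)"
      using h(4) unfolding cong_mod_p_emb[symmetric] d by (simp add: Emb.hom_add)
    have "poly.coeff h 0 * poly.coeff h1 0 = - ?P"
      using arg_cong[OF Gh, of "\<lambda>t. poly.coeff t 0"] e_pos e_less_a
      by (simp add: G_def coeff_mult_0)
    then have eis: "eisenstein h" using h(2) c by (intro eisenstein_of_factor) (auto simp: Rep.hom_1_iff)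
    have "E.ev u h1 \<in> Units (whole :: 'a ring)"
    proof (rule ccontr)
      assume "E.ev u h1 \<notin> Units (whole :: 'a ring)"
      then have 1: "E.ev u h1 \<in> R.V 1" using R.nonunit_iff[of "E.ev u h1"] by simp
      have "E.ev u (h1 - (?X (a - e) + d)) \<in> R.V e" using E.ev_P_mult[OF _ c1, of u] by simp
      then have 2: "E.ev u (h1 - (?X (a - e) + d)) \<in> R.V 1" using R.V_antimono[of 1 e] e_pos by auto
      have "1 \<le> a - e" using e_less_a by linarith
      then have 3: "u ^ (a - e) \<in> R.V 1"
        using R.u_pow_V[of "a - e"] R.V_antimono[of 1 "a - e"] by auto
      have "E.ev u d = (E.ev u h1 - E.ev u (h1 - (?X (a - e) + d))) - u ^ (a - e)"
        by (simp add: E.ev_diff E.ev_add E.ev_monom)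
      also have "\<dots> \<in> R.V 1"
        using R.V_diff[OF R.V_diff[OF 1 2] 3] by simp
      finally show False using ann by blast
    qed
    moreover have "E.ev u h * E.ev u h1 = 0" using evG by (simp add: Gh E.ev_mult)
    ultimately have "E.ev u h = 0" unfolding whole_Units
      by (metis (mono_tags) dvdE mem_Collect_eq mult.assoc mult.right_neutral mult_zero_left)
    then have "h = q" using E.eisenstein_zero_unique[OF iffD1[OF neat_iff neat] eis _ q(1)] q(2) by simp
    then show ?thesis using h(1) by simp
  qed
  ultimately have "(THE g. spec g) = emb q" by (rule the_equality)
  then have "hensel_factor u \<epsilon> = emb q"
    unfolding hensel_factor_def Let_def R.nilpotency_index e_def p_def embG[symmetric] spec_def .
  then show ?thesis
    using q eisenstein_with_zeroI[of "emb q" u] by (simp add: emb_eisenstein poly_emb)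
qed

end

section \<open>Rings of the same type\<close>

context coefficient_extension begin

lemma extension_at:
  assumes x: "x \<in> uniformizers S"
  shows "coefficient_extension P k e a S x j"
proof -
  interpret X: finite_chain_ring S x a
    using uniformizer_chain[OF _ x] e_less_a e_pos by linarith
  have V1: "X.V 1 = V 1"
    using X.maximalideal_iff[of "V 1"] maximalideal_iff[of "V 1"] by simp
  show ?thesis
  proof
    obtain v where v: "v \<in> Units S" "j P = v \<otimes> u [^] e" using j_P by blast
    obtain w where w: "w \<in> Units S" "u = w \<otimes> x"
      using X.uniformizers u_uniformizer e_less_a e_pos by force
    have "j P = (v \<otimes> w [^] e) \<otimes> x [^] e"
      unfolding v(2) w(2) using v(1) w(1) by (simp add: nat_pow_distrib m_assoc)
    moreover have "v \<otimes> w [^] e \<in> Units S" using v(1) w(1) by (simp add: Units_pow_closed)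
    ultimately show "\<exists>v\<in>Units S. j P = v \<otimes> x [^] e" by blast
  next
    fix y assume "y \<in> carrier S"
    then show "\<exists>c. y \<ominus> j c \<in> X.V 1" unfolding V1 by (rule j_residue)
  qed
qed

text \<open>Both zeros are uniformizers, so y = t(x) x for some \<open>t\<close> with unit constant
  term. Then t * q and \<open>r\<close> are Eisenstein polynomials with the common zero y, hence
  equal in the neat case.\<close>

lemma eisenstein_zeros_conjugate:
  assumes neat: "a = e * Suc k"
    and q: "eisenstein q" "x \<in> carrier S" "ev x q = \<zero>"
    and r: "eisenstein r" "y \<in> carrier S" "ev y r = \<zero>"
  shows "\<exists>t. poly.coeff t 0 dvd 1 \<and> r = subst_resultant t q"
proof -
  interpret X: coefficient_extension P k e a S x j
    by (rule extension_at[OF eisenstein_zero_uniformizer[OF q]])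
  interpret Y: coefficient_extension P k e a S y j
    by (rule extension_at[OF eisenstein_zero_uniformizer[OF r]])
  obtain v where v: "v \<in> Units S" "y = v \<otimes> x"
    using Y.u_uniformizer unfolding X.uniformizers_eq by blast
  obtain t where t: "v = ev x t" using X.ev_surj_degree[of v] v(1) by auto
  have t0: "poly.coeff t 0 dvd 1" using X.ev_unit_iff[OF X.u_V] v(1) t by blast
  have "ev y (subst_resultant t q) = \<zero>"
    using ev_subst_resultant_zero[OF q, of t] v(2) t by simp
  then have "r = subst_resultant t q"
    using Y.eisenstein_zero_unique[OF neat r(1) r(3) eisenstein_subst_resultant[OF q(1) t0]] by simp
  then show ?thesis using t0 by blast
qed

lemma residue_char_coefficients: "residue_char S = (LEAST n. 0 < n \<and> P dvd of_nat n)"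
  unfolding residue_char_eq j_num[symmetric] j_V1_iff ..

text \<open>The right side mentions only \<open>P\<close> and the coefficient ring. It is therefore
  the same for all extensions, which makes the residue degree of another extension comparable with
  that of R.\<close>

lemma card_residue_coefficients: "card (carrier (residue_field S)) = card (range (\<lambda>c. {d. P dvd c - d}))"
proof -
  have "carrier (residue_field S) = range (\<lambda>c. V 1 +> j c)"
  proof -
    have "V 1 +> x \<in> range (\<lambda>c. V 1 +> j c)" if "x \<in> carrier S" for x
      using j_residue[OF that] residue_eq_iff[OF that] by (metis j_simps(1) rangeI)
    then show ?thesis unfolding carrier_residue by auto
  qed
  moreover have "V 1 +> j c = V 1 +> j d \<longleftrightarrow> {x. P dvd c - x} = {x. P dvd d - x}" for c d
  proof -
    have "V 1 +> j c = V 1 +> j d \<longleftrightarrow> P dvd c - d"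
      using residue_eq_iff[of "j c" "j d"] j_V1_iff[of "c - d"] by (simp add: j_diff del: One_nat_def)
    also have "\<dots> \<longleftrightarrow> {x. P dvd c - x} = {x. P dvd d - x}"
    proof
      assume cd: "P dvd c - d"
      have "P dvd c - x \<longleftrightarrow> P dvd d - x" for x
        using dvd_add_right_iff[OF cd, of "d - x"] by simp
      then show "{x. P dvd c - x} = {x. P dvd d - x}" by simp
    next
      assume "{x. P dvd c - x} = {x. P dvd d - x}"
      moreover have "d \<in> {x. P dvd d - x}" by simp
      ultimately have "d \<in> {x. P dvd c - x}" by (simp only:)
      then show "P dvd c - d" by simp
    qed
    finally show ?thesis .
  qed
  then have "card (range (\<lambda>c. V 1 +> j c)) = card (range (\<lambda>c. {x. P dvd c - x}))"
  proof -
    assume eq: "\<And>c d. V 1 +> j c = V 1 +> j d \<longleftrightarrow> {x. P dvd c - x} = {x. P dvd d - x}"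
    define h where "h C = {x. P dvd inv_into UNIV (\<lambda>c. V 1 +> j c) C - x}" for C
    have h: "h (V 1 +> j c) = {x. P dvd c - x}" for c
      unfolding h_def eq[symmetric] by (rule f_inv_into_f) simp
    have "inj_on h (range (\<lambda>c. V 1 +> j c))"
    proof (rule inj_onI, clarify)
      fix c d assume "h (V 1 +> j c) = h (V 1 +> j d)"
      then show "V 1 +> j c = V 1 +> j d" unfolding h eq .
    qed
    moreover have "h ` range (\<lambda>c. V 1 +> j c) = range (\<lambda>c. {x. P dvd c - x})" by (simp add: image_image h del: One_nat_def)
    ultimately show ?thesis using card_image by metis
  qed
  ultimately show ?thesis by simp
qed

lemma ramification_of_P: "max_ideal_ord S (j P) = e"
  using j_P max_ideal_ord[of _ e] e_less_a by auto

end

text \<open>The isomorphism theorem for two surjections from one ring: \<open>h\<close> lifts an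
  element along \<open>\<phi>\<close> and applies \<open>\<psi>\<close>, and the common kernel makes
  the lift irrelevant.\<close>

lemma ring_iso_of_same_kernel:
  assumes R: "ring R" "ring S" "ring S'"
    and \<phi>: "\<phi> \<in> Ring.ring_hom R S" "\<phi> ` carrier R = carrier S"
    and \<psi>: "\<psi> \<in> Ring.ring_hom R S'" "\<psi> ` carrier R = carrier S'"
    and kernel: "\<And>x. x \<in> carrier R \<Longrightarrow> \<phi> x = \<zero>\<^bsub>S\<^esub> \<longleftrightarrow> \<psi> x = \<zero>\<^bsub>S'\<^esub>"
  shows "\<exists>h\<in>ring_iso S S'. \<forall>x\<in>carrier R. h (\<phi> x) = \<psi> x"
proof -
  interpret R: ring R by fact
  interpret S: ring S by fact
  interpret S': ring S' by fact
  have eq: "\<phi> x = \<phi> y \<longleftrightarrow> \<psi> x = \<psi> y" if xy: "x \<in> carrier R" "y \<in> carrier R" for x y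
  proof -
    have c: "\<phi> x \<in> carrier S" "\<phi> y \<in> carrier S" "\<psi> x \<in> carrier S'" "\<psi> y \<in> carrier S'"
      using xy \<phi>(2) \<psi>(2) by auto
    interpret P1: ring_hom_ring R S \<phi> by (rule ring_hom_ringI2[OF R(1,2) \<phi>(1)])
    interpret P2: ring_hom_ring R S' \<psi> by (rule ring_hom_ringI2[OF R(1,3) \<psi>(1)])
    have "\<phi> (x \<ominus>\<^bsub>R\<^esub> y) = \<phi> x \<ominus>\<^bsub>S\<^esub> \<phi> y" "\<psi> (x \<ominus>\<^bsub>R\<^esub> y) = \<psi> x \<ominus>\<^bsub>S'\<^esub> \<psi> y"
      using xy by (simp_all add: a_minus_def)
    then show ?thesis using kernel[of "x \<ominus>\<^bsub>R\<^esub> y"] xy c by simp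
  qed
  define h where "h s = \<psi> (inv_into (carrier R) \<phi> s)" for s
  have h: "h (\<phi> x) = \<psi> x" if "x \<in> carrier R" for x
    unfolding h_def
    by (rule iffD1[OF eq]) (use that in \<open>auto intro: inv_into_into simp: f_inv_into_f\<close>)
  have "h \<in> ring_iso S S'"
  proof (rule ring_iso_memI)
    show "bij_betw h (carrier S) (carrier S')"
      unfolding bij_betw_def
    proof
      show "inj_on h (carrier S)" unfolding \<phi>(2)[symmetric] by (rule inj_onI) (auto simp: h eq)
      show "h ` carrier S = carrier S'" unfolding \<phi>(2)[symmetric] \<psi>(2)[symmetric] by (force simp: h)
    qed
  next
    show "h \<one>\<^bsub>S\<^esub> = \<one>\<^bsub>S'\<^esub>"
      using h[OF R.one_closed] ring_hom_one[OF \<phi>(1)] ring_hom_one[OF \<psi>(1)] by simp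
  next
    fix x assume "x \<in> carrier S"
    then show "h x \<in> carrier S'" using h \<psi>(2) unfolding \<phi>(2)[symmetric] by auto
  next
    fix x y assume "x \<in> carrier S" "y \<in> carrier S"
    then obtain x' y' where xy: "x' \<in> carrier R" "y' \<in> carrier R" "x = \<phi> x'" "y = \<phi> y'"
      unfolding \<phi>(2)[symmetric] by auto
    show "h (x \<otimes>\<^bsub>S\<^esub> y) = h x \<otimes>\<^bsub>S'\<^esub> h y"
      using xy h[of "x' \<otimes>\<^bsub>R\<^esub> y'"] ring_hom_mult[OF \<phi>(1) xy(1,2)] ring_hom_mult[OF \<psi>(1) xy(1,2)]
      by (simp add: h)
    show "h (x \<oplus>\<^bsub>S\<^esub> y) = h x \<oplus>\<^bsub>S'\<^esub> h y"
      using xy h[of "x' \<oplus>\<^bsub>R\<^esub> y'"] ring_hom_add[OF \<phi>(1) xy(1,2)] ring_hom_add[OF \<psi>(1) xy(1,2)]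
      by (simp add: h)
  qed
  then show ?thesis using h by blast
qed

lemma quotient_bij_betw:
  assumes r: "\<And>x y. (x, y) \<in> r \<longleftrightarrow> x \<in> A \<and> y \<in> A \<and> g x = g y"
  shows "\<exists>F. bij_betw F (A // r) (g ` A) \<and> (\<forall>x\<in>A. F (r `` {x}) = g x)"
proof -
  define F where "F C = g (SOME x. x \<in> C)" for C
  have F: "F (r `` {x}) = g x" if "x \<in> A" for x
  proof -
    have "x \<in> r `` {x}" using that r by auto
    then have "(SOME y. y \<in> r `` {x}) \<in> r `` {x}" by (rule someI)
    then have "g (SOME y. y \<in> r `` {x}) = g x" using r by (metis Image_singleton_iff)
    then show ?thesis by (simp only: F_def)
  qed
  have "bij_betw F (A // r) (g ` A)"
    unfolding bij_betw_def
  proof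
    show "inj_on F (A // r)"
    proof (rule inj_onI)
      fix C D assume "C \<in> A // r" "D \<in> A // r" and eq: "F C = F D"
      then obtain x y where xy: "x \<in> A" "C = r `` {x}" "y \<in> A" "D = r `` {y}" by (auto elim!: quotientE)
      then have "g x = g y" using eq F by simp
      then show "C = D" using xy r by auto
    qed
    show "F ` (A // r) = g ` A"
      using F by (auto simp: quotient_def intro!: rev_image_eqI)
  qed
  then show ?thesis using F by blast
qed

context finite_local_setup begin

definition \<tau> :: "nat \<times> nat \<times> nat \<times> nat" where "\<tau> = (a, e, f, p)"

lemma coeff_ring_record [simp]:
  "x \<otimes>\<^bsub>coeff_ring S\<^esub> y = x \<otimes>\<^bsub>S\<^esub> y" "x \<oplus>\<^bsub>coeff_ring S\<^esub> y = x \<oplus>\<^bsub>S\<^esub> y" "\<one>\<^bsub>coeff_ring S\<^esub> = \<one>\<^bsub>S\<^esub>"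
  by (simp_all add: coeff_ring_def)

lemma coeff_ring_subset:
  assumes "ring S" shows "carrier (coeff_ring S) \<subseteq> carrier S"
  unfolding carrier_coeff_ring by (rule ring.generate_ring_incl[OF assms]) (auto simp: residue_reps_def)

text \<open>A ring homomorphism sends \<open>p\<close> to the same multiple of 1, whose order in
  \<open>S\<close> is \<open>e\<close> by the type; and the Teichmueller representatives of
  \<open>S\<close> lie in its coefficient ring, the image of \<open>\<iota>\<close>.\<close>

lemma coefficient_extension_of_type:
  assumes "(S, \<iota>) \<in> rings_of_type \<tau>"
  shows "\<exists>x. coefficient_extension (of_nat p :: 'a omega) k e a S x (\<iota> \<circ> Rep_omega)"
proof -
  have S: "finite_local_pir S" "type_of_ring S = \<tau>" "\<iota> \<in> ring_iso (coeff_ring (whole :: 'a ring)) (coeff_ring S)"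
    using assms by (auto simp: rings_of_type_def)
  have type: "nilpotency_index S = a" "ramification_index S = e" "residue_char S = p"
    using S(2) by (auto simp: type_of_ring_def \<tau>_def)
  obtain x where "finite_chain_ring S x a" using finite_local_pir_chain[OF S(1)] type(1) by auto
  then interpret S: finite_chain_ring S x a .
  let ?j = "\<iota> \<circ> Rep_omega"
  have \<iota>: "\<iota> \<in> Ring.ring_hom (coeff_ring (whole :: 'a ring)) (coeff_ring S)"
    "\<iota> ` carrier (coeff_ring (whole :: 'a ring)) = carrier (coeff_ring S)"
    using S(3) by (auto simp: ring_iso_def bij_betw_def)
  have mem: "Rep_omega c \<in> carrier (coeff_ring (whole :: 'a ring))" for c by (rule Rep_omega)
  have j: "?j \<in> Ring.ring_hom whole S"
  proof (rule ring_hom_memI)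
    show "?j c \<in> carrier S" for c
      using \<iota>(2) mem coeff_ring_subset[OF S.ring_axioms] by auto
  next
    show "?j (c \<otimes>\<^bsub>whole\<^esub> d) = ?j c \<otimes>\<^bsub>S\<^esub> ?j d" for c d
      using ring_hom_mult[OF \<iota>(1) mem mem, of c d] by (simp add: hom_distribs)
    show "?j (c \<oplus>\<^bsub>whole\<^esub> d) = ?j c \<oplus>\<^bsub>S\<^esub> ?j d" for c d
      using ring_hom_add[OF \<iota>(1) mem mem, of c d] by (simp add: hom_distribs)
    show "?j \<one>\<^bsub>whole\<^esub> = \<one>\<^bsub>S\<^esub>" using ring_hom_one[OF \<iota>(1)] by simp
  qed
  interpret J: ring_eval S ?j by unfold_locales (rule j)
  show ?thesis
  proof (intro exI, unfold_locales)
    obtain v where "v \<in> Units S" "add_pow S p \<one>\<^bsub>S\<^esub> = v \<otimes>\<^bsub>S\<^esub> x [^]\<^bsub>S\<^esub> max_ideal_ord S (add_pow S p \<one>\<^bsub>S\<^esub>)"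
      by (rule S.factorization_ord[of "add_pow S p \<one>\<^bsub>S\<^esub>"]) auto
    moreover have "max_ideal_ord S (add_pow S p \<one>\<^bsub>S\<^esub>) = e"
      using type(2,3) by (simp add: ramification_index_def)
    ultimately show "\<exists>v\<in>Units S. ?j (of_nat p) = v \<otimes>\<^bsub>S\<^esub> x [^]\<^bsub>S\<^esub> e"
      unfolding J.j_num by metis
  next
    fix y assume "y \<in> carrier S"
    then obtain r where r: "r \<in> residue_reps S" "y \<ominus>\<^bsub>S\<^esub> r \<in> S.V 1" using S.residue_reps_exist by blast
    then have "r \<in> carrier (coeff_ring S)" unfolding carrier_coeff_ring by (intro generate_ring.incl)
    then have "r \<in> \<iota> ` range Rep_omega" unfolding range_Rep_omega \<iota>(2) .
    then show "\<exists>c. y \<ominus>\<^bsub>S\<^esub> ?j c \<in> S.V 1" using r by auto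
  qed
qed

lemma eisenstein_with_zero_in_eq:
  assumes "(S, \<iota>) \<in> rings_of_type \<tau>"
  shows "eisenstein_with_zero_in S \<iota> =
    emb ` {q. eisenstein q \<and> (\<exists>x\<in>carrier S. eval_at S (\<iota> \<circ> Rep_omega) x q = \<zero>\<^bsub>S\<^esub>)}"
proof -
  obtain y where "coefficient_extension (of_nat p :: 'a omega) k e a S y (\<iota> \<circ> Rep_omega)"
    using coefficient_extension_of_type[OF assms] by blast
  then interpret X: coefficient_extension "of_nat p :: 'a omega" k e a S y "\<iota> \<circ> Rep_omega" .
  have "(\<Oplus>\<^bsub>S\<^esub>i\<in>{..Polynomial.degree (emb q)}. \<iota> (poly.coeff (emb q) i) \<otimes>\<^bsub>S\<^esub> x [^]\<^bsub>S\<^esub> i) =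
      eval_at S (\<iota> \<circ> Rep_omega) x q" if "x \<in> carrier S" for x q
    using X.ev_finsum[OF that, of q "Polynomial.degree q"] by simp
  then show ?thesis unfolding eisenstein_with_zero_in_def eisenstein_polys_eq
    by (auto intro!: imageI)
qed

end

section \<open>Isomorphism and equality of the sets of Eisenstein polynomials\<close>

context finite_local_setup begin

lemma same_zeros_if_iso:
  assumes S: "(S, \<iota>) \<in> rings_of_type \<tau>" and S': "(S', \<iota>') \<in> rings_of_type \<tau>"
    and h: "h \<in> ring_iso S S'" "\<forall>x \<in> carrier (coeff_ring (whole :: 'a ring)). h (\<iota> x) = \<iota>' x"
  shows "eisenstein_with_zero_in S \<iota> = (eisenstein_with_zero_in S' \<iota>' :: 'a poly set)"
proof -
  obtain y where "coefficient_extension (of_nat p :: 'a omega) k e a S y (\<iota> \<circ> Rep_omega)"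
    using coefficient_extension_of_type[OF S] by blast
  then interpret X: coefficient_extension "of_nat p :: 'a omega" k e a S y "\<iota> \<circ> Rep_omega" .
  obtain y' where "coefficient_extension (of_nat p :: 'a omega) k e a S' y' (\<iota>' \<circ> Rep_omega)"
    using coefficient_extension_of_type[OF S'] by blast
  then interpret X': coefficient_extension "of_nat p :: 'a omega" k e a S' y' "\<iota>' \<circ> Rep_omega" .
  have hom: "h \<in> Ring.ring_hom S S'" and bij: "bij_betw h (carrier S) (carrier S')"
    using h(1) by (auto simp: ring_iso_def)
  have hz: "h \<zero>\<^bsub>S\<^esub> = \<zero>\<^bsub>S'\<^esub>" using ring_hom_zero[OF hom X.ring_axioms X'.ring_axioms] .
  have closed: "h x \<in> carrier S'" if "x \<in> carrier S" for x using ring_hom_closed[OF hom that] .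
  have hj: "h (\<iota> (Rep_omega c)) = \<iota>' (Rep_omega c)" for c using h(2) Rep_omega by blast
  have ev: "h (X.ev x t) = X'.ev (h x) t" if x: "x \<in> carrier S" for x t
  proof (induction t)
    case (pCons c t)
    have 1: "X.ev x (pCons c t) = (\<iota> \<circ> Rep_omega) c \<oplus>\<^bsub>S\<^esub> x \<otimes>\<^bsub>S\<^esub> X.ev x t" by (rule X.ev_pCons[OF x])
    have 2: "X'.ev (h x) (pCons c t) = (\<iota>' \<circ> Rep_omega) c \<oplus>\<^bsub>S'\<^esub> h x \<otimes>\<^bsub>S'\<^esub> X'.ev (h x) t"
      by (rule X'.ev_pCons[OF closed[OF x]])
    have 3: "h ((\<iota> \<circ> Rep_omega) c \<oplus>\<^bsub>S\<^esub> x \<otimes>\<^bsub>S\<^esub> X.ev x t) =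
        h ((\<iota> \<circ> Rep_omega) c) \<oplus>\<^bsub>S'\<^esub> h x \<otimes>\<^bsub>S'\<^esub> h (X.ev x t)"
      unfolding ring_hom_add[OF hom X.j_simps(1)[of c] X.m_closed[OF x X.ev_closed[OF x, of t]]]
        ring_hom_mult[OF hom x X.ev_closed[OF x, of t]] ..
    show ?case unfolding 1 2 3 pCons.IH using hj[of c] by simp
  qed (simp only: X.ev_0 X'.ev_0 hz)
  have zero: "X.ev x q = \<zero>\<^bsub>S\<^esub> \<longleftrightarrow> X'.ev (h x) q = \<zero>\<^bsub>S'\<^esub>" if x: "x \<in> carrier S" for x q
    unfolding ev[OF x, symmetric] hz[symmetric]
    using inj_on_eq_iff[OF bij_betw_imp_inj_on[OF bij] X.ev_closed[OF x] X.zero_closed] by metis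
  have "(\<exists>x\<in>carrier S. X.ev x q = \<zero>\<^bsub>S\<^esub>) \<longleftrightarrow> (\<exists>x\<in>carrier S'. X'.ev x q = \<zero>\<^bsub>S'\<^esub>)" for q
  proof -
    have "(\<exists>x\<in>carrier S'. X'.ev x q = \<zero>\<^bsub>S'\<^esub>) \<longleftrightarrow> (\<exists>x\<in>carrier S. X'.ev (h x) q = \<zero>\<^bsub>S'\<^esub>)"
      unfolding bij_betw_imp_surj_on[OF bij, symmetric] by simp
    then show ?thesis using zero by blast
  qed
  then show ?thesis unfolding eisenstein_with_zero_in_eq[OF S] eisenstein_with_zero_in_eq[OF S'] by simp
qed

text \<open>The Eisenstein polynomial \<open>q\<close> of a uniformizer of \<open>S\<close> has a
  zero x in \<open>S'\<close>. Both rings are then images of the polynomial ring, by evaluation at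
  \<open>y\<close> and at \<open>x\<close>, with the same kernel, the multiples of
  \<open>q\<close>.\<close>

lemma iso_if_same_zeros:
  assumes neat: "a = e * Suc k"
    and S: "(S, \<iota>) \<in> rings_of_type \<tau>" and S': "(S', \<iota>') \<in> rings_of_type \<tau>"
    and eq: "eisenstein_with_zero_in S \<iota> = (eisenstein_with_zero_in S' \<iota>' :: 'a poly set)"
  shows "\<exists>h \<in> ring_iso S S'. \<forall>x \<in> carrier (coeff_ring (whole :: 'a ring)). h (\<iota> x) = \<iota>' x"
proof -
  obtain y where "coefficient_extension (of_nat p :: 'a omega) k e a S y (\<iota> \<circ> Rep_omega)"
    using coefficient_extension_of_type[OF S] by blast
  then interpret X: coefficient_extension "of_nat p :: 'a omega" k e a S y "\<iota> \<circ> Rep_omega" .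
  obtain y' where "coefficient_extension (of_nat p :: 'a omega) k e a S' y' (\<iota>' \<circ> Rep_omega)"
    using coefficient_extension_of_type[OF S'] by blast
  then interpret X': coefficient_extension "of_nat p :: 'a omega" k e a S' y' "\<iota>' \<circ> Rep_omega" .
  obtain q where q: "eisenstein q" "X.ev y q = \<zero>\<^bsub>S\<^esub>" using X.eisenstein_zero_exists by blast
  then have "emb q \<in> eisenstein_with_zero_in S \<iota>"
    unfolding eisenstein_with_zero_in_eq[OF S] using X.u_closed by (intro imageI) auto
  then have "emb q \<in> eisenstein_with_zero_in S' \<iota>'" unfolding eq .
  then obtain x where x: "x \<in> carrier S'" "X'.ev x q = \<zero>\<^bsub>S'\<^esub>"
    unfolding eisenstein_with_zero_in_eq[OF S'] by auto
  interpret Y: coefficient_extension "of_nat p :: 'a omega" k e a S' x "\<iota>' \<circ> Rep_omega"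
    by (rule X'.extension_at[OF X'.eisenstein_zero_uniformizer[OF q(1) x]])
  have "\<exists>h\<in>ring_iso S S'. \<forall>t\<in>carrier (whole :: 'a omega poly ring). h (X.ev y t) = X'.ev x t"
  proof (rule ring_iso_of_same_kernel)
    show "ring (whole :: 'a omega poly ring)" using cring_whole by (rule cring.axioms(1))
    show "X.ev y ` carrier whole = carrier S" using X.ev_surj_degree by (auto simp: X.ev_closed)
    show "X'.ev x ` carrier whole = carrier S'" using Y.ev_surj_degree by (auto simp: X'.ev_closed[OF x(1)])
    show "X.ev y t = \<zero>\<^bsub>S\<^esub> \<longleftrightarrow> X'.ev x t = \<zero>\<^bsub>S'\<^esub>" for t
      unfolding X.ev_kernel[OF neat q] Y.ev_kernel[OF neat q(1) x(2)] ..
  qed (auto intro: X.ring_axioms X'.ring_axioms X.ev_hom X'.ev_hom x)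
  then obtain h where h: "h \<in> ring_iso S S'" "\<And>t. h (X.ev y t) = X'.ev x t" by auto
  \<comment> \<open>On constant polynomials the two evaluations are \<open>\<iota>\<close> and
    \<open>\<iota>'\<close>.\<close>
  have "h (\<iota> z) = \<iota>' z" if "z \<in> carrier (coeff_ring (whole :: 'a ring))" for z
  proof -
    obtain c where c: "z = Rep_omega c" using \<open>z \<in> _\<close> unfolding range_Rep_omega[symmetric] by auto
    show ?thesis using h(2)[of "[:c:]"] X.ev_const[OF X.u_closed, of c] X'.ev_const[OF x(1), of c] c by simp
  qed
  then show ?thesis using h(1) by blast
qed

lemma eisenstein_with_zero_in_orbit:
  fixes q :: "'a omega poly"
  assumes neat: "a = e * Suc k" and S: "(S, \<iota>) \<in> rings_of_type \<tau>" and q: "emb q \<in> eisenstein_with_zero_in S \<iota>"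
  shows "eisenstein_with_zero_in S \<iota> = orbit subst_group poly_action (emb q)"
proof -
  obtain y where "coefficient_extension (of_nat p :: 'a omega) k e a S y (\<iota> \<circ> Rep_omega)"
    using coefficient_extension_of_type[OF S] by blast
  then interpret X: coefficient_extension "of_nat p :: 'a omega" k e a S y "\<iota> \<circ> Rep_omega" .
  obtain x where x: "eisenstein q" "x \<in> carrier S" "X.ev x q = \<zero>\<^bsub>S\<^esub>"
    using q unfolding eisenstein_with_zero_in_eq[OF S] by auto
  have orbit: "orbit subst_group poly_action (emb q) = emb ` {subst_resultant t q | t. poly.coeff t 0 dvd 1}"
  proof -
    have "orbit subst_group poly_action (emb q) = (\<lambda>t. poly_action (cls t) (emb q)) ` {t. poly.coeff t 0 dvd 1}"
      unfolding orbit_def setcompr_eq_image carrier_subst_group image_image by auto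
    also have "\<dots> = (\<lambda>t. emb (subst_resultant t q)) ` {t. poly.coeff t 0 dvd 1}"
      by (rule image_cong) (auto simp: poly_action_cls[OF _ x(1)])
    finally show ?thesis unfolding setcompr_eq_image image_image .
  qed
  have "{r. eisenstein r \<and> (\<exists>y\<in>carrier S. X.ev y r = \<zero>\<^bsub>S\<^esub>)} = {subst_resultant t q | t. poly.coeff t 0 dvd 1}"
  proof
    show "{r. eisenstein r \<and> (\<exists>y\<in>carrier S. X.ev y r = \<zero>\<^bsub>S\<^esub>)} \<subseteq> {subst_resultant t q | t. poly.coeff t 0 dvd 1}"
      using X.eisenstein_zeros_conjugate[OF neat x] by blast
    show "{subst_resultant t q | t. poly.coeff t 0 dvd 1} \<subseteq> {r. eisenstein r \<and> (\<exists>y\<in>carrier S. X.ev y r = \<zero>\<^bsub>S\<^esub>)}"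
    proof clarify
      fix t :: "'a omega poly" assume t: "poly.coeff t 0 dvd 1"
      have "X.ev x t \<otimes>\<^bsub>S\<^esub> x \<in> carrier S" using x(2) X.ev_closed[OF x(2)] by simp
      then show "eisenstein (subst_resultant t q) \<and> (\<exists>y\<in>carrier S. X.ev y (subst_resultant t q) = \<zero>\<^bsub>S\<^esub>)"
        using eisenstein_subst_resultant[OF x(1) t] X.ev_subst_resultant_zero[OF x, of t] by blast
    qed
  qed
  then show ?thesis unfolding eisenstein_with_zero_in_eq[OF S] orbit by simp
qed

text \<open>Remainders of degree below that of \<open>q\<close> represent all classes, so the
  residue ring is finite; an injection of its elements into the natural numbers then moves it to a
  ring of the kind that \<open>rings_of_type\<close> collects.\<close>

lemma finite_residue_ring:
  assumes q: "lead_coeff q = 1"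
  shows "\<exists>(S :: nat ring) \<phi>. cring S \<and> finite (carrier S) \<and>
    \<phi> \<in> Ring.ring_hom (whole :: 'a omega poly ring) S \<and> range \<phi> = carrier S \<and> (\<forall>t. \<phi> t = \<zero>\<^bsub>S\<^esub> \<longleftrightarrow> q dvd t)"
proof -
  let ?A = "whole :: 'a omega poly ring"
  define I where "I = {t. q dvd t}"
  have I: "ideal I ?A"
  proof -
    have "I = PIdl\<^bsub>?A\<^esub> q" by (auto simp: I_def cgenideal_def dvd_def mult.commute)
    then show ?thesis using cring.cgenideal_ideal[OF cring_whole, of q] by simp
  qed
  let ?K = "?A Quot I"
  define \<pi> where "\<pi> t = I +>\<^bsub>?A\<^esub> t" for t
  have \<pi>: "\<pi> \<in> Ring.ring_hom ?A ?K" unfolding \<pi>_def using ideal.rcos_ring_hom[OF I] by simp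
  have K: "cring ?K" by (rule ideal.quotient_is_cring[OF I cring_whole])
  have range: "range \<pi> = carrier ?K" by (auto simp: \<pi>_def FactRing_def A_RCOSETS_def')
  have eq: "\<pi> s = \<pi> t \<longleftrightarrow> q dvd s - t" for s t
    using ring.quotient_eq_iff_same_a_r_cos[OF cring.axioms(1)[OF cring_whole] I, of s t]
    by (simp add: \<pi>_def I_def)
  have "\<zero>\<^bsub>?K\<^esub> = \<pi> 0"
    using ring_hom_zero[OF \<pi> cring.axioms(1)[OF cring_whole] cring.axioms(1)[OF K]] by simp
  then have zero: "\<pi> t = \<zero>\<^bsub>?K\<^esub> \<longleftrightarrow> q dvd t" for t using eq[of t 0] by simp
  have fin: "finite (carrier ?K)"
  proof -
    let ?B = "{t :: 'a omega poly. t = 0 \<or> Polynomial.degree t < Polynomial.degree q}"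
    have "?B \<subseteq> Poly ` {xs. set xs \<subseteq> UNIV \<and> length xs \<le> Polynomial.degree q}"
    proof
      fix t assume "t \<in> ?B"
      then have "length (coeffs t) \<le> Polynomial.degree q"
        by (cases "t = 0") (auto simp: length_coeffs_degree)
      then show "t \<in> Poly ` {xs. set xs \<subseteq> UNIV \<and> length xs \<le> Polynomial.degree q}"
        by (intro image_eqI[of _ _ "coeffs t"]) auto
    qed
    then have "finite ?B"
      using finite_lists_length_le[OF finite_UNIV(2)] finite_surj by blast
    moreover have "carrier ?K \<subseteq> \<pi> ` ?B"
    proof
      fix z assume "z \<in> carrier ?K"
      then obtain t where t: "z = \<pi> t" using range by blast
      obtain b r where "t = q * b + r" "r = 0 \<or> Polynomial.degree r < Polynomial.degree q"
        by (rule monic_division[OF q])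
      then show "z \<in> \<pi> ` ?B" using t eq[of t r] by auto
    qed
    ultimately show ?thesis using finite_surj by blast
  qed
  obtain enc :: "'a omega poly set \<Rightarrow> nat" where enc: "inj_on enc (carrier ?K)"
    using finite_imp_inj_to_nat_seg[OF fin] by blast
  let ?S = "image_ring enc ?K"
  have iso: "enc \<in> ring_iso ?K ?S" by (rule inj_imp_image_ring_iso[OF enc])
  have "cring (?S\<lparr>zero := enc \<zero>\<^bsub>?K\<^esub>\<rparr>)" by (rule cring.ring_iso_imp_img_cring[OF K iso])
  then have S: "cring ?S" by (simp flip: image_ring_zero)
  have hom: "enc \<in> Ring.ring_hom ?K ?S" and surj: "enc ` carrier ?K = carrier ?S"
    using iso by (auto simp: ring_iso_def bij_betw_def)
  have "(enc \<circ> \<pi>) \<in> Ring.ring_hom ?A ?S" by (rule ring_hom_trans[OF \<pi> hom])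
  moreover have "range (enc \<circ> \<pi>) = carrier ?S" unfolding surj[symmetric] range[symmetric] by auto
  moreover have "(enc \<circ> \<pi>) t = \<zero>\<^bsub>?S\<^esub> \<longleftrightarrow> q dvd t" for t
  proof -
    have "\<pi> t \<in> carrier ?K" "\<zero>\<^bsub>?K\<^esub> \<in> carrier ?K"
      using range cring.cring_simprules(2)[OF K] by auto
    then show ?thesis unfolding zero[symmetric] image_ring_zero using inj_on_eq_iff[OF enc] by simp
  qed
  moreover have "finite (carrier ?S)" unfolding surj[symmetric] using fin by simp
  ultimately show ?thesis using S by blast
qed

end

section \<open>The residue ring of an Eisenstein polynomial and its type\<close>

context finite_local_setup begin

lemma residue_ring_extension:
  fixes q :: "'a omega poly"
  assumes neat: "a = e * Suc k" and q: "eisenstein q"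
    and S: "cring S" "finite (carrier S)"
    and \<phi>: "\<phi> \<in> Ring.ring_hom (whole :: 'a omega poly ring) S" "range \<phi> = carrier S"
    and kernel: "\<And>t. \<phi> t = \<zero>\<^bsub>S\<^esub> \<longleftrightarrow> q dvd t"
  shows "coefficient_extension (of_nat p :: 'a omega) k e a S (\<phi> [:0, 1:]) (\<lambda>c. \<phi> [:c:])"
    "eval_at S (\<lambda>c. \<phi> [:c:]) (\<phi> [:0, 1:]) q = \<zero>\<^bsub>S\<^esub>"
proof -
  let ?P = "of_nat p :: 'a omega"
  let ?j = "\<lambda>c. \<phi> [:c:]"
  define x where "x = \<phi> [:0, 1:]"
  interpret F: ring_eval S \<phi>
    by (intro ring_eval.intro ring_eval_axioms.intro S \<phi>)
  interpret J: ring_eval S ?j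
  proof (intro ring_eval.intro ring_eval_axioms.intro S ring_hom_memI)
    show "\<phi> [:\<one>\<^bsub>whole\<^esub>:] = \<one>\<^bsub>S\<^esub>" using F.j_simps(4) by simp
    show "\<phi> [:c \<otimes>\<^bsub>whole\<^esub> d:] = \<phi> [:c:] \<otimes>\<^bsub>S\<^esub> \<phi> [:d:]" for c d
      using F.j_simps(3)[of "[:c:]" "[:d:]"] by (simp add: mult.commute)
    show "\<phi> [:c \<oplus>\<^bsub>whole\<^esub> d:] = \<phi> [:c:] \<oplus>\<^bsub>S\<^esub> \<phi> [:d:]" for c d
      using F.j_simps(2)[of "[:c:]" "[:d:]"] by simp
  qed (rule F.j_simps)
  have x: "x \<in> carrier S" by (simp only: x_def F.j_simps)
  have split: "\<phi> (pCons c t) = ?j c \<oplus>\<^bsub>S\<^esub> x \<otimes>\<^bsub>S\<^esub> \<phi> t" for c t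
  proof -
    have "pCons c t = [:c:] + [:0, 1:] * t" by simp
    then show ?thesis unfolding x_def by (metis F.j_simps(2,3))
  qed
  have ev: "J.ev x t = \<phi> t" for t
  proof (induction t)
    case 0 show ?case by (simp only: J.ev_0 F.j_zero)
  next
    case (pCons c t) show ?case unfolding J.ev_pCons[OF x] split[of c t] pCons.IH ..
  qed
  have xpow: "x [^]\<^bsub>S\<^esub> n = \<phi> (Polynomial.monom 1 n)" for n
    using J.ev_monom[OF x, of 1 n] x unfolding ev by simp
  have q0: "J.ev x q = \<zero>\<^bsub>S\<^esub>" unfolding ev kernel by simp
  have nil: "x [^]\<^bsub>S\<^esub> a = \<zero>\<^bsub>S\<^esub>"
    unfolding xpow kernel neat by (rule eisenstein_dvd_X_power[OF q])
  \<comment> \<open>\<open>t\<close> is invertible modulo Y^a, and \<open>q\<close> divides Y^a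
    because neatness makes \<open>a\<close> equal to \<open>e * Suc k\<close>.\<close>
  have unit: "\<phi> t \<in> Units S" if t0: "poly.coeff t 0 dvd 1" for t
  proof -
    obtain s where "Polynomial.monom 1 a dvd t * s - 1" using inverse_mod_X_power[OF t0] by blast
    then have "q dvd t * s - 1" using eisenstein_dvd_X_power[OF q] neat dvd_trans by metis
    then have "\<phi> t \<otimes>\<^bsub>S\<^esub> \<phi> s \<ominus>\<^bsub>S\<^esub> \<one>\<^bsub>S\<^esub> = \<zero>\<^bsub>S\<^esub>"
      unfolding kernel[symmetric] F.j_diff F.j_simps .
    then have "\<phi> t \<otimes>\<^bsub>S\<^esub> \<phi> s = \<one>\<^bsub>S\<^esub>" by simp
    then show ?thesis unfolding Units_def using F.m_comm[of "\<phi> t" "\<phi> s"] by auto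
  qed
  \<comment> \<open>With q = Y^e + P y the relation q(x) = 0 reads P y(x) = - x^e, and y(x) is a
    unit; so the unit sought is the negative inverse of y(x).\<close>
  obtain v where v: "v \<in> Units S" "?j ?P = v \<otimes>\<^bsub>S\<^esub> x [^]\<^bsub>S\<^esub> e"
  proof -
    obtain y where y: "q = Polynomial.monom 1 e + smult ?P y" "poly.coeff y 0 dvd 1"
      by (rule eisenstein_decomposition[OF q])
    have yu: "\<phi> y \<in> Units S" by (rule unit[OF y(2)])
    have "x [^]\<^bsub>S\<^esub> e \<oplus>\<^bsub>S\<^esub> ?j ?P \<otimes>\<^bsub>S\<^esub> \<phi> y = \<zero>\<^bsub>S\<^esub>"
      using q0 unfolding y(1) J.ev_add[OF x] J.ev_smult[OF x] unfolding ev xpow .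
    then have P: "?j ?P \<otimes>\<^bsub>S\<^esub> \<phi> y = \<ominus>\<^bsub>S\<^esub> (x [^]\<^bsub>S\<^esub> e)"
      using x F.minus_equality[of "?j ?P \<otimes>\<^bsub>S\<^esub> \<phi> y" "x [^]\<^bsub>S\<^esub> e"] by (simp add: F.a_comm)
    define w where "w = inv\<^bsub>S\<^esub> (\<phi> y)"
    have w: "w \<in> carrier S" "\<phi> y \<otimes>\<^bsub>S\<^esub> w = \<one>\<^bsub>S\<^esub>" using yu by (simp_all add: w_def)
    have c: "?j ?P \<in> carrier S" "\<phi> y \<in> carrier S" "x [^]\<^bsub>S\<^esub> e \<in> carrier S" using x by simp_all
    have "?j ?P = (?j ?P \<otimes>\<^bsub>S\<^esub> \<phi> y) \<otimes>\<^bsub>S\<^esub> w" using w c by (simp only: F.m_assoc F.r_one)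
    also have "\<dots> = (\<ominus>\<^bsub>S\<^esub> w) \<otimes>\<^bsub>S\<^esub> x [^]\<^bsub>S\<^esub> e" unfolding P using w(1) c(3) by algebra
    finally have "?j ?P = (\<ominus>\<^bsub>S\<^esub> w) \<otimes>\<^bsub>S\<^esub> x [^]\<^bsub>S\<^esub> e" .
    moreover have "\<ominus>\<^bsub>S\<^esub> w \<in> Units S"
    proof -
      have "(\<ominus>\<^bsub>S\<^esub> w) \<otimes>\<^bsub>S\<^esub> (\<ominus>\<^bsub>S\<^esub> \<phi> y) = \<phi> y \<otimes>\<^bsub>S\<^esub> w" using w(1) c(2) by algebra
      then have 1: "(\<ominus>\<^bsub>S\<^esub> w) \<otimes>\<^bsub>S\<^esub> (\<ominus>\<^bsub>S\<^esub> \<phi> y) = \<one>\<^bsub>S\<^esub>" unfolding w(2) .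
      have m: "\<ominus>\<^bsub>S\<^esub> w \<in> carrier S" "\<ominus>\<^bsub>S\<^esub> \<phi> y \<in> carrier S"
        using w(1) c(2) by (simp_all only: F.a_inv_closed)
      have 2: "(\<ominus>\<^bsub>S\<^esub> \<phi> y) \<otimes>\<^bsub>S\<^esub> (\<ominus>\<^bsub>S\<^esub> w) = \<one>\<^bsub>S\<^esub>"
        unfolding F.m_comm[OF m(2,1)] by (rule 1)
      show ?thesis
        unfolding Units_def by (rule CollectI) (intro conjI m(1) bexI[OF _ m(2)] 1 2)
    qed
    ultimately show ?thesis using that by blast
  qed
  have chain: "finite_chain_ring S x a"
  proof (intro finite_chain_ring.intro finite_chain_ring_axioms.intro S x nil R.a_pos)
    fix z assume "z \<in> carrier S"
    then obtain t where z: "z = \<phi> t" using \<phi>(2) by blast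
    show "z \<in> Units S \<or> (\<exists>y\<in>carrier S. z = x \<otimes>\<^bsub>S\<^esub> y)"
    proof (cases "poly.coeff t 0 dvd 1")
      case True then show ?thesis using unit z by blast
    next
      case False
      obtain c s where t: "t = pCons c s" by (cases t)
      then have "?P dvd c" using False omega_p_dvd_or_unit[of c] by simp
      then obtain d where d: "c = ?P * d" by (auto elim: dvdE)
      have "?j c = v \<otimes>\<^bsub>S\<^esub> x [^]\<^bsub>S\<^esub> e \<otimes>\<^bsub>S\<^esub> ?j d" unfolding d J.j_simps(3) v(2) ..
      also have "x [^]\<^bsub>S\<^esub> e = x \<otimes>\<^bsub>S\<^esub> x [^]\<^bsub>S\<^esub> (e - 1)"
        using e_pos x F.nat_pow_Suc2[OF x, of "e - 1"] by simp
      also have "v \<otimes>\<^bsub>S\<^esub> (x \<otimes>\<^bsub>S\<^esub> x [^]\<^bsub>S\<^esub> (e - 1)) \<otimes>\<^bsub>S\<^esub> ?j d =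
          x \<otimes>\<^bsub>S\<^esub> (v \<otimes>\<^bsub>S\<^esub> x [^]\<^bsub>S\<^esub> (e - 1) \<otimes>\<^bsub>S\<^esub> ?j d)"
        using v(1) x F.nat_pow_closed[OF x, of "e - 1"] by (simp add: F.m_ac F.Units_closed)
      finally have "z = x \<otimes>\<^bsub>S\<^esub> (v \<otimes>\<^bsub>S\<^esub> x [^]\<^bsub>S\<^esub> (e - 1) \<otimes>\<^bsub>S\<^esub> ?j d) \<oplus>\<^bsub>S\<^esub> x \<otimes>\<^bsub>S\<^esub> \<phi> s"
        unfolding z t split[of c s] by (simp only:)
      then have "z = x \<otimes>\<^bsub>S\<^esub> (v \<otimes>\<^bsub>S\<^esub> x [^]\<^bsub>S\<^esub> (e - 1) \<otimes>\<^bsub>S\<^esub> ?j d \<oplus>\<^bsub>S\<^esub> \<phi> s)"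
        using v(1) x by (simp add: F.r_distr F.Units_closed)
      then show ?thesis using v(1) x by (auto simp: F.Units_closed)
    qed
  next
    \<comment> \<open>Up to a unit this power is P^k x^(e-1), since a - 1 = e k + (e - 1). If it
      vanished, \<open>q\<close> would divide P^k Y^(e-1), whose degree is too small, and P^k would
      be 0.\<close>
    show "x [^]\<^bsub>S\<^esub> (a - 1) \<noteq> \<zero>\<^bsub>S\<^esub>"
    proof
      assume z: "x [^]\<^bsub>S\<^esub> (a - 1) = \<zero>\<^bsub>S\<^esub>"
      have "?j ?P [^]\<^bsub>S\<^esub> k = v [^]\<^bsub>S\<^esub> k \<otimes>\<^bsub>S\<^esub> x [^]\<^bsub>S\<^esub> (e * k)"
        unfolding v(2) using v(1) x by (simp add: F.nat_pow_distrib F.nat_pow_pow F.Units_closed)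
      moreover have "x [^]\<^bsub>S\<^esub> (e * k) \<otimes>\<^bsub>S\<^esub> x [^]\<^bsub>S\<^esub> (e - 1) = x [^]\<^bsub>S\<^esub> (a - 1)"
      proof -
        have "e * k + (e - 1) = a - 1" using e_pos by (simp add: neat)
        then show ?thesis using F.nat_pow_mult[OF x, of "e * k" "e - 1"] by simp
      qed
      ultimately have "?j ?P [^]\<^bsub>S\<^esub> k \<otimes>\<^bsub>S\<^esub> x [^]\<^bsub>S\<^esub> (e - 1) = \<zero>\<^bsub>S\<^esub>"
        using z v(1) x by (simp add: F.m_assoc F.Units_closed)
      moreover have "\<phi> (smult (?P ^ k) (Polynomial.monom 1 (e - 1))) =
          ?j (?P ^ k) \<otimes>\<^bsub>S\<^esub> x [^]\<^bsub>S\<^esub> (e - 1)"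
        unfolding xpow using J.ev_smult[OF x, of "?P ^ k" "Polynomial.monom 1 (e - 1)"] unfolding ev .
      ultimately have "\<phi> (smult (?P ^ k) (Polynomial.monom 1 (e - 1))) = \<zero>\<^bsub>S\<^esub>"
        unfolding J.j_pow by (rule trans[rotated])
      then have "q dvd smult (?P ^ k) (Polynomial.monom 1 (e - 1))" unfolding kernel .
      moreover have "Polynomial.degree (smult (?P ^ k) (Polynomial.monom 1 (e - 1))) < Polynomial.degree q"
        unfolding eisensteinD(1)[OF q] using e_pos
        by (intro le_less_trans[OF degree_smult_le] le_less_trans[OF degree_monom_le]) simp
      ultimately have "smult (?P ^ k) (Polynomial.monom 1 (e - 1)) = 0"
        by (rule monic_dvd_small_degree[OF eisensteinD(2)[OF q]])
      then have "?P ^ k = 0" by (simp add: smult_monom)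
      then show False using P_power by blast
    qed
  qed
  interpret X: finite_chain_ring S x a by (rule chain)
  show "coefficient_extension ?P k e a S (\<phi> [:0, 1:]) ?j"
    unfolding x_def[symmetric]
  proof unfold_locales
    show "\<exists>v\<in>Units S. ?j ?P = v \<otimes>\<^bsub>S\<^esub> x [^]\<^bsub>S\<^esub> e" using v by blast
  next
    fix z assume "z \<in> carrier S"
    then obtain t where z: "z = \<phi> t" using \<phi>(2) by blast
    obtain c s where t: "t = pCons c s" by (cases t)
    have "z \<ominus>\<^bsub>S\<^esub> ?j c = x \<otimes>\<^bsub>S\<^esub> \<phi> s"
      unfolding z t split[of c s] using x F.j_simps(1)[of "[:c:]"] F.j_simps(1)[of s] by algebra
    moreover have "x \<otimes>\<^bsub>S\<^esub> \<phi> s \<in> X.V 1" by (rule X.V_mult_r[OF X.u_V]) simp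
    ultimately show "\<exists>c. z \<ominus>\<^bsub>S\<^esub> ?j c \<in> X.V 1" by metis
  qed
  show "eval_at S ?j (\<phi> [:0, 1:]) q = \<zero>\<^bsub>S\<^esub>" using q0 unfolding x_def .
qed

text \<open>Characteristic, residue degree and ramification index are determined by
  \<open>P\<close>, \<open>e\<close> and the coefficient ring. What remains is that \<open>j\<close>
  hits precisely the coefficient ring of \<open>S\<close>, which is generated by its own
  Teichmueller representatives.\<close>

lemma extension_of_type:
  assumes X: "coefficient_extension (of_nat p :: 'a omega) k e a S x j"
  shows "(S, j \<circ> Abs_omega) \<in> rings_of_type \<tau>"
proof -
  interpret X: coefficient_extension "of_nat p :: 'a omega" k e a S x j by fact
  have char: "residue_char S = p"
    using X.residue_char_coefficients E.residue_char_coefficients p_def by simp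
  have "p ^ residue_degree S = p ^ f"
    using X.card_residue E.card_residue_coefficients X.card_residue_coefficients R.card_residue
    by (simp add: char p_def f_def)
  then have degree: "residue_degree S = f" using prime_gt_1_nat[OF prime_p] by (simp add: power_inject_exp)
  have ram: "ramification_index S = e"
    using X.ramification_of_P by (simp add: ramification_index_def char X.j_num)
  have type: "type_of_ring S = \<tau>"
    by (simp add: type_of_ring_def \<tau>_def char degree ram X.nilpotency_index)
  have Q: "X.Q = p ^ f" by (simp add: X.Q_def char degree)
  \<comment> \<open>Every residue class of \<open>S\<close> contains j(c) for some \<open>c\<close>,
    which may be exchanged for the Teichmueller element \<open>d\<close> of its class; uniqueness of
    representatives in \<open>S\<close> then gives r = j(d).\<close>
  have reps: "residue_reps S = j ` {c. c ^ (p ^ f) = c}"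
  proof
    show "j ` {c. c ^ (p ^ f) = c} \<subseteq> residue_reps S"
      by (auto simp: X.residue_reps_eq Q simp flip: X.j_pow)
    show "residue_reps S \<subseteq> j ` {c. c ^ (p ^ f) = c}"
    proof
      fix r assume r: "r \<in> residue_reps S"
      then have rc: "r \<in> carrier S" by (simp add: X.residue_reps_eq)
      obtain c where c: "r \<ominus>\<^bsub>S\<^esub> j c \<in> X.V 1" using X.j_residue[OF rc] by blast
      obtain r0 where r0: "r0 \<in> residue_reps (whole :: 'a ring)" "Rep_omega c \<ominus>\<^bsub>whole\<^esub> r0 \<in> R.V 1"
        using R.residue_reps_exist[of "Rep_omega c"] by auto
      then have "r0 \<in> range Rep_omega" unfolding range_Rep_omega carrier_coeff_ring by (intro generate_ring.incl)
      then obtain d where d: "r0 = Rep_omega d" by auto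
      have "Rep_omega (d ^ (p ^ f)) = Rep_omega d"
        using r0(1) by (simp add: R.residue_reps_eq R_Q d hom_distribs)
      then have dQ: "d ^ (p ^ f) = d" by (simp only: Rep_omega_inject)
      have "Rep_omega (c - d) \<in> R.V 1" using r0(2) by (simp add: d hom_distribs)
      then have "of_nat p dvd c - d" by (simp only: E.j_V1_iff)
      then have "j (c - d) \<in> X.V 1" by (simp only: X.j_V1_iff)
      then have "(r \<ominus>\<^bsub>S\<^esub> j c) \<oplus>\<^bsub>S\<^esub> j (c - d) \<in> X.V 1" using c by (intro X.V_add)
      also have "(r \<ominus>\<^bsub>S\<^esub> j c) \<oplus>\<^bsub>S\<^esub> j (c - d) = r \<ominus>\<^bsub>S\<^esub> j d"
        unfolding X.j_diff using rc X.j_simps(1)[of c] X.j_simps(1)[of d] by algebra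
      finally have rd: "r \<ominus>\<^bsub>S\<^esub> j d \<in> X.V 1" .
      have "j d \<in> residue_reps S" using dQ by (simp add: X.residue_reps_eq Q flip: X.j_pow)
      then have "r = j d" using X.residue_reps_unique[OF r _ rd] by blast
      then show "r \<in> j ` {c. c ^ (p ^ f) = c}" using dQ by blast
    qed
  qed
  have coeff: "carrier (coeff_ring S) = range j"
  proof
    have "z \<in> range j" if "z \<in> generate_ring S (residue_reps S)" for z
      using that
    proof (induction rule: generate_ring.induct)
      case one show ?case using X.j_simps(4) by (metis rangeI)
    next
      case (incl h) then show ?case unfolding reps by blast
    next
      case (a_inv h) then show ?case by (auto simp flip: X.j_minus)
    next
      case (eng_add h1 h2) then show ?case by (auto simp flip: X.j_simps(2))
    next
      case (eng_mult h1 h2) then show ?case by (auto simp flip: X.j_simps(3))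
    qed
    then show "carrier (coeff_ring S) \<subseteq> range j" unfolding carrier_coeff_ring by blast
    have "\<exists>c. Rep_omega c = r \<and> j c \<in> generate_ring S (residue_reps S)"
      if "r \<in> generate_ring whole (residue_reps (whole :: 'a ring))" for r
      using that
    proof (induction rule: generate_ring.induct)
      case one
      then show ?case using generate_ring.one by (intro exI[of _ 1]) (simp add: X.j_simps(4))
    next
      case (incl h)
      then have "h \<in> range Rep_omega" unfolding range_Rep_omega carrier_coeff_ring by (rule generate_ring.incl)
      then obtain c where c: "Rep_omega c = h" by auto
      have "Rep_omega (c ^ (p ^ f)) = Rep_omega c" using incl c by (simp add: R.residue_reps_eq R_Q hom_distribs)
      then have "c ^ (p ^ f) = c" by (simp only: Rep_omega_inject)
      then have "j c \<in> residue_reps S" unfolding reps by blast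
      then show ?case using c generate_ring.incl by (intro exI[of _ c]) auto
    next
      case (a_inv h)
      then obtain c where c: "Rep_omega c = h" "j c \<in> generate_ring S (residue_reps S)" by blast
      then show ?case using generate_ring.a_inv[OF c(2)] by (intro exI[of _ "- c"]) (simp add: hom_distribs)
    next
      case (eng_add h1 h2)
      then obtain c d where c: "Rep_omega c = h1" "j c \<in> generate_ring S (residue_reps S)"
        "Rep_omega d = h2" "j d \<in> generate_ring S (residue_reps S)" by blast
      then show ?case using generate_ring.eng_add[OF c(2,4)] by (intro exI[of _ "c + d"]) (simp add: hom_distribs)
    next
      case (eng_mult h1 h2)
      then obtain c d where c: "Rep_omega c = h1" "j c \<in> generate_ring S (residue_reps S)"
        "Rep_omega d = h2" "j d \<in> generate_ring S (residue_reps S)" by blast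
      then show ?case using generate_ring.eng_mult[OF c(2,4)] by (intro exI[of _ "c * d"]) (simp add: hom_distribs)
    qed
    then have "j c \<in> carrier (coeff_ring S)" for c
      using Rep_omega[of c] unfolding carrier_coeff_ring by (metis Rep_omega_inject)
    then show "range j \<subseteq> carrier (coeff_ring S)" by blast
  qed
  have "j \<circ> Abs_omega \<in> ring_iso (coeff_ring (whole :: 'a ring)) (coeff_ring S)"
  proof (rule ring_iso_memI)
    have inj: "inj_on (j \<circ> Abs_omega) (carrier (coeff_ring (whole :: 'a ring)))"
      unfolding range_Rep_omega[symmetric]
      by (rule inj_onI) (auto simp: Rep_omega_inverse dest: X.j_inj)
    show "bij_betw (j \<circ> Abs_omega) (carrier (coeff_ring (whole :: 'a ring))) (carrier (coeff_ring S))"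
      unfolding bij_betw_def using inj
      by (simp add: coeff image_image Rep_omega_inverse flip: range_Rep_omega)
    show "(j \<circ> Abs_omega) \<one>\<^bsub>coeff_ring (whole :: 'a ring)\<^esub> = \<one>\<^bsub>coeff_ring S\<^esub>"
      using X.j_simps(4) by (simp add: one_omega_def)
  next
    fix z assume "z \<in> carrier (coeff_ring (whole :: 'a ring))"
    then show "(j \<circ> Abs_omega) z \<in> carrier (coeff_ring S)" by (simp add: coeff)
  next
    fix y z assume "y \<in> carrier (coeff_ring (whole :: 'a ring))" "z \<in> carrier (coeff_ring (whole :: 'a ring))"
    then have "y \<in> range Rep_omega" "z \<in> range Rep_omega" by (simp_all only: range_Rep_omega)
    then obtain c d where cd: "y = Rep_omega c" "z = Rep_omega d" by (elim imageE)
    have "Abs_omega (Rep_omega c * Rep_omega d) = c * d" "Abs_omega (Rep_omega c + Rep_omega d) = c + d"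
      by (metis Rep_omega_inverse Rep.hom_mult) (metis Rep_omega_inverse Rep.hom_add)
    then show "(j \<circ> Abs_omega) (y \<otimes>\<^bsub>coeff_ring whole\<^esub> z) = (j \<circ> Abs_omega) y \<otimes>\<^bsub>coeff_ring S\<^esub> (j \<circ> Abs_omega) z"
      "(j \<circ> Abs_omega) (y \<oplus>\<^bsub>coeff_ring whole\<^esub> z) = (j \<circ> Abs_omega) y \<oplus>\<^bsub>coeff_ring S\<^esub> (j \<circ> Abs_omega) z"
      by (simp_all add: cd Rep_omega_inverse)
  qed
  then show ?thesis using type X.finite_local_pir by (simp add: rings_of_type_def)
qed

text \<open>The map that sends a ring with its identification to the set of Eisenstein polynomials
  having a zero in it has the isomorphism classes as fibres. Each value is a single orbit, and each
  orbit arises, namely from the residue ring of one of its members.\<close>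

lemma classes_bij_orbits:
  assumes "neat (whole :: 'a ring)"
  shows "\<exists>F. bij_betw F (rings_of_type \<tau> // iso_of_type \<tau>)
               (orbits subst_group (eisenstein_polys :: 'a poly set) poly_action) \<and>
             (\<forall>(S, \<iota>) \<in> rings_of_type \<tau>. F (iso_of_type \<tau> `` {(S, \<iota>)}) = eisenstein_with_zero_in S \<iota>)"
proof -
  have neat: "a = e * Suc k" using assms neat_iff by blast
  let ?g = "\<lambda>(S, \<iota>). eisenstein_with_zero_in S \<iota> :: 'a poly set"
  have "?g ` rings_of_type \<tau> = orbits subst_group eisenstein_polys poly_action"
  proof
    show "?g ` rings_of_type \<tau> \<subseteq> orbits subst_group eisenstein_polys poly_action"
    proof clarify
      fix S \<iota> assume S: "(S, \<iota> :: 'a \<Rightarrow> nat) \<in> rings_of_type \<tau>"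
      obtain y where "coefficient_extension (of_nat p :: 'a omega) k e a S y (\<iota> \<circ> Rep_omega)"
        using coefficient_extension_of_type[OF S] by blast
      then interpret X: coefficient_extension "of_nat p :: 'a omega" k e a S y "\<iota> \<circ> Rep_omega" .
      obtain q where q: "eisenstein q" "X.ev y q = \<zero>\<^bsub>S\<^esub>" using X.eisenstein_zero_exists by blast
      then have "emb q \<in> eisenstein_with_zero_in S \<iota>"
        unfolding eisenstein_with_zero_in_eq[OF S] using X.u_closed by (intro imageI) auto
      from eisenstein_with_zero_in_orbit[OF neat S this]
      show "eisenstein_with_zero_in S \<iota> \<in> orbits subst_group eisenstein_polys poly_action"
        using q(1) by (auto simp: orbits_def emb_eisenstein)
    qed
    show "orbits subst_group eisenstein_polys poly_action \<subseteq> ?g ` rings_of_type \<tau>"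
    proof
      fix \<Omega> :: "'a poly set" assume "\<Omega> \<in> orbits subst_group eisenstein_polys poly_action"
      then obtain q where q: "eisenstein q" "\<Omega> = orbit subst_group poly_action (emb q)"
        by (auto simp: orbits_def eisenstein_polys_eq)
      obtain S :: "nat ring" and \<phi> where S: "cring S" "finite (carrier S)"
        "\<phi> \<in> Ring.ring_hom (whole :: 'a omega poly ring) S" "range \<phi> = carrier S"
        "\<forall>t. \<phi> t = \<zero>\<^bsub>S\<^esub> \<longleftrightarrow> q dvd t"
        using finite_residue_ring[OF eisensteinD(2)[OF q(1)]] by (elim exE conjE)
      define j where "j = (\<lambda>c. \<phi> [:c:])"
      have X: "coefficient_extension (of_nat p :: 'a omega) k e a S (\<phi> [:0, 1:]) j"
        and zero: "eval_at S j (\<phi> [:0, 1:]) q = \<zero>\<^bsub>S\<^esub>"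
        unfolding j_def by (rule residue_ring_extension[OF neat q(1) S(1-4) S(5)[rule_format]])+
      have type: "(S, j \<circ> Abs_omega) \<in> rings_of_type \<tau>" by (rule extension_of_type[OF X])
      have "(j \<circ> Abs_omega) \<circ> Rep_omega = j" by (simp add: fun_eq_iff Rep_omega_inverse)
      then have "emb q \<in> eisenstein_with_zero_in S (j \<circ> Abs_omega)"
        using zero q(1) ring_hom_closed[OF S(3), of "[:0, 1:]"]
        unfolding eisenstein_with_zero_in_eq[OF type] by (intro imageI) auto
      then have "\<Omega> = ?g (S, j \<circ> Abs_omega)"
        using eisenstein_with_zero_in_orbit[OF neat type] q(2) by simp
      then show "\<Omega> \<in> ?g ` rings_of_type \<tau>" using type by (rule image_eqI)
    qed
  qed
  moreover have "(x, y) \<in> iso_of_type \<tau> \<longleftrightarrow> x \<in> rings_of_type \<tau> \<and> y \<in> rings_of_type \<tau> \<and> ?g x = ?g y" for x y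
    using same_zeros_if_iso iso_if_same_zeros[OF neat]
    by (cases x; cases y) (auto simp: iso_of_type_def)
  from quotient_bij_betw[OF this] obtain F where
    "bij_betw F (rings_of_type \<tau> // iso_of_type \<tau>) (?g ` rings_of_type \<tau>)"
    "\<forall>x\<in>rings_of_type \<tau>. F (iso_of_type \<tau> `` {x}) = ?g x" by blast
  ultimately show ?thesis by (intro exI[of _ F]) auto
qed

end

theorem theorem3:
  fixes a e f p :: nat and \<Delta> :: "'a::comm_ring_1 poly set"
  assumes "finite_local_pir (whole :: 'a ring)"
    and "signature = (a, e, f, p, \<Delta>)"
    and "e < a"
  shows
    "group_action subst_group (eisenstein_polys :: 'a poly set) poly_action \<and>
     (\<exists>\<O> \<subseteq> orbits subst_group eisenstein_polys poly_action. \<Delta> = \<Union>\<O>) \<and>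
     (neat (whole :: 'a ring) \<longrightarrow>
        (\<forall>\<pi> \<in> uniformizers whole. \<forall>\<epsilon> \<in> Units whole. of_nat p = \<epsilon> * \<pi> ^ e \<longrightarrow>
           \<Delta> = orbit subst_group poly_action (hensel_factor \<pi> \<epsilon>))) \<and>
     (\<forall>q \<in> \<Delta>. \<forall>u \<in> uniformizers whole. \<exists>q' \<in> orbit subst_group poly_action q. poly q' u = 0) \<and>
     (\<forall>\<Omega> \<in> orbits subst_group (eisenstein_polys :: 'a poly set) poly_action.
        \<forall>q \<in> \<Omega>. \<forall>q' \<in> \<Omega>. card {x. poly q x = 0} = card {x. poly q' x = 0}) \<and>
     transitive_action subst_group (uniformizers (whole :: 'a ring)) unif_action \<and>
     (\<forall>q \<in> \<Delta>. \<forall>u \<in> uniformizers whole. poly q u = 0 \<longrightarrow>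
        (\<forall>t \<in> carrier subst_group. poly (poly_action t q) (unif_action t u) = 0)) \<and>
     (neat (whole :: 'a ring) \<longrightarrow>
        (\<forall>u \<in> uniformizers whole. \<exists>!q. q \<in> \<Delta> \<and> poly q u = 0) \<and>
        (let \<theta> = (\<lambda>u. THE q. q \<in> \<Delta> \<and> poly q u = 0)
         in \<theta> ` uniformizers whole = \<Delta> \<and>
            (\<forall>t \<in> carrier subst_group. \<forall>u \<in> uniformizers whole.
               \<theta> (unif_action t u) = poly_action t (\<theta> u)))) \<and>
     (neat (whole :: 'a ring) \<longrightarrow>
        (\<exists>F. bij_betw F (rings_of_type (a, e, f, p) // iso_of_type (a, e, f, p))
               (orbits subst_group (eisenstein_polys :: 'a poly set) poly_action) \<and>
             (\<forall>(S, \<iota>) \<in> rings_of_type (a, e, f, p).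
                F (iso_of_type (a, e, f, p) `` {(S, \<iota>)}) = eisenstein_with_zero_in S \<iota>)))"
proof -
  have sig: "nilpotency_index (whole :: 'a ring) = a" "ramification_index (whole :: 'a ring) = e"
    "residue_degree (whole :: 'a ring) = f" "residue_char (whole :: 'a ring) = p"
    "\<Delta> = eisenstein_with_zero"
    using assms(2) by (simp_all add: signature_def)
  obtain u where "finite_chain_ring (whole :: 'a ring) u a"
    using finite_local_pir_chain[OF assms(1)] sig(1) by auto
  then interpret finite_local_setup u a e "(a - 1) div e" p f
    by (intro finite_local_setup.intro sig assms(3)) simp_all
  \<comment> \<open>The uniformizer in the statement about g is arbitrary, so the setting is
    instantiated again at \<open>\<pi>\<close>; the orbits do not depend on this choice.\<close>
  have hensel: "eisenstein_with_zero = orbit subst_group poly_action (hensel_factor \<pi> \<epsilon>)"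
    if neat: "neat (whole :: 'a ring)" and \<pi>: "\<pi> \<in> uniformizers whole"
      and \<epsilon>: "\<epsilon> \<in> Units whole" "of_nat p = \<epsilon> * \<pi> ^ e" for \<pi> \<epsilon> :: 'a
  proof -
    interpret X: finite_local_setup \<pi> a e "(a - 1) div e" p f by (rule setup_at[OF \<pi>])
    show ?thesis
      by (rule eisenstein_with_zero_orbit[OF neat X.hensel_factor[OF neat \<epsilon>]])
  qed
  have zeros: "poly (poly_action t q) (unif_action t x) = 0"
    if "q \<in> eisenstein_with_zero" "poly q x = 0" "t \<in> carrier subst_group" for q t and x :: 'a
    using that poly_action_zero unfolding eisenstein_with_zero_def by blast
  show ?thesis
    unfolding sig(5)
    by (intro conjI)
      ((rule group_action_polys eisenstein_with_zero_orbits transitive_action_uniformizers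
        | (rule impI, rule neat_epimorphism classes_bij_orbits[unfolded \<tau>_def], assumption)
        | (intro impI ballI,
           (rule hensel uniformizer_zero_in_orbit card_zeros_orbit zeros; assumption)))+)
qed

end
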